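(* Let $G$ be a square-free Berge graph, and suppose that $V(G)$ has a good partition $(K_1,K_2,K_3,L,R)$. Let $G_1=G\setminus R$ and $G_2=G\setminus L$, and for $i=1,2$ let $c_i$ be a proper $\omega(G_i)$-coloring of $G_i$. Then a proper $\omega(G)$-coloring of $G$ can be obtained in polynomial time (that is, there is a polynomial-time algorithm which, given $G$, the good partition, $c_1$ and $c_2$, outputs a proper coloring of $G$ with $\omega(G)$ colors).
   Context: Graphs are finite and simple; "path" means induced (chordless) path, and the interior $P^*$ of a path $P$ is the set of its vertices other than its two ends. $\omega(G)$ is the maximum size of a clique of $G$; a $k$-coloring is a proper vertex-coloring with $k$ colors. For a vertex set $X$, $G\setminus X$ is the subgraph induced by $V(G)\setminus X$. A hole is an induced cycle with at least four vertices; an antihole is the complement of a hole. A graph is Berge if it contains (as an induced subgraph) no odd hole and no odd antihole. A graph is square-free if it has no induced cycle of length four. For disjoint vertex sets $S,T$, $S$ is complete (anticomplete) to $T$ if every vertex of $S$ is adjacent (non-adjacent) to every vertex of $T$; the same terms are used for a single vertex in place of $S$. $N(v)$ is the set of neighbors of $v$. A triad is a set of three pairwise non-adjacent vertices. A good partition of a graph $G$ is a partition $(K_1,K_2,K_3,L,R)$ of $V(G)$ (where $K_1,K_2,K_3$ may be empty) such that: (i) $L$ and $R$ are not empty, and $L$ is anticomplete to $R$; (ii) $K_1\cup K_2$ and $K_2\cup K_3$ are cliques; (iii) if $P=p_1-\cdots-p_k$ is a path with $p_1\in K_1$, $p_k\in K_3$, $k\ge 3$ and $P^*\subseteq L$,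 then $p_2$ is complete to $K_1$; (iv) either $K_1$ is anticomplete to $K_3$, or for every $v\in L$ the set $N(v)\cap K_1$ is complete to $N(v)\cap K_3$; (v) for some $x\in L$ and $y\in R$, there is a triad of $G$ that contains $\{x,y\}$. *)

theory Defs
  imports "Graph_Theory.Graph_Theory" "HOL-Computational_Algebra.Polynomial"
begin

section \<open>Graph notions\<close>

text \<open>
  Finite simple graphs are the symmetric loop-free digraphs of Graph_Theory (locales
  \<open>graph\<close> and \<open>pair_graph\<close>); adjacency is \<open>u \<rightarrow>\<^bsub>G\<^esub> v\<close> and the subgraph induced by
  \<open>X \<subseteq> verts G\<close> is \<open>G \<restriction> X\<close>.
\<close>

definition complement :: "('a, 'b) pre_digraph \<Rightarrow> ('a, 'a \<times> 'a) pre_digraph" where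
  "complement G = with_proj
     \<lparr> pverts = verts G,
       parcs = {(u, v). u \<in> verts G \<and> v \<in> verts G \<and> u \<noteq> v \<and> \<not> u \<rightarrow>\<^bsub>G\<^esub> v} \<rparr>"

definition complete_to :: "('a, 'b) pre_digraph \<Rightarrow> 'a set \<Rightarrow> 'a set \<Rightarrow> bool" where
  "complete_to G S T \<longleftrightarrow> (\<forall>s\<in>S. \<forall>t\<in>T. s \<rightarrow>\<^bsub>G\<^esub> t)"

definition anticomplete_to :: "('a, 'b) pre_digraph \<Rightarrow> 'a set \<Rightarrow> 'a set \<Rightarrow> bool" where
  "anticomplete_to G S T \<longleftrightarrow> (\<forall>s\<in>S. \<forall>t\<in>T. \<not> s \<rightarrow>\<^bsub>G\<^esub> t)"

definition nbrs :: "('a, 'b) pre_digraph \<Rightarrow> 'a \<Rightarrow> 'a set" where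
  "nbrs G v = {u \<in> verts G. v \<rightarrow>\<^bsub>G\<^esub> u}"

definition clique :: "('a, 'b) pre_digraph \<Rightarrow> 'a set \<Rightarrow> bool" where
  "clique G X \<longleftrightarrow> X \<subseteq> verts G \<and> (\<forall>u\<in>X. \<forall>v\<in>X. u \<noteq> v \<longrightarrow> u \<rightarrow>\<^bsub>G\<^esub> v)"

definition clique_number :: "('a, 'b) pre_digraph \<Rightarrow> nat" where
  "clique_number G = Max (card ` {X. clique G X})"

definition proper_coloring :: "('a, 'b) pre_digraph \<Rightarrow> nat \<Rightarrow> ('a \<Rightarrow> nat) \<Rightarrow> bool" where
  "proper_coloring G k c \<longleftrightarrow>
     c ` verts G \<subseteq> {..<k} \<and> (\<forall>u\<in>verts G. \<forall>v\<in>verts G. u \<rightarrow>\<^bsub>G\<^esub> v \<longrightarrow> c u \<noteq> c v)"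

definition triad :: "('a, 'b) pre_digraph \<Rightarrow> 'a set \<Rightarrow> bool" where
  "triad G T \<longleftrightarrow> T \<subseteq> verts G \<and> card T = 3 \<and> (\<forall>u\<in>T. \<forall>v\<in>T. u \<noteq> v \<longrightarrow> \<not> u \<rightarrow>\<^bsub>G\<^esub> v)"

text \<open>Paths are chordless: the only adjacencies are those between consecutive vertices.\<close>

definition chordless_path :: "('a, 'b) pre_digraph \<Rightarrow> 'a list \<Rightarrow> bool" where
  "chordless_path G p \<longleftrightarrow>
     p \<noteq> [] \<and> distinct p \<and> set p \<subseteq> verts G \<and>
     (\<forall>i<length p. \<forall>j<length p. p ! i \<rightarrow>\<^bsub>G\<^esub> p ! j \<longleftrightarrow> j = Suc i \<or> i = Suc j)"

definition path_interior :: "'a list \<Rightarrow> 'a set" where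
  "path_interior p = set p - {hd p, last p}"

text \<open>
  The predicates \<open>cycle_graph\<close>, \<open>hole\<close> and \<open>antihole\<close> are about a whole graph; they are
  applied to induced subgraphs of the graph under study.
\<close>

definition cycle_graph :: "('a, 'b) pre_digraph \<Rightarrow> bool" where
  "cycle_graph H \<longleftrightarrow>
     (\<exists>c. length c \<ge> 3 \<and> distinct c \<and> set c = verts H \<and>
        (\<forall>i<length c. \<forall>j<length c. c ! i \<rightarrow>\<^bsub>H\<^esub> c ! j \<longleftrightarrow>
           j = Suc i mod length c \<or> i = Suc j mod length c))"

definition hole :: "('a, 'b) pre_digraph \<Rightarrow> bool" where
  "hole H \<longleftrightarrow> cycle_graph H \<and> card (verts H) \<ge> 4"

definition antihole :: "('a, 'b) pre_digraph \<Rightarrow> bool" where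
  "antihole H \<longleftrightarrow> hole (complement H)"

definition berge :: "('a, 'b) pre_digraph \<Rightarrow> bool" where
  "berge G \<longleftrightarrow>
     \<not> (\<exists>X\<subseteq>verts G. odd (card X) \<and> (hole (G \<restriction> X) \<or> antihole (G \<restriction> X)))"

definition square_free :: "('a, 'b) pre_digraph \<Rightarrow> bool" where
  "square_free G \<longleftrightarrow> \<not> (\<exists>X\<subseteq>verts G. card X = 4 \<and> cycle_graph (G \<restriction> X))"

definition good_partition ::
  "('a, 'b) pre_digraph \<Rightarrow> 'a set \<Rightarrow> 'a set \<Rightarrow> 'a set \<Rightarrow> 'a set \<Rightarrow> 'a set \<Rightarrow> bool" where
  "good_partition G K1 K2 K3 L R \<longleftrightarrow>
     K1 \<union> K2 \<union> K3 \<union> L \<union> R = verts G \<and>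
     K1 \<inter> K2 = {} \<and> (K1 \<union> K2) \<inter> K3 = {} \<and> (K1 \<union> K2 \<union> K3) \<inter> L = {} \<and>
     (K1 \<union> K2 \<union> K3 \<union> L) \<inter> R = {} \<and>
     L \<noteq> {} \<and> R \<noteq> {} \<and> anticomplete_to G L R \<and>
     clique G (K1 \<union> K2) \<and> clique G (K2 \<union> K3) \<and>
     (\<forall>p. chordless_path G p \<and> hd p \<in> K1 \<and> last p \<in> K3 \<and> length p \<ge> 3 \<and> path_interior p \<subseteq> L
          \<longrightarrow> complete_to G {p ! 1} K1) \<and>
     (anticomplete_to G K1 K3 \<or>
      (\<forall>v\<in>L. complete_to G (nbrs G v \<inter> K1) (nbrs G v \<inter> K3))) \<and>
     (\<exists>x\<in>L. \<exists>y\<in>R. \<exists>T. triad G T \<and> {x, y} \<subseteq> T)"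


section \<open>Algorithms and their running time\<close>

text \<open>
  Algorithms are programs for a random access machine with structured control. Every
  assignment and every test costs one unit of time; since a program contains only finitely
  many expressions, this differs from charging for each arithmetic operation and each memory
  access by at most a constant factor depending on the program. The only arithmetic operations
  are addition and (truncated) subtraction, so a step lengthens the numbers in memory by
  only a constant number of bits and polynomial time here is the same as polynomial time on a
  Turing machine. (With multiplication at unit cost this would fail.)
\<close>

datatype aexp =
    Lit nat
  | Var string
  | Arr string aexp
  | Plus aexp aexp
  | Minus aexp aexp

datatype bexp =
    Less aexp aexp
  | Equal aexp aexp
  | Neg bexp
  | Conj bexp bexp

datatype com =
    Skip
  | Assign string aexp
  | Store string aexp aexp
  | Seq com com
  | Cond bexp com com
  | While bexp com

record state =
  scalar :: "string \<Rightarrow> nat"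
  arr :: "string \<Rightarrow> nat \<Rightarrow> nat"

fun aval :: "aexp \<Rightarrow> state \<Rightarrow> nat" where
  "aval (Lit k) s = k"
| "aval (Var x) s = scalar s x"
| "aval (Arr a e) s = arr s a (aval e s)"
| "aval (Plus e f) s = aval e s + aval f s"
| "aval (Minus e f) s = aval e s - aval f s"

fun bval :: "bexp \<Rightarrow> state \<Rightarrow> bool" where
  "bval (Less e f) s \<longleftrightarrow> aval e s < aval f s"
| "bval (Equal e f) s \<longleftrightarrow> aval e s = aval f s"
| "bval (Neg b) s \<longleftrightarrow> \<not> bval b s"
| "bval (Conj b c) s \<longleftrightarrow> bval b s \<and> bval c s"

text \<open>\<open>exec c s t s'\<close>: started in \<open>s\<close>, the program \<open>c\<close> halts in \<open>s'\<close> after \<open>t\<close> steps.\<close>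

inductive exec :: "com \<Rightarrow> state \<Rightarrow> nat \<Rightarrow> state \<Rightarrow> bool" where
  Skip: "exec Skip s 1 s"
| Assign: "exec (Assign x e) s 1 (s\<lparr>scalar := (scalar s)(x := aval e s)\<rparr>)"
| Store: "exec (Store a e f) s 1
            (s\<lparr>arr := (arr s)(a := (arr s a)(aval e s := aval f s))\<rparr>)"
| Seq: "exec c s t s' \<Longrightarrow> exec d s' u s'' \<Longrightarrow> exec (Seq c d) s (t + u) s''"
| CondTrue: "bval b s \<Longrightarrow> exec c s t s' \<Longrightarrow> exec (Cond b c d) s (1 + t) s'"
| CondFalse: "\<not> bval b s \<Longrightarrow> exec d s t s' \<Longrightarrow> exec (Cond b c d) s (1 + t) s'"
| WhileFalse: "\<not> bval b s \<Longrightarrow> exec (While b c) s 1 s"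
| WhileTrue: "bval b s \<Longrightarrow> exec c s t s' \<Longrightarrow> exec (While b c) s' u s'' \<Longrightarrow>
                exec (While b c) s (1 + t + u) s''"

text \<open>
  The encoding of a graph with vertices \<open>0, \<dots>, n - 1\<close>, a partition of its vertex set and
  colorings of \<open>G \ R\<close> and \<open>G \ L\<close>. The adjacency matrix is stored row by row; all
  memory not holding input is zero. In particular the values of \<open>c1\<close> on \<open>R\<close> and of \<open>c2\<close> on
  \<open>L\<close>, which are irrelevant, are not passed on to the program.
\<close>

definition input_state ::
  "nat \<Rightarrow> (nat, 'b) pre_digraph \<Rightarrow> nat set \<Rightarrow> nat set \<Rightarrow> nat set \<Rightarrow> nat set \<Rightarrow> nat set \<Rightarrow>
   (nat \<Rightarrow> nat) \<Rightarrow> (nat \<Rightarrow> nat) \<Rightarrow> state" where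
  "input_state n G K1 K2 K3 L R c1 c2 =
     \<lparr> scalar = (\<lambda>_. 0)(''n'' := n),
       arr = (\<lambda>_ _. 0)
         (''adj'' := (\<lambda>i. if i < n * n \<and> (i div n) \<rightarrow>\<^bsub>G\<^esub> (i mod n) then 1 else 0),
          ''part'' := (\<lambda>v. if v \<in> K1 then 1 else if v \<in> K2 then 2 else if v \<in> K3 then 3
                           else if v \<in> L then 4 else if v \<in> R then 5 else 0),
          ''c1'' := (\<lambda>v. if v \<in> verts G - R then c1 v else 0),
          ''c2'' := (\<lambda>v. if v \<in> verts G - L then c2 v else 0)) \<rparr>"

definition output_coloring :: "state \<Rightarrow> nat \<Rightarrow> nat" where
  "output_coloring s = arr s ''col''"

end

theory Submission
  imports Defs "HOL-Combinatorics.Transposition"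
begin

text \<open>
  Since \<open>K1 \<union> K2\<close> is a clique, the colors of \<open>c2\<close> can be permuted so that \<open>c1\<close> and \<open>c2\<close> agree on
  \<open>K1 \<union> K2\<close>. If they also agree on \<open>K3\<close>, their union is a proper coloring of \<open>G\<close>, because \<open>L\<close> is
  anticomplete to \<open>R\<close>, and its colors are below the larger of the two clique numbers, hence below
  \<open>\<omega>(G)\<close>. So only the vertices \<open>u \<in> K3\<close> with \<open>c1 u \<noteq> c2 u\<close> are in the way. A Kempe chain of \<open>G \ R\<close>
  or \<open>G \ L\<close> that avoids \<open>K1 \<union> K2\<close> may be swapped freely. The algorithm is a local search: such a
  chain is swapped whenever this increases \<open>potential\<close>, the number of pairs \<open>(x, y)\<close> in \<open>K3\<close> with
  \<open>c1 x = c2 y\<close> and \<open>c1 y = c2 x\<close>, where the pairs with \<open>x = y\<close> count twice. The potential is at most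
  \<open>2 |K3|\<close>, with equality exactly when the colorings agree on \<open>K3\<close>; so a linear number of swaps suffices,
  provided that the search never gets stuck too early.

  That it does not (\<open>agree_on_K3\<close>) is the combinatorial core. View a disagreeing vertex \<open>u\<close> as an arrow
  from the color \<open>c1 u\<close> to the color \<open>c2 u\<close>, so that it has at most one next arrow, starting at \<open>c2 u\<close>,
  and at most one previous arrow, ending at \<open>c1 u\<close>. Swapping the chain of \<open>u\<close> in its two colors would
  make \<open>u\<close> agree; as no improvement is left, this chain reaches \<open>K1\<close> on both sides. A shortest
  connection is a chordless two-colored path that starts in \<open>u\<close> or, through \<open>L\<close>, in the next vertex and,
  through \<open>R\<close>, in the previous vertex. Its parity is dictated by the colors of its ends. By condition
  (iii) a path through \<open>L\<close> can be redirected to every vertex of \<open>K1\<close> not adjacent to its start, so paths on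
  opposite sides close up to holes, and two combinations have the wrong parity for a Berge graph: paths
  on both sides that start in \<open>u\<close> (\<open>not_linked_both\<close>), and a left path from the next vertex together with a
  right path from \<open>u\<close> (\<open>crossing_paths\<close>).

  As \<open>G\<close> is square-free, the neighborhoods in \<open>K1\<close> of the vertices of \<open>K3\<close> form a chain. For a disagreeing
  \<open>u\<close> whose neighborhood is largest, the cases lead to one of these two contradictions, with two
  exceptions in which \<open>u\<close> has a neighbor in \<open>K1\<close> of the color \<open>c1 v\<close>, where \<open>v\<close> is the previous vertex. One is
  settled by condition (iv) (\<open>attached_L_path_parity\<close>). In the other no chain of \<open>u\<close> or \<open>v\<close> in its own two
  colors need be swappable: there one swaps the chain of \<open>v\<close> in the colors \<open>c1 v\<close> and \<open>c2 u\<close>. This makes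
  no vertex agree but turns \<open>v\<close> and \<open>u\<close> into opposite arrows, which is why the potential counts pairs.
\<close>

unbundle no funcset_syntax

section \<open>Chordless paths and odd holes\<close>

context graph
begin

lemma adj_sym: "u \<rightarrow> v \<Longrightarrow> v \<rightarrow> u"
  by (rule arcs_ends_symmetric[OF sym_arcs])

lemma adj_irrefl: "\<not> u \<rightarrow> u"
  by (rule notI) (drule adj_not_same, simp)

text \<open>
  Among all walks in \<open>S\<close> from \<open>A\<close> to \<open>B\<close> take one of least length: repeated vertices, chords and inner
  vertices in \<open>A\<close> or \<open>B\<close> would all allow a shortcut.
\<close>

lemma shortest_path:
  assumes "successively (dominates G) p" "p \<noteq> []" "set p \<subseteq> S" "S \<subseteq> verts G"
    and "hd p \<in> A" "last p \<in> B"
  obtains q where "chordless_path G q" "set q \<subseteq> S" "hd q \<in> A" "last q \<in> B"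
    "path_interior q \<inter> (A \<union> B) = {}"
proof -
  let ?W = "\<lambda>p. successively (dominates G) p \<and> p \<noteq> [] \<and> set p \<subseteq> S \<and> hd p \<in> A \<and> last p \<in> B"
  obtain q where q: "?W q" and least: "\<And>r. ?W r \<Longrightarrow> length q \<le> length r"
    using ex_has_least_nat[of ?W p length] assms by blast
  have shortcut: False
    if "Suc i < j" "j < length q" "q ! i \<rightarrow> q ! j" for i j
  proof -
    let ?r = "take (Suc i) q @ drop j q"
    have *: "last (take (Suc i) q) = q ! i" "hd (drop j q) = q ! j"
      using that by (simp_all add: take_Suc_conv_app_nth hd_drop_conv_nth)
    have "successively (dominates G) (take (Suc i) q)" "successively (dominates G) (drop j q)"
      using q successively_append_iff[of _ "take (Suc i) q" "drop (Suc i) q"]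
        successively_append_iff[of _ "take j q" "drop j q"] by auto
    then have "?W ?r"
      using q that * set_take_subset[of "Suc i" q] set_drop_subset[of j q]
      by (auto simp: successively_append_iff hd_append)
    from least[OF this] show False using that by simp
  qed
  have tails: "successively (dominates G) (drop i q)" "successively (dominates G) (take i q)" for i
    using q successively_append_iff[of _ "take i q" "drop i q"] by auto
  have no_rep: "q ! i \<noteq> q ! j" if "i < j" "j < length q" for i j
  proof
    assume eq: "q ! i = q ! j"
    let ?r = "take i q @ drop j q"
    have "hd (drop j q) = q ! i" "i > 0 \<Longrightarrow> last (take i q) = q ! (i - 1)"
      using that eq q by (simp_all add: last_conv_nth hd_drop_conv_nth)
    moreover have "i > 0 \<Longrightarrow> q ! (i - 1) \<rightarrow> q ! i"
      using q that successively_nth[of "dominates G" q "i - 1"] by auto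
    moreover have "i = 0 \<Longrightarrow> q ! i \<in> A" using q hd_conv_nth[of q] by auto
    ultimately have "?W ?r"
      using q that tails set_take_subset[of i q] set_drop_subset[of j q]
      by (auto simp: successively_append_iff hd_append)
    from least[OF this] show False using that by simp
  qed
  then have dist: "distinct q"
    by (metis distinct_conv_nth linorder_neqE_nat)
  have "q ! i \<rightarrow> q ! j \<longleftrightarrow> j = Suc i \<or> i = Suc j" if ij: "i < length q" "j < length q" for i j
  proof
    assume e: "q ! i \<rightarrow> q ! j"
    show "j = Suc i \<or> i = Suc j"
    proof (rule ccontr)
      assume "\<not> ?thesis"
      then consider "i = j" | "Suc i < j" | "Suc j < i" by linarith
      then show False
        using shortcut[of i j] shortcut[of j i] ij e adj_sym adj_irrefl by cases auto
    qed
  next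
    assume "j = Suc i \<or> i = Suc j"
    then show "q ! i \<rightarrow> q ! j"
      using q ij successively_nth[of _ q i] successively_nth[of _ q j] adj_sym by auto
  qed
  then have "chordless_path G q"
    using q dist assms(4) unfolding chordless_path_def by auto
  moreover have "path_interior q \<inter> (A \<union> B) = {}"
  proof (rule ccontr)
    assume "\<not> ?thesis"
    then obtain x where x: "x \<in> set q" "x \<noteq> hd q" "x \<noteq> last q" "x \<in> A \<or> x \<in> B"
      unfolding path_interior_def by auto
    then obtain i where i: "i < length q" "q ! i = x" by (metis in_set_conv_nth)
    have i0: "i \<noteq> 0" using x i q by (metis hd_conv_nth)
    have il: "i \<noteq> length q - 1" using x i q by (metis last_conv_nth)
    from x(4) show False
    proof
      assume "x \<in> A"
      then have "?W (drop i q)" using q i tails set_drop_subset[of i q] by (auto simp: hd_drop_conv_nth)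
      from least[OF this] show False using i i0 by simp
    next
      assume "x \<in> B"
      then have "?W (take (Suc i) q)"
        using q i tails set_take_subset[of "Suc i" q] by (auto simp: last_conv_nth)
      from least[OF this] show False using i il by simp
    qed
  qed
  ultimately show ?thesis using that q by blast
qed

lemma chordless_successively: "chordless_path G p \<Longrightarrow> successively (dominates G) p"
  unfolding chordless_path_def by (auto simp: successively_conv_nth)

lemma chordless_ends_nonadjacent:
  assumes "chordless_path G p" "length p \<ge> 3"
  shows "hd p \<noteq> last p" "\<not> hd p \<rightarrow> last p"
proof -
  have h: "hd p = p ! 0" "last p = p ! (length p - 1)"
    using assms by (auto simp: chordless_path_def hd_conv_nth last_conv_nth)
  show "hd p \<noteq> last p" 
    using assms h nth_eq_iff_index_eq[of p 0 "length p - 1"] by (auto simp: chordless_path_def)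
  have "0 < length p" "length p - 1 < length p" using assms by auto
  then have "p ! 0 \<rightarrow> p ! (length p - 1) \<longleftrightarrow> length p - 1 = Suc 0 \<or> 0 = Suc (length p - 1)"
    using assms(1) unfolding chordless_path_def by blast
  then show "\<not> hd p \<rightarrow> last p" using assms h by auto
qed

lemma chordless_length2:
  assumes "chordless_path G p" "length p \<ge> 2" "length p < 3"
  shows "hd p \<rightarrow> last p"
proof -
  have "length p = 2" using assms by simp
  then obtain x y where "p = [x, y]" by (auto simp: numeral_2_eq_2 length_Suc_conv)
  then show ?thesis using assms by (auto simp: chordless_path_def nth_Cons' split: if_splits)
qed

lemma interior_nth:
  assumes "distinct p" "i < length p"
  shows "p ! i \<in> path_interior p \<longleftrightarrow> 0 < i \<and> i < length p - 1"
proof -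
  have p: "p \<noteq> []" using assms by auto
  show ?thesis
    using assms p nth_eq_iff_index_eq[of p i 0] nth_eq_iff_index_eq[of p i "length p - 1"]
    by (auto simp: path_interior_def hd_conv_nth last_conv_nth)
qed

lemma path_interior_rev: "path_interior (rev p) = path_interior p"
  by (cases "p = []") (auto simp: path_interior_def hd_rev last_rev)

lemma chordless_rev: "chordless_path G p \<Longrightarrow> chordless_path G (rev p)"
  unfolding chordless_path_def
proof (elim conjE, intro conjI allI impI)
  fix i j assume *: "\<forall>i<length p. \<forall>j<length p. p ! i \<rightarrow> p ! j \<longleftrightarrow> j = Suc i \<or> i = Suc j"
    and "i < length (rev p)" "j < length (rev p)"
  then show "rev p ! i \<rightarrow> rev p ! j \<longleftrightarrow> j = Suc i \<or> i = Suc j"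
    using *[rule_format, of "length p - Suc i" "length p - Suc j"] by (auto simp: rev_nth)
qed auto

text \<open>
  A chordless path remains one when a vertex \<open>x\<close> that sees nothing on it but the first vertex is
  put in front.
\<close>

lemma chordless_Cons:
  assumes "chordless_path G p" "x \<in> verts G" "x \<notin> set p" "x \<rightarrow> hd p"
    and "\<And>y. y \<in> set p \<Longrightarrow> y \<noteq> hd p \<Longrightarrow> \<not> x \<rightarrow> y"
  shows "chordless_path G (x # p)"
proof -
  have p: "p \<noteq> []" "distinct p" and ad: "\<And>i j. i < length p \<Longrightarrow> j < length p \<Longrightarrow> p ! i \<rightarrow> p ! j \<longleftrightarrow> j = Suc i \<or> i = Suc j"
    using assms(1) unfolding chordless_path_def by auto
  have x: "x \<rightarrow> p ! j \<longleftrightarrow> j = 0" if "j < length p" for j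
  proof (cases "j = 0")
    case True then show ?thesis using assms(4) p by (simp add: hd_conv_nth)
  next
    case False
    then have "p ! j \<noteq> hd p" using p that by (simp add: hd_conv_nth nth_eq_iff_index_eq)
    then show ?thesis using assms(5) that False by auto
  qed
  have x': "p ! j \<rightarrow> x \<longleftrightarrow> j = 0" if "j < length p" for j
    using x[OF that] adj_sym by blast
  have "(x # p) ! i \<rightarrow> (x # p) ! j \<longleftrightarrow> j = Suc i \<or> i = Suc j"
    if "i < length (x # p)" "j < length (x # p)" for i j
    using that x x' ad adj_irrefl by (cases i; cases j) auto
  then show ?thesis using assms p unfolding chordless_path_def by auto
qed

lemma chordless_snoc:
  assumes "chordless_path G p" "x \<in> verts G" "x \<notin> set p" "x \<rightarrow> last p"
    and "\<And>y. y \<in> set p \<Longrightarrow> y \<noteq> last p \<Longrightarrow> \<not> x \<rightarrow> y"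
  shows "chordless_path G (p @ [x])"
proof -
  have "p \<noteq> []" using assms(1) by (auto simp: chordless_path_def)
  then have "chordless_path G (x # rev p)"
    using assms by (intro chordless_Cons chordless_rev) (auto simp: hd_rev)
  from chordless_rev[OF this] show ?thesis by simp
qed

lemma chordless_butlast:
  assumes "chordless_path G p" "length p \<ge> 2"
  shows "chordless_path G (butlast p)"
proof -
  have "butlast p \<noteq> []" using assms by (cases p) auto
  then show ?thesis using assms unfolding chordless_path_def
    by (auto simp: nth_butlast distinct_butlast dest: in_set_butlastD)
qed

lemma dominates_induce: "u \<rightarrow>\<^bsub>G \<restriction> S\<^esub> v \<longleftrightarrow> u \<rightarrow> v \<and> u \<in> S \<and> v \<in> S"
  by (auto simp: arcs_ends_conv)

lemma berge_no_odd_hole: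
  assumes "berge G" "set c \<subseteq> verts G" "distinct c" "length c \<ge> 4" "odd (length c)"
    and adj: "\<And>i j. i < length c \<Longrightarrow> j < length c \<Longrightarrow>
      c ! i \<rightarrow> c ! j \<longleftrightarrow> j = Suc i mod length c \<or> i = Suc j mod length c"
  shows False
proof -
  have "cycle_graph (G \<restriction> set c)"
    unfolding cycle_graph_def
    by (rule exI[of _ c]) (use assms adj in \<open>auto simp: dominates_induce\<close>)
  moreover have "card (set c) = length c" using assms by (simp add: distinct_card)
  ultimately show False
    using assms unfolding berge_def hole_def by (metis induce_subgraph_verts)
qed

text \<open>
  The two paths close up to a hole, whose length is the sum of their numbers of vertices minus two.
  This is the only way in which the Berge property is used.
\<close>

lemma two_paths_same_parity:
  assumes berge: "berge G" and P: "chordless_path G P" "length P \<ge> 3"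
    and Q: "chordless_path G Q" "length Q \<ge> 3"
    and ends: "hd P = hd Q" "last P = last Q"
    and disj: "path_interior P \<inter> path_interior Q = {}"
    and anti: "anticomplete_to G (path_interior P) (path_interior Q)"
  shows "even (length P + length Q)"
proof (rule ccontr)
  assume odd: "odd (length P + length Q)"
  define a b where "a = length P" and "b = length Q"
  define c where "c = P @ rev (butlast (tl Q))"
  define N where "N = a + b - 2"
  (* The cycle runs through P forwards and then through the interior of Q backwards,
     so that position i beyond P holds vertex N - i of Q. *)
  have ab: "a \<ge> 3" "b \<ge> 3" using P Q by (auto simp: a_def b_def)
  have len: "length c = N" using ab by (simp add: c_def N_def a_def b_def)
  have Pd: "distinct P" "set P \<subseteq> verts G" "P \<noteq> []" and Qd: "distinct Q" "set Q \<subseteq> verts G" "Q \<noteq> []"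
    using P Q by (auto simp: chordless_path_def)
  have Padj: "P ! i \<rightarrow> P ! j \<longleftrightarrow> j = Suc i \<or> i = Suc j" if "i < a" "j < a" for i j
    using P(1) that unfolding chordless_path_def a_def by blast
  have Qadj: "Q ! i \<rightarrow> Q ! j \<longleftrightarrow> j = Suc i \<or> i = Suc j" if "i < b" "j < b" for i j
    using Q(1) that unfolding chordless_path_def b_def by blast
  have e0: "P ! 0 = Q ! 0" "P ! (a - 1) = Q ! (b - 1)"
    using ends Pd Qd by (simp_all add: hd_conv_nth last_conv_nth a_def b_def)
  have c1: "c ! i = P ! i" if "i < a" for i
    using that by (simp add: c_def a_def nth_append)
  have c2: "c ! i = Q ! (N - i)" if "a \<le> i" "i < N" for i
  proof -
    have "c ! i = rev (butlast (tl Q)) ! (i - a)" using that by (simp add: c_def a_def nth_append)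
    also have "\<dots> = butlast (tl Q) ! (b - 2 - Suc (i - a))"
      using that ab by (subst rev_nth) (auto simp: b_def N_def)
    also have "\<dots> = tl Q ! (b - 2 - Suc (i - a))"
      using that ab by (subst nth_butlast) (auto simp: b_def N_def)
    also have "\<dots> = Q ! (Suc (b - 2 - Suc (i - a)))"
      using that ab by (subst nth_tl) (auto simp: b_def N_def)
    also have "Suc (b - 2 - Suc (i - a)) = N - i" using that ab by (simp add: N_def)
    finally show ?thesis .
  qed
  have Qint: "Q ! (N - j) \<in> path_interior Q" "0 < N - j" "N - j < b - 1" if "a \<le> j" "j < N" for j
    using that interior_nth[OF Qd(1), of "N - j"] ab by (auto simp: N_def b_def)
  have mixed: "c ! i \<rightarrow> c ! j \<longleftrightarrow> (i = 0 \<and> j = N - 1) \<or> (i = a - 1 \<and> j = a)"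
    if "i < a" "a \<le> j" "j < N" for i j
  proof -
    have "i < a" by fact
    then consider "i = 0" | "i = a - 1" | "0 < i" "i < a - 1"
      by (cases "i = 0"; cases "i = a - 1") auto
    then show ?thesis
    proof cases
      case 1
      then have "c ! i \<rightarrow> c ! j \<longleftrightarrow> N - j = Suc 0"
        using Qadj[of 0 "N - j"] Qint[OF that(2,3)] that c1[of i] c2[of j] e0 ab by simp
      then show ?thesis using 1 that ab by auto
    next
      case 2
      then have "c ! i \<rightarrow> c ! j \<longleftrightarrow> b - 1 = Suc (N - j)"
        using Qadj[of "b - 1" "N - j"] Qint[OF that(2,3)] that c1[of i] c2[of j] e0 ab by auto
      then show ?thesis using 2 that ab by (auto simp: N_def)
    next
      case 3
      then have "P ! i \<in> path_interior P" using interior_nth[OF Pd(1), of i] a_def by auto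
      then have "\<not> c ! i \<rightarrow> c ! j"
        using anti Qint(1)[OF that(2,3)] c1[of i] c2[of j] that by (auto simp: anticomplete_to_def)
      then show ?thesis using 3 by auto
    qed
  qed
  have md: "Suc i mod N = (if i = N - 1 then 0 else Suc i)" if "i < N" for i
    using that by (auto simp: mod_Suc)
  have adj: "c ! i \<rightarrow> c ! j \<longleftrightarrow> j = Suc i mod N \<or> i = Suc j mod N" if "i < N" "j < N" for i j
  proof -
    consider "i < a" "j < a" | "i < a" "a \<le> j" | "a \<le> i" "j < a" | "a \<le> i" "a \<le> j" by linarith
    then show ?thesis
    proof cases
      case 1
      then show ?thesis using Padj[of i j] c1 md[of i] md[of j] that ab by (auto simp: N_def)
    next
      case 2
      then show ?thesis using mixed[of i j] md[of i] md[of j] that ab by (auto simp: N_def)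
    next
      case 3
      then have "c ! i \<rightarrow> c ! j \<longleftrightarrow> (j = 0 \<and> i = N - 1) \<or> (j = a - 1 \<and> i = a)"
        using mixed[of j i] that adj_sym by blast
      then show ?thesis using 3 md[of i] md[of j] that ab by (auto simp: N_def)
    next
      case 4
      then have "c ! i \<rightarrow> c ! j \<longleftrightarrow> N - j = Suc (N - i) \<or> N - i = Suc (N - j)"
        using Qadj[of "N - i" "N - j"] Qint[of i] Qint[of j] c2 that by auto
      also have "\<dots> \<longleftrightarrow> j = Suc i \<or> i = Suc j" using that by arith
      also have "\<dots> \<longleftrightarrow> j = Suc i mod N \<or> i = Suc j mod N"
        using md[OF that(1)] md[OF that(2)] 4 that ab by (cases "i = N - 1"; cases "j = N - 1") auto
      finally show ?thesis .
    qed
  qed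
  have Qmid: "set (butlast (tl Q)) = path_interior Q" "distinct (butlast (tl Q))"
  proof -
    obtain x ys where "Q = x # ys" using Qd by (cases Q) auto
    moreover have "ys \<noteq> []" using calculation ab b_def by auto
    then obtain zs y where "ys = zs @ [y]" by (cases ys rule: rev_cases) auto
    ultimately have Q': "Q = x # zs @ [y]" by simp
    show "set (butlast (tl Q)) = path_interior Q" "distinct (butlast (tl Q))"
      using Qd(1) unfolding Q' path_interior_def by auto
  qed
  have Psplit: "set P = path_interior P \<union> {hd Q, last Q}"
    unfolding path_interior_def using hd_in_set[OF Pd(3)] last_in_set[OF Pd(3)] ends by auto
  have "set P \<inter> path_interior Q = {}"
    using disj unfolding Psplit by (auto simp: path_interior_def[of Q])
  then have "distinct c" using Pd(1) Qmid by (simp add: c_def)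
  moreover have "path_interior Q \<subseteq> verts G" using Qd(2) by (auto simp: path_interior_def)
  then have "set c \<subseteq> verts G" using Pd(2) Qmid by (simp add: c_def)
  moreover have "4 \<le> N" using ab by (simp add: N_def)
  moreover have "odd N" using odd ab by (simp add: N_def a_def b_def)
  ultimately show False
    using berge_no_odd_hole[OF berge, of c] len adj by simp
qed

text \<open>
  The square is given by its four vertices in cyclic order, so that its two diagonals \<open>a c\<close> and \<open>b d\<close>
  are the pairs that must be non-adjacent.
\<close>

lemma square_free_no_square:
  assumes "square_free G" "a \<rightarrow> b" "b \<rightarrow> c" "c \<rightarrow> d" "d \<rightarrow> a" "\<not> a \<rightarrow> c" "\<not> b \<rightarrow> d" "a \<noteq> c" "b \<noteq> d"
  shows False
proof -
  let ?c = "[a, b, c, d]"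
  have v: "set ?c \<subseteq> verts G" using assms adj_in_verts by auto
  have d: "distinct ?c" using assms adj_irrefl by auto
  have "cycle_graph (G \<restriction> set ?c)"
    unfolding cycle_graph_def
  proof (rule exI[of _ ?c], intro conjI allI impI)
    fix i j assume "i < length ?c" "j < length ?c"
    then have "i \<in> {0, 1, 2, 3}" "j \<in> {0, 1, 2, 3}" by auto
    moreover have "b \<rightarrow> a" "c \<rightarrow> b" "d \<rightarrow> c" "a \<rightarrow> d" "\<not> c \<rightarrow> a" "\<not> d \<rightarrow> b"
      using assms adj_sym by blast+
    ultimately show "?c ! i \<rightarrow>\<^bsub>G \<restriction> set ?c\<^esub> ?c ! j \<longleftrightarrow> j = Suc i mod length ?c \<or> i = Suc j mod length ?c"
      by (elim insertE emptyE; simp add: dominates_induce assms(2-7) adj_irrefl)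
  qed (use d in auto)
  moreover have "card (set ?c) = 4" using distinct_card[OF d] by simp
  ultimately show False using assms(1) v unfolding square_free_def by blast
qed

end

section \<open>Kempe chains and the potential\<close>

text \<open>
  The color \<open>h\<close> need not occur at \<open>x\<close>; the chain is the component of \<open>x\<close> in the subgraph of \<open>S\<close> induced by
  the colors \<open>c x\<close> and \<open>h\<close>. The edge relation is a parameter because the program knows it only as a matrix.
\<close>

definition kempe_chain :: "('a \<Rightarrow> 'a \<Rightarrow> bool) \<Rightarrow> 'a set \<Rightarrow> ('a \<Rightarrow> nat) \<Rightarrow> 'a \<Rightarrow> nat \<Rightarrow> 'a set" where
  "kempe_chain E S c x h = {y. (\<lambda>a b. E a b \<and> b \<in> S \<and> c b \<in> {c x, h})\<^sup>*\<^sup>* x y}"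

definition swap_on :: "'a set \<Rightarrow> nat \<Rightarrow> nat \<Rightarrow> ('a \<Rightarrow> nat) \<Rightarrow> 'a \<Rightarrow> nat" where
  "swap_on C i h c = (\<lambda>z. if z \<in> C then transpose i h (c z) else c z)"

text \<open>
  On a clique \<open>K\<close> both colorings are injective. Then every \<open>x\<close> has at most one partner \<open>y\<close>, namely itself
  when the colorings agree at \<open>x\<close>, and \<open>weight\<close> is its total contribution.
\<close>

definition potential :: "'a set \<Rightarrow> ('a \<Rightarrow> nat) \<Rightarrow> ('a \<Rightarrow> nat) \<Rightarrow> nat" where
  "potential K a b =
     (\<Sum>x\<in>K. \<Sum>y\<in>K. if a x = b y \<and> a y = b x then (if x = y then 2 else 1) else 0)"

definition weight :: "'a set \<Rightarrow> ('a \<Rightarrow> nat) \<Rightarrow> ('a \<Rightarrow> nat) \<Rightarrow> 'a \<Rightarrow> nat" where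
  "weight K a b x =
     (if a x = b x then 2 else if \<exists>y\<in>K. a x = b y \<and> a y = b x then 1 else 0)"

lemma kempe_chain_color:
  assumes "z \<in> kempe_chain E S c x h"
  shows "c z \<in> {c x, h}"
proof -
  have "(\<lambda>a b. E a b \<and> b \<in> S \<and> c b \<in> {c x, h})\<^sup>*\<^sup>* x z"
    using assms by (simp add: kempe_chain_def)
  then show ?thesis by cases auto
qed

lemma kempe_chain_subset: "x \<in> S \<Longrightarrow> kempe_chain E S c x h \<subseteq> S"
proof
  fix z assume "x \<in> S" "z \<in> kempe_chain E S c x h"
  then have "(\<lambda>a b. E a b \<and> b \<in> S \<and> c b \<in> {c x, h})\<^sup>*\<^sup>* x z"
    by (simp add: kempe_chain_def)
  then show "z \<in> S" using \<open>x \<in> S\<close> by cases auto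
qed

lemma kempe_chain_self: "x \<in> kempe_chain E S c x h"
  by (simp add: kempe_chain_def)

lemma kempe_chain_step:
  assumes "y \<in> kempe_chain E S c x h" "E y z" "z \<in> S" "c z \<in> {c x, h}"
  shows "z \<in> kempe_chain E S c x h"
  using assms unfolding kempe_chain_def by (auto intro: rtranclp.rtrancl_into_rtrancl)

lemma potential_commute: "potential K a b = potential K b a"
  unfolding potential_def by (intro sum.cong refl) auto

lemma potential_eq_sum_weight:
  assumes "finite K" "inj_on a K" "inj_on b K"
  shows "potential K a b = (\<Sum>x\<in>K. weight K a b x)"
  unfolding potential_def
proof (rule sum.cong)
  fix x assume x: "x \<in> K"
  let ?f = "\<lambda>y. if a x = b y \<and> a y = b x then (if x = y then 2 else 1) else (0::nat)"
  show "(\<Sum>y\<in>K. ?f y) = weight K a b x"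
  proof (cases "\<exists>y\<in>K. a x = b y \<and> a y = b x")
    case True
    then obtain y where y: "y \<in> K" "a x = b y" "a y = b x" by blast
    have uniq: "z = y" if "z \<in> K" "a x = b z" for z
      by (rule inj_onD[OF assms(3)]) (simp_all only: that y flip: that(2) y(2))
    have "?f z = (if z = y then ?f y else 0)" if "z \<in> K" for z
    proof (cases "z = y")
      case False
      then have "a x \<noteq> b z" using uniq[OF that] by blast
      then show ?thesis using False by (simp only: if_False HOL.simp_thms)
    qed (simp only: simp_thms if_True)
    then have "(\<Sum>z\<in>K. ?f z) = (\<Sum>z\<in>K. if z = y then ?f y else 0)"
      by (rule sum.cong[OF refl])
    also have "\<dots> = ?f y" using assms(1) y by simp
    also have "\<dots> = weight K a b x"
    proof (cases "a x = b x")
      case True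
      then have "x = y" using uniq[OF x] by simp
      then show ?thesis using y by (simp add: weight_def)
    next
      case neq: False
      then have "x \<noteq> y" using y by auto
      then show ?thesis using True neq y by (simp add: weight_def)
    qed
    finally show ?thesis .
  next
    case False
    have "?f y = 0" if "y \<in> K" for y
    proof -
      have "\<not> (a x = b y \<and> a y = b x)" using False that by blast
      then show ?thesis by (simp only: if_False)
    qed
    moreover have "weight K a b x = 0"
      using False x unfolding weight_def by (metis (no_types, lifting))
    ultimately show ?thesis by (simp only: sum.neutral_const cong: sum.cong)
  qed
qed simp

lemma potential_le:
  assumes "finite K" "inj_on a K" "inj_on b K"
  shows "potential K a b \<le> 2 * card K"
  using sum_bounded_above[of K "weight K a b" 2] assms
  by (simp add: potential_eq_sum_weight weight_def mult.commute)

lemma potential_max_iff: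
  assumes "finite K" "inj_on a K" "inj_on b K"
  shows "potential K a b = 2 * card K \<longleftrightarrow> (\<forall>x\<in>K. a x = b x)"
proof
  assume "\<forall>x\<in>K. a x = b x"
  then show "potential K a b = 2 * card K"
    using assms by (simp add: potential_eq_sum_weight weight_def)
next
  assume eq: "potential K a b = 2 * card K"
  show "\<forall>x\<in>K. a x = b x"
  proof (rule ccontr)
    assume "\<not> ?thesis"
    then obtain x where x: "x \<in> K" "a x \<noteq> b x" by blast
    have "(\<Sum>x\<in>K. weight K a b x) < (\<Sum>x\<in>K. 2)"
      using assms(1) x by (intro sum_strict_mono_ex1) (auto simp: weight_def)
    then show False using eq assms by (simp add: potential_eq_sum_weight)
  qed
qed

text \<open>
  A partner of \<open>x\<close> is kept by every recoloring that leaves \<open>x\<close> and that partner alone.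
\<close>

lemma weight_mono:
  assumes "a' x = a x" "\<And>y. y \<in> K \<Longrightarrow> a x = b y \<Longrightarrow> a y = b x \<Longrightarrow> a' y = a y"
  shows "weight K a b x \<le> weight K a' b x"
proof (cases "\<exists>y\<in>K. a x = b y \<and> a y = b x")
  case True
  then obtain y where "y \<in> K" "a x = b y" "a y = b x" by blast
  then have "\<exists>y\<in>K. a' x = b y \<and> a' y = b x" using assms by force
  then show ?thesis using assms(1) by (simp add: weight_def)
next
  case False
  then have "weight K a b x = (if a x = b x then 2 else 0)" unfolding weight_def by auto
  then show ?thesis using assms(1) by (simp add: weight_def)
qed

lemma potential_increase:
  assumes fin: "finite K" and a: "inj_on a K" and b: "inj_on b K"
    and C: "C \<inter> K = {x \<in> K. a x \<in> {i, h}}"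
    and le: "\<And>x. x \<in> K \<Longrightarrow> weight K a b x \<le> weight K (\<lambda>x. transpose i h (a x)) b x"
    and less: "x0 \<in> K" "weight K a b x0 < weight K (\<lambda>x. transpose i h (a x)) b x0"
  shows "potential K a b < potential K (swap_on C i h a) b"
proof -
  let ?a = "\<lambda>x. transpose i h (a x)"
  have "swap_on C i h a x = ?a x" if "x \<in> K" for x
    using C that by (auto simp: swap_on_def transpose_def)
  then have "potential K (swap_on C i h a) b = potential K ?a b"
    unfolding potential_def by (intro sum.cong refl) auto
  also have "inj_on ?a K" using a by (auto simp: inj_on_def dest!: injD[OF bij_is_inj[OF bij_transpose]])
  then have "potential K ?a b = (\<Sum>x\<in>K. weight K ?a b x)"
    by (rule potential_eq_sum_weight[OF fin _ b])
  finally show ?thesis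
    using sum_strict_mono_ex1[OF fin, of "weight K a b" "weight K ?a b"] le less
      potential_eq_sum_weight[OF fin a b] by auto
qed

text \<open>
  The swap makes \<open>u\<close> agree. The only other vertex of the clique that changes is the one with color
  \<open>b u\<close>; it loses a partner only if that partner is \<open>u\<close>, and in this case it becomes an agreeing vertex itself.
\<close>

lemma potential_increase_single:
  assumes fin: "finite K" and a: "inj_on a K" and b: "inj_on b K"
    and u: "u \<in> K" "a u \<noteq> b u" and C: "C \<inter> K = {x \<in> K. a x \<in> {a u, b u}}"
  shows "potential K a b < potential K (swap_on C (a u) (b u) a) b"
proof (rule potential_increase[OF fin a b C])
  let ?a = "\<lambda>x. transpose (a u) (b u) (a x)"
  show "weight K a b u < weight K ?a b u"
    using u by (simp add: weight_def)
  fix x assume x: "x \<in> K"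
  have ai: "\<And>y z. y \<in> K \<Longrightarrow> z \<in> K \<Longrightarrow> a y = a z \<Longrightarrow> y = z"
    and bi: "\<And>y z. y \<in> K \<Longrightarrow> z \<in> K \<Longrightarrow> b y = b z \<Longrightarrow> y = z"
    using a b by (auto dest: inj_onD)
  consider "x = u" | "x \<noteq> u" "a x = b u" | "a x \<notin> {a u, b u}"
    using ai[OF x u(1)] by blast
  then show "weight K a b x \<le> weight K ?a b x"
  proof cases
    case 1 then show ?thesis using u by (simp add: weight_def)
  next
    case 2
    then have "a x \<noteq> b x" using bi[OF x u(1)] by auto
    moreover have "?a x = b x" if "y \<in> K" "a x = b y" "a y = b x" for y
      using that 2 bi[OF that(1) u(1)] by (simp add: transpose_def)
    ultimately show ?thesis by (auto simp: weight_def)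
  next
    case 3
    have "?a y = a y" if "y \<in> K" "a x = b y" "a y = b x" for y
    proof -
      have "a y \<noteq> a u" using that 3 ai[of y u] u by auto
      moreover have "a y \<noteq> b u" using that 3 bi[of x u] u x by auto
      ultimately show ?thesis by (simp add: transpose_def)
    qed
    then show ?thesis using 3 by (intro weight_mono) auto
  qed
qed (use u in auto)

text \<open>
  Here \<open>v\<close> goes from \<open>a v\<close> to \<open>a u\<close> and \<open>u\<close> from \<open>a u\<close> to \<open>b u\<close>. After the swap \<open>v\<close> goes from \<open>b u\<close> to
  \<open>a u\<close>, so \<open>u\<close> and \<open>v\<close> become partners. No partnership is lost: a partner of \<open>v\<close>, or of the vertex
  with color \<open>b u\<close>, could only be \<open>u\<close>, and \<open>u\<close> had none.
\<close>

lemma potential_increase_pair: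
  assumes fin: "finite K" and a: "inj_on a K" and b: "inj_on b K"
    and uv: "u \<in> K" "v \<in> K" "b v = a u" "a u \<noteq> b u" "a v \<noteq> b v" "a v \<noteq> b u"
    and C: "C \<inter> K = {x \<in> K. a x \<in> {a v, b u}}"
  shows "potential K a b < potential K (swap_on C (a v) (b u) a) b"
proof (rule potential_increase[OF fin a b C])
  let ?a = "\<lambda>x. transpose (a v) (b u) (a x)"
  have ai: "\<And>y z. y \<in> K \<Longrightarrow> z \<in> K \<Longrightarrow> a y = a z \<Longrightarrow> y = z"
    and bi: "\<And>y z. y \<in> K \<Longrightarrow> z \<in> K \<Longrightarrow> b y = b z \<Longrightarrow> y = z"
    using a b by (auto dest: inj_onD)
  have "\<not> (\<exists>y\<in>K. a v = b y \<and> a y = b v)"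
    using uv ai by metis
  then have v0: "weight K a b v = 0" using uv by (simp add: weight_def)
  have "?a v = b u" "?a u = b v" using uv by (auto simp: transpose_def)
  then have "\<exists>y\<in>K. ?a v = b y \<and> ?a y = b v" using uv(1) by blast
  then have "weight K ?a b v \<ge> 1" by (simp add: weight_def)
  then show less: "weight K a b v < weight K ?a b v" using v0 by simp
  fix x assume x: "x \<in> K"
  consider "x = v" | "x \<noteq> v" "a x = b u" | "a x \<notin> {a v, b u}"
    using ai[OF x uv(2)] by blast
  then show "weight K a b x \<le> weight K ?a b x"
  proof cases
    case 1 then show ?thesis using less by simp
  next
    case 2
    then have "a x \<noteq> b x" using bi[OF x uv(1)] uv(4) by metis
    moreover have "\<not> (\<exists>y\<in>K. a x = b y \<and> a y = b x)"
      using 2 bi uv x by metis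
    ultimately show ?thesis by (auto simp: weight_def)
  next
    case 3
    have "?a y = a y" if "y \<in> K" "a x = b y" "a y = b x" for y
    proof -
      have "a y \<noteq> a v" using that 3 ai uv x by metis
      moreover have "a y \<noteq> b u" using that 3 bi uv x by metis
      ultimately show ?thesis by (simp add: transpose_def)
    qed
    then show ?thesis using 3 by (intro weight_mono) auto
  qed
qed (use uv in auto)

section \<open>Paths between the ends of a good partition\<close>

lemma (in graph) walk_between:
  assumes "successively (dominates G) r" "s \<in> set r" "t \<in> set r"
  obtains p where "successively (dominates G) p" "p \<noteq> []" "hd p = s" "last p = t" "set p \<subseteq> set r"
proof -
  have forward: "\<exists>p. successively (dominates G) p \<and> p \<noteq> [] \<and> hd p = r ! i \<and> last p = r ! j \<and> set p \<subseteq> set r"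
    if "i \<le> j" "j < length r" for i j
  proof (rule exI[of _ "drop i (take (Suc j) r)"], intro conjI)
    have "successively (dominates G) (take (Suc j) r)"
      using assms(1) successively_append_iff[of _ "take (Suc j) r" "drop (Suc j) r"] by auto
    then show "successively (dominates G) (drop i (take (Suc j) r))"
      using successively_append_iff[of _ "take i (take (Suc j) r)" "drop i (take (Suc j) r)"]
      by (metis append_take_drop_id)
    show "set (drop i (take (Suc j) r)) \<subseteq> set r"
      by (meson set_drop_subset set_take_subset subset_trans)
    show "last (drop i (take (Suc j) r)) = r ! j"
      using that by (simp add: last_drop take_Suc_conv_app_nth)
  qed (use that in \<open>auto simp: hd_drop_conv_nth\<close>)
  obtain i j where ij: "i < length r" "r ! i = s" "j < length r" "r ! j = t"
    using assms by (metis in_set_conv_nth)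
  show thesis
  proof (cases "i \<le> j")
    case True
    then show thesis using forward[of i j] ij that by auto
  next
    case False
    then obtain p where "successively (dominates G) p" "p \<noteq> []" "hd p = t" "last p = s" "set p \<subseteq> set r"
      using forward[of j i] ij by auto
    moreover from this have "successively (dominates G) (rev p)"
      using adj_sym by (auto simp: successively_rev intro: successively_mono)
    ultimately show thesis using that[of "rev p"] by (auto simp: hd_rev last_rev)
  qed
qed

text \<open>
  In a bipartite graph a walk ends on the side where it started exactly if it has an even number of
  edges, that is, an odd number of vertices.
\<close>

lemma alternating_parity:
  assumes "successively (dominates G) p" "p \<noteq> []" "c ` set p \<subseteq> {i, h}"
    and "\<And>x y. x \<in> set p \<Longrightarrow> y \<in> set p \<Longrightarrow> dominates G x y \<Longrightarrow> c x \<noteq> c y"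
  shows "odd (length p) \<longleftrightarrow> c (hd p) = c (last p)"
  using assms
proof (induction p)
  case (Cons x p)
  show ?case
  proof (cases "p = []")
    case False
    then have "dominates G x (hd p)" using Cons.prems(1) by (cases p) auto
    then have "c x \<noteq> c (hd p)" using Cons.prems False by auto
    moreover have "odd (length p) \<longleftrightarrow> c (hd p) = c (last p)"
      using Cons False by (intro Cons.IH) (auto simp: successively_Cons)
    moreover have "\<forall>y\<in>set (x # p). c y \<in> {i, h}"
      using Cons.prems(3) by (simp only: image_subset_iff)
    then have "c x = i \<or> c x = h" "c (hd p) = i \<or> c (hd p) = h" "c (last p) = i \<or> c (last p) = h"
      using hd_in_set[OF False] last_in_set[OF False] by simp_all
    ultimately have "c x = c (last p) \<longleftrightarrow> even (length p)" by metis
    then show ?thesis using False by simp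
  qed auto
qed auto

lemma path_last_two:
  assumes "length p \<ge> 3"
  obtains q z w where "p = q @ [z, w]" "q \<noteq> []"
proof -
  have "p \<noteq> []" using assms by auto
  then obtain p' w where p': "p = p' @ [w]" by (cases p rule: rev_cases) auto
  then have "p' \<noteq> []" using assms by auto
  then obtain q z where q: "p' = q @ [z]" by (cases p' rule: rev_cases) auto
  then have "q \<noteq> []" using assms p' by auto
  then show thesis using that p' q by simp
qed

locale good_partition_graph = graph G for G :: "('a, 'b) pre_digraph" (structure) +
  fixes K1 K2 K3 L R :: "'a set"
  assumes square_free: "square_free G" and berge: "berge G"
    and good_partition: "good_partition G K1 K2 K3 L R"
begin

lemma verts_eq: "verts G = K1 \<union> K2 \<union> K3 \<union> L \<union> R"
  using good_partition unfolding good_partition_def by auto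

lemma disjoint:
  "K1 \<inter> K2 = {}" "K1 \<inter> K3 = {}" "K2 \<inter> K3 = {}" "K1 \<inter> L = {}" "K2 \<inter> L = {}" "K3 \<inter> L = {}"
  "K1 \<inter> R = {}" "K2 \<inter> R = {}" "K3 \<inter> R = {}" "L \<inter> R = {}"
  using good_partition unfolding good_partition_def by (auto simp: Int_Un_distrib2)

lemma clique12: "x \<in> K1 \<union> K2 \<Longrightarrow> y \<in> K1 \<union> K2 \<Longrightarrow> x \<noteq> y \<Longrightarrow> x \<rightarrow> y"
  and clique23: "x \<in> K2 \<union> K3 \<Longrightarrow> y \<in> K2 \<union> K3 \<Longrightarrow> x \<noteq> y \<Longrightarrow> x \<rightarrow> y"
  using good_partition unfolding good_partition_def clique_def by auto

lemma L_R: "x \<in> L \<Longrightarrow> y \<in> R \<Longrightarrow> \<not> x \<rightarrow> y"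
  using good_partition unfolding good_partition_def anticomplete_to_def by auto

text \<open>
  Condition (iv) leaves a choice; an edge between \<open>K1\<close> and \<open>K3\<close> excludes its first alternative.
\<close>

lemma edge_completeness:
  assumes "x \<in> K3" "w \<in> K1" "x \<rightarrow> w"
    and "y \<in> L" "a \<in> K1" "b \<in> K3" "y \<rightarrow> a" "y \<rightarrow> b"
  shows "a \<rightarrow> b"
proof -
  have "\<not> anticomplete_to G K1 K3"
    using assms adj_sym unfolding anticomplete_to_def by blast
  then have "\<forall>v\<in>L. complete_to G (nbrs G v \<inter> K1) (nbrs G v \<inter> K3)"
    using good_partition unfolding good_partition_def by blast
  then have "complete_to G (nbrs G y \<inter> K1) (nbrs G y \<inter> K3)" using assms(4) by blast
  moreover have "a \<in> nbrs G y \<inter> K1" "b \<in> nbrs G y \<inter> K3"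
    using assms(5-8) verts_eq by (simp_all add: nbrs_def)
  ultimately show ?thesis unfolding complete_to_def by blast
qed

lemma finite_K3: "finite K3"
  using finite_verts verts_eq by (auto intro: finite_subset)

text \<open>
  Side paths run from \<open>K3\<close> to \<open>K1\<close>, against the direction in condition (iii), since they are looked at from
  a vertex of \<open>K3\<close>. Single edges are included, for which (iii) says nothing.
\<close>

definition side_path :: "'a set \<Rightarrow> 'a \<Rightarrow> 'a list \<Rightarrow> bool" where
  "side_path X x p \<longleftrightarrow>
     chordless_path G p \<and> x \<in> K3 \<and> hd p = x \<and> last p \<in> K1 \<and> path_interior p \<subseteq> X"

lemma side_path_length:
  assumes "side_path X x p"
  shows "length p \<ge> 2" "\<not> x \<rightarrow> last p \<Longrightarrow> length p \<ge> 3" "length p \<ge> 3 \<Longrightarrow> \<not> x \<rightarrow> last p"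
proof -
  have p: "chordless_path G p" "hd p \<in> K3" "last p \<in> K1" "hd p = x" "p \<noteq> []"
    using assms by (auto simp: side_path_def chordless_path_def)
  then have "hd p \<noteq> last p" using disjoint by auto
  then show 2: "length p \<ge> 2" using p(5) by (cases p) (auto simp: Suc_le_eq)
  show "length p \<ge> 3" if "\<not> x \<rightarrow> last p"
    using chordless_length2[OF p(1) 2] that p by force
  show "\<not> x \<rightarrow> last p" if "length p \<ge> 3"
    using chordless_ends_nonadjacent[OF p(1) that] p by simp
qed

lemma side_path_set: "side_path X x p \<Longrightarrow> set p = {x, last p} \<union> path_interior p"
  by (auto simp: side_path_def path_interior_def chordless_path_def)

lemma L_path_penultimate:
  assumes "side_path L x (q @ [z, w])" "q \<noteq> []" "w' \<in> K1"
  shows "z \<rightarrow> w'"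
proof -
  let ?p = "rev (q @ [z, w])"
  have "chordless_path G ?p" "hd ?p \<in> K1" "last ?p \<in> K3" "path_interior ?p \<subseteq> L" "length ?p \<ge> 3"
    using assms chordless_rev[of "q @ [z, w]"] path_interior_rev[of "q @ [z, w]"]
    by (auto simp: side_path_def last_rev Suc_le_eq hd_append split: if_splits)
  then have "complete_to G {?p ! 1} K1"
    using good_partition unfolding good_partition_def by blast
  then show ?thesis using assms(3) by (auto simp: complete_to_def)
qed

lemma only_penultimate_sees_last:
  assumes "side_path X x (q @ [z, w])" "y \<in> set q"
  shows "\<not> y \<rightarrow> w"
proof -
  obtain i where i: "i < length q" "q ! i = y" using assms(2) by (metis in_set_conv_nth)
  have ad: "\<forall>i<length (q @ [z, w]). \<forall>j<length (q @ [z, w]).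
      (q @ [z, w]) ! i \<rightarrow> (q @ [z, w]) ! j \<longleftrightarrow> j = Suc i \<or> i = Suc j"
    using assms(1) unfolding side_path_def chordless_path_def by blast
  show ?thesis
    using ad[rule_format, of i "Suc (length q)"] i by (auto simp: nth_append)
qed

text \<open>
  The new end \<open>w'\<close> sees the penultimate vertex \<open>z\<close> by condition (iii). If it saw an earlier interior vertex,
  there would be a side path to \<open>w'\<close> that avoids \<open>z\<close>; by (iii) its penultimate vertex would see \<open>w\<close> as well,
  although only \<open>z\<close> does.
\<close>

lemma L_path_reroute:
  assumes p: "side_path L x (q @ [z, w])" "q \<noteq> []" and w': "w' \<in> K1" "\<not> x \<rightarrow> w'"
  shows "side_path L x (q @ [z, w'])"
proof (cases "w' = w")
  case True then show ?thesis using p by simp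
next
  case neq: False
  let ?p = "q @ [z, w]"
  have cp: "chordless_path G ?p" "hd q = x" "x \<in> K3" "w \<in> K1" "path_interior ?p \<subseteq> L"
    using p by (auto simp: side_path_def)
  have dist: "distinct ?p" "set ?p \<subseteq> verts G" using cp by (auto simp: chordless_path_def)
  have inner: "set q \<subseteq> insert x L" "z \<in> L"
    using dist cp p by (auto simp: path_interior_def)
  have suc: "successively (dominates G) ?p" using cp chordless_successively by blast
  have none: "\<not> w' \<rightarrow> y" if y: "y \<in> set q" for y
  proof
    assume "w' \<rightarrow> y"
    then have yw: "y \<rightarrow> w'" by (rule adj_sym)
    obtain q1 q2 where q12: "q = q1 @ y # q2" using y by (metis split_list)
    let ?S = "insert w' (set q)"
    have s: "successively (dominates G) (q1 @ [y, w'])"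
      using suc yw q12 by (auto simp: successively_append_iff)
    obtain r where r: "chordless_path G r" "set r \<subseteq> ?S" "hd r \<in> {x}" "last r \<in> {w'}"
      by (rule shortest_path[OF s, of ?S "{x}" "{w'}"])
        (use q12 dist w' verts_eq cp in \<open>auto simp: hd_append split: if_splits\<close>)
    have sr: "side_path L x r"
      using r cp w' inner unfolding side_path_def path_interior_def by auto
    then have "length r \<ge> 3" using side_path_length(2)[OF sr] w' r by auto
    then obtain q' z' v where r': "r = q' @ [z', v]" "q' \<noteq> []" by (rule path_last_two)
    have "z' \<rightarrow> w" using L_path_penultimate[OF sr[unfolded r'] r'(2) cp(4)] .
    moreover have "z' \<in> set q"
      using r r' by (auto simp: chordless_path_def)
    ultimately show False using only_penultimate_sees_last[OF p(1)] by blast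
  qed
  have "chordless_path G (q @ [z])" using chordless_butlast[OF cp(1)] by (simp add: butlast_append)
  moreover have "w' \<notin> set (q @ [z])" using inner w' cp disjoint by auto
  moreover have "w' \<rightarrow> z" using L_path_penultimate[OF p w'(1)] adj_sym by blast
  ultimately have "chordless_path G ((q @ [z]) @ [w'])"
    using none w' verts_eq by (intro chordless_snoc[of "q @ [z]" w']) auto
  moreover have "path_interior (q @ [z, w']) \<subseteq> L"
    using inner p(2) cp(2) by (auto simp: path_interior_def)
  ultimately show ?thesis using cp p w' by (auto simp: side_path_def)
qed

lemma L_path_to_nonneighbor:
  assumes "side_path L x p" "length p \<ge> 3" "w' \<in> K1" "\<not> x \<rightarrow> w'"
  obtains p' where "side_path L x p'" "length p' = length p" "last p' = w'"
    "path_interior p' = path_interior p"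
proof -
  obtain q z w where p: "p = q @ [z, w]" "q \<noteq> []" using assms(2) by (rule path_last_two)
  have s: "side_path L x (q @ [z, w'])" using L_path_reroute assms p by blast
  have "path_interior (q @ [z, v]) = insert z (set q) - {x}" if "side_path L x (q @ [z, v])" for v
    using that p(2) by (auto simp: side_path_def path_interior_def chordless_path_def)
  then show thesis using that[OF s] s assms(1) p by simp
qed

text \<open>
  Redirected to the end of \<open>q\<close>, the path \<open>p\<close> from \<open>v\<close> and the path that goes from \<open>v\<close> to \<open>u\<close> and then along
  \<open>q\<close> have common ends. The hypothesis on the interior of \<open>p\<close> is still about the original path, whose
  interior is not affected by the redirection.
\<close>

lemma two_sides_parity:
  assumes uv: "u \<in> K3" "v \<in> K3" "u \<noteq> v"
    and p: "side_path L v p" "length p \<ge> 3" and q: "side_path R u q"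
    and w: "\<not> v \<rightarrow> last q"
    and q_free: "\<And>y. y \<in> path_interior q \<Longrightarrow> \<not> v \<rightarrow> y"
    and p_free: "\<And>y. y \<in> path_interior p \<Longrightarrow> \<not> u \<rightarrow> y"
  shows "odd (length p + length q)"
proof -
  have lq: "last q \<in> K1" "path_interior q \<subseteq> R" "chordless_path G q" "hd q = u"
    using q by (auto simp: side_path_def)
  obtain p' where p': "side_path L v p'" "length p' = length p" "last p' = last q"
    "path_interior p' = path_interior p"
    using L_path_to_nonneighbor[OF p lq(1) w] .
  have sq: "set q = {u, last q} \<union> path_interior q" by (rule side_path_set[OF q])
  have "v \<rightarrow> u" using clique23 uv by auto
  then have c: "chordless_path G (v # q)"
    using lq uv w q_free sq disjoint verts_eq by (intro chordless_Cons[of q v]) auto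
  have ne: "q \<noteq> []" using lq by (auto simp: chordless_path_def)
  have i: "path_interior (v # q) \<subseteq> insert u (path_interior q)"
    using sq ne by (auto simp: path_interior_def)
  have pL: "path_interior p' \<subseteq> L" using p'(1) by (simp add: side_path_def)
  have anti: "anticomplete_to G (path_interior p') (path_interior (v # q))"
    unfolding anticomplete_to_def
  proof (intro ballI notI)
    fix x y assume xy: "x \<in> path_interior p'" "y \<in> path_interior (v # q)" "x \<rightarrow> y"
    then have "y \<rightarrow> x" by (blast intro: adj_sym)
    then have "y \<noteq> u" using p_free xy(1) p'(4) by blast
    then have "y \<in> R" using i lq(2) xy(2) by blast
    then show False using L_R xy pL by blast
  qed
  have disj: "path_interior p' \<inter> path_interior (v # q) = {}"
    using i lq(2) pL disjoint(6,10) uv(1) by blast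
  have ends: "chordless_path G p'" "hd p' = hd (v # q)" "last p' = last (v # q)"
    using p'(1,3) ne by (simp_all add: side_path_def)
  have long: "length p' \<ge> 3" "length (v # q) \<ge> 3"
    using p'(2) p(2) side_path_length(1)[OF q] by simp_all
  have "even (length p' + length (v # q))"
    by (rule two_paths_same_parity[OF berge ends(1) long(1) c long(2) ends(2,3) disj anti])
  then show ?thesis using p'(2) by simp
qed

lemma opposite_sides_same_parity:
  assumes p: "side_path L u p" "length p \<ge> 3" and q: "side_path R u q" "length q \<ge> 3"
  shows "even (length p + length q)"
proof -
  have lq: "last q \<in> K1" "path_interior q \<subseteq> R" "chordless_path G q" "hd q = u"
    using q by (auto simp: side_path_def)
  obtain p' where p': "side_path L u p'" "length p' = length p" "last p' = last q"
    "path_interior p' = path_interior p"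
    using L_path_to_nonneighbor[OF p lq(1) side_path_length(3)[OF q]] .
  have pL: "path_interior p' \<subseteq> L" using p'(1) by (simp add: side_path_def)
  have anti: "anticomplete_to G (path_interior p') (path_interior q)"
    using L_R lq(2) pL unfolding anticomplete_to_def by blast
  have disj: "path_interior p' \<inter> path_interior q = {}"
    using lq(2) pL disjoint(10) by blast
  have ends: "chordless_path G p'" "hd p' = hd q" "length p' \<ge> 3"
    using p'(1,2) p(2) lq(4) by (simp_all add: side_path_def)
  have "even (length p' + length q)"
    by (rule two_paths_same_parity[OF berge ends(1,3) lq(3) q(2) ends(2) p'(3) disj anti])
  then show ?thesis using p'(2) by simp
qed

text \<open>
  By condition (iv) no interior vertex sees both \<open>v\<close> and \<open>w'\<close>. If \<open>w'\<close> saw an interior vertex other than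
  the penultimate one, a path between \<open>v\<close> and \<open>w'\<close> through the interior could avoid the penultimate
  vertex \<open>z\<close>, which contradicts (iii) because only \<open>z\<close> sees the end of \<open>p\<close>. So \<open>w'\<close> sees just \<open>u\<close> and \<open>z\<close>, and
  closes the part of \<open>p\<close> from \<open>u\<close> to \<open>z\<close> to a hole.
\<close>

lemma attached_L_path_parity:
  assumes u: "w' \<in> K1" "u \<rightarrow> w'" and v: "v \<in> K3" "\<not> v \<rightarrow> w'"
    and p: "side_path L u p" "length p \<ge> 3" and s: "s \<in> path_interior p" "v \<rightarrow> s"
  shows "even (length p)"
proof -
  obtain q z w where pq: "p = q @ [z, w]" "q \<noteq> []" using p(2) by (rule path_last_two)
  obtain t where qt: "q = u # t" using p pq by (cases q) (auto simp: side_path_def)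
  have cp: "chordless_path G p" "u \<in> K3" "w \<in> K1" "path_interior p \<subseteq> L"
    using p pq by (auto simp: side_path_def)
  have dist: "distinct p" "set p \<subseteq> verts G" using cp by (auto simp: chordless_path_def)
  have int: "path_interior p = insert z (set t)"
    using dist pq qt by (auto simp: path_interior_def)
  have z: "z \<rightarrow> w'" using L_path_penultimate p pq u by blast
  have uw': "\<not> u \<rightarrow> w" using side_path_length(3)[OF p] pq by simp
  have zL: "z \<in> L" using int cp by auto
  have "s \<noteq> z"
    using edge_completeness[OF cp(2) u zL u(1) v(1) z] s(2) v(2) adj_sym by blast
  then have st: "s \<in> set t" using s int by auto
  have suc: "successively (dominates G) p" using cp chordless_successively by blast
  have none: "\<not> w' \<rightarrow> y" if y: "y \<in> set t" for y
  proof
    assume "w' \<rightarrow> y"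
    then have yw: "y \<rightarrow> w'" by (rule adj_sym)
    have "successively (dominates G) t" using suc pq qt by (auto simp: successively_append_iff successively_Cons)
    then obtain r where r: "successively (dominates G) r" "r \<noteq> []" "hd r = s" "last r = y" "set r \<subseteq> set t"
      using walk_between[OF _ st y] by blast
    let ?S = "insert v (insert w' (set t))"
    have sw: "successively (dominates G) (v # r @ [w'])"
      using r yw s by (auto simp: successively_append_iff successively_Cons hd_append)
    obtain k where k: "chordless_path G k" "set k \<subseteq> ?S" "hd k \<in> {v}" "last k \<in> {w'}"
      by (rule shortest_path[OF sw, of ?S "{v}" "{w'}"])
        (use r dist pq qt u v verts_eq in auto)
    have sk: "side_path L v k"
      using k v u int cp unfolding side_path_def path_interior_def[of k] by auto
    then have "length k \<ge> 3" using side_path_length(2)[OF sk] v k by auto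
    then obtain q' z' w'' where k': "k = q' @ [z', w'']" "q' \<noteq> []" by (rule path_last_two)
    have "z' \<rightarrow> w" using L_path_penultimate[OF sk[unfolded k'] k'(2) cp(3)] .
    moreover have "z' \<in> set q"
      using k k' qt by (auto simp: chordless_path_def hd_append)
    ultimately show False using only_penultimate_sees_last p pq by blast
  qed
  have c1: "chordless_path G (q @ [z])"
    using chordless_butlast[OF cp(1)] pq by (simp add: butlast_append)
  have "t \<noteq> []" using st by auto
  then have len: "length (q @ [z]) \<ge> 3" using qt by (cases t) auto
  have uz: "\<not> u \<rightarrow> z" "u \<noteq> z" using chordless_ends_nonadjacent[OF c1 len] qt by auto
  have w'n: "w' \<notin> set (q @ [z])" using u cp disjoint int qt by auto
  have "chordless_path G [z]"
    using dist pq adj_irrefl by (auto simp: chordless_path_def)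
  then have "chordless_path G [w', z]"
    using z w'n u verts_eq adj_sym by (intro chordless_Cons[of "[z]" w']) auto
  then have c2: "chordless_path G [u, w', z]"
    using u uz w'n qt cp verts_eq by (intro chordless_Cons[of "[w', z]" u]) auto
  have i1: "path_interior (q @ [z]) \<subseteq> set t" using qt by (auto simp: path_interior_def)
  have i2: "path_interior [u, w', z] \<subseteq> {w'}" by (auto simp: path_interior_def)
  have "even (length (q @ [z]) + length [u, w', z])"
  proof (rule two_paths_same_parity[OF berge c1 len c2])
    show "path_interior (q @ [z]) \<inter> path_interior [u, w', z] = {}"
      using i1 i2 w'n qt by auto
    show "anticomplete_to G (path_interior (q @ [z])) (path_interior [u, w', z])"
      using i1 i2 none adj_sym unfolding anticomplete_to_def by blast
  qed (use qt in auto)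
  then show ?thesis using pq by simp
qed

end

section \<open>Two-colored paths\<close>

locale colored_good_partition = good_partition_graph +
  fixes c1 c2 :: "'a \<Rightarrow> nat"
  assumes proper1: "\<And>x y. x \<in> verts G - R \<Longrightarrow> y \<in> verts G - R \<Longrightarrow> x \<rightarrow> y \<Longrightarrow> c1 x \<noteq> c1 y"
    and proper2: "\<And>x y. x \<in> verts G - L \<Longrightarrow> y \<in> verts G - L \<Longrightarrow> x \<rightarrow> y \<Longrightarrow> c2 x \<noteq> c2 y"
    and agree: "\<And>x. x \<in> K1 \<union> K2 \<Longrightarrow> c1 x = c2 x"
begin

lemma sides: "verts G - R = K1 \<union> K2 \<union> K3 \<union> L" "verts G - L = K1 \<union> K2 \<union> K3 \<union> R"
  using verts_eq disjoint by auto

lemma proper1': "x \<in> K1 \<union> K2 \<union> K3 \<union> L \<Longrightarrow> y \<in> K1 \<union> K2 \<union> K3 \<union> L \<Longrightarrow> x \<rightarrow> y \<Longrightarrow> c1 x \<noteq> c1 y"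
  and proper2': "x \<in> K1 \<union> K2 \<union> K3 \<union> R \<Longrightarrow> y \<in> K1 \<union> K2 \<union> K3 \<union> R \<Longrightarrow> x \<rightarrow> y \<Longrightarrow> c2 x \<noteq> c2 y"
  using proper1 proper2 unfolding sides by blast+

lemma inj1: "inj_on c1 K3" and inj2: "inj_on c2 K3"
  using proper1' proper2' clique23 by (auto simp: inj_on_def) metis+

lemma c1_eq: "x \<in> K3 \<Longrightarrow> y \<in> K3 \<Longrightarrow> c1 x = c1 y \<Longrightarrow> x = y"
  and c2_eq: "x \<in> K3 \<Longrightarrow> y \<in> K3 \<Longrightarrow> c2 x = c2 y \<Longrightarrow> x = y"
  using inj1 inj2 by (auto dest: inj_onD)

definition proper_side :: "('a \<Rightarrow> nat) \<Rightarrow> 'a set \<Rightarrow> bool" where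
  "proper_side c X \<longleftrightarrow>
     (\<forall>x \<in> K1 \<union> K2 \<union> K3 \<union> X. \<forall>y \<in> K1 \<union> K2 \<union> K3 \<union> X. x \<rightarrow> y \<longrightarrow> c x \<noteq> c y) \<and>
     (\<forall>x \<in> K1 \<union> K2. c x = c1 x)"

lemma proper_side_L: "proper_side c1 L" and proper_side_R: "proper_side c2 R"
  unfolding proper_side_def using proper1' proper2' agree by auto

definition two_colored_path ::
  "('a \<Rightarrow> nat) \<Rightarrow> 'a set \<Rightarrow> nat \<Rightarrow> nat \<Rightarrow> 'a \<Rightarrow> 'a list \<Rightarrow> bool" where
  "two_colored_path c X i h x p \<longleftrightarrow> side_path X x p \<and> (\<forall>y\<in>set p. c y = i \<or> c y = h)"

text \<open>
  The colors of \<open>K1\<close> form the set \<open>c1 ` K1\<close>. The parity in \<open>linked\<close> is the one that a path in two colors has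
  when exactly one of them occurs on \<open>K1\<close>: the last vertex then has that color. Stating the parity in this
  way makes it independent of the second color of the path.
\<close>

definition linked :: "('a \<Rightarrow> nat) \<Rightarrow> 'a set \<Rightarrow> 'a \<Rightarrow> bool" where
  "linked c X x \<longleftrightarrow>
     (\<exists>p. side_path X x p \<and> length p \<ge> 3 \<and> (odd (length p) \<longleftrightarrow> c x \<in> c1 ` K1))"

lemma side_path_vertices:
  assumes "side_path X x p"
  shows "set p \<subseteq> K1 \<union> K2 \<union> K3 \<union> X" "x \<in> set p" "last p \<in> set p" "last p \<in> K1" "x \<in> K3"
  using assms side_path_set[OF assms] by (auto simp: side_path_def)

lemma parity_of_two_colored:
  assumes ps: "proper_side c X" and p: "two_colored_path c X i h x p"
    and ih: "(i \<in> c1 ` K1) \<noteq> (h \<in> c1 ` K1)"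
  shows "odd (length p) \<longleftrightarrow> c x \<in> c1 ` K1"
proof -
  have sp: "side_path X x p" and col: "\<And>y. y \<in> set p \<Longrightarrow> c y = i \<or> c y = h"
    using p by (auto simp: two_colored_path_def)
  have ch: "chordless_path G p" "hd p = x" "p \<noteq> []"
    using sp by (auto simp: side_path_def chordless_path_def)
  note sv = side_path_vertices[OF sp]
  have "odd (length p) \<longleftrightarrow> c (hd p) = c (last p)"
  proof (rule alternating_parity)
    show "successively (dominates G) p" by (rule chordless_successively[OF ch(1)])
    show "c ` set p \<subseteq> {i, h}" using col by blast
    show "c a \<noteq> c b" if "a \<in> set p" "b \<in> set p" "a \<rightarrow> b" for a b
      using that sv(1) ps unfolding proper_side_def by blast
  qed (rule ch(3))
  moreover have "c (last p) \<in> c1 ` K1" using sv(4) ps unfolding proper_side_def by auto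
  moreover have "c x = i \<or> c x = h" "c (last p) = i \<or> c (last p) = h"
    using col sv by blast+
  ultimately show ?thesis using ih ch(2) by metis
qed

lemma linkedI:
  assumes "proper_side c X" "two_colored_path c X i h x p" "(i \<in> c1 ` K1) \<noteq> (h \<in> c1 ` K1)"
    and "length p \<ge> 3"
  shows "linked c X x"
  using assms parity_of_two_colored[OF assms(1-3)] unfolding linked_def two_colored_path_def by blast

lemma reroute_two_colored:
  assumes p: "two_colored_path c X i h y p" and x: "x \<in> K3" "c x = i \<or> c x = h"
    and s: "s \<in> path_interior p" "x \<rightarrow> s"
  obtains q where "two_colored_path c X i h x q"
proof -
  have sp: "side_path X y p" and col: "\<And>y. y \<in> set p \<Longrightarrow> c y = i \<or> c y = h"
    using p by (auto simp: two_colored_path_def)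
  have ch: "chordless_path G p" "hd p = y" "last p \<in> K1" "path_interior p \<subseteq> X"
    using sp by (auto simp: side_path_def)
  have "s \<in> set p" "s \<noteq> y" using s ch by (auto simp: path_interior_def)
  then obtain p1 p2 where p12: "p = p1 @ s # p2" by (metis split_list)
  have "p1 \<noteq> []" using p12 \<open>s \<noteq> y\<close> ch(2) by auto
  then have "y \<in> set p1" using p12 ch(2) by (cases p1) auto
  then have y: "y \<notin> set (s # p2)" using ch(1) p12 unfolding chordless_path_def by auto
  have "successively (dominates G) (s # p2)"
    using chordless_successively[OF ch(1)] p12 by (auto simp: successively_append_iff)
  then have w: "successively (dominates G) (x # s # p2)" using s(2) by simp
  let ?S = "insert x (set (s # p2))"
  have l: "last (x # s # p2) = last p" using p12 by simp
  have "set p \<subseteq> verts G" using ch(1) by (simp add: chordless_path_def)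
  then have sub: "?S \<subseteq> verts G" using p12 x(1) verts_eq by auto
  obtain q where q: "chordless_path G q" "set q \<subseteq> ?S" "hd q \<in> {x}" "last q \<in> {last p}"
    by (rule shortest_path[OF w _ _ sub, of "{x}" "{last p}"]) (use l in auto)
  have "path_interior q \<subseteq> path_interior p"
    using q y p12 ch(2) by (auto simp: path_interior_def)
  then have "side_path X x q" using q ch x unfolding side_path_def by auto
  moreover have "\<forall>z\<in>set q. c z = i \<or> c z = h" using q(2) col x(2) p12 by auto
  ultimately show thesis using that by (simp add: two_colored_path_def)
qed

text \<open>
  The colors \<open>c1 u\<close> and \<open>c2 u\<close> demand different parities of the two paths, and the paths form a hole.
\<close>

lemma not_linked_both:
  assumes "(c1 u \<in> c1 ` K1) \<noteq> (c2 u \<in> c1 ` K1)" "linked c1 L u" "linked c2 R u"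
  shows False
  using assms opposite_sides_same_parity unfolding linked_def by (meson even_add)

lemma no_edge_same_colors:
  assumes "x \<in> K3" "w \<in> K1" "c1 w = c1 x \<or> c1 w = c2 x"
  shows "\<not> x \<rightarrow> w"
  using assms proper1'[of x w] proper2'[of x w] agree[of w] by auto

lemma two_colored_path_long:
  assumes "two_colored_path c X i h x p" "proper_side c X" "{i, h} = {c1 x, c2 x}"
  shows "length p \<ge> 3"
proof -
  have sp: "side_path X x p" and col: "\<And>y. y \<in> set p \<Longrightarrow> c y = i \<or> c y = h"
    using assms by (auto simp: two_colored_path_def)
  note sv = side_path_vertices[OF sp]
  have "c1 (last p) = c (last p)" using sv(4) assms(2) by (auto simp: proper_side_def)
  then have "c1 (last p) = c1 x \<or> c1 (last p) = c2 x" using col[OF sv(3)] assms(3) by auto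
  then show ?thesis using side_path_length(2)[OF sp] no_edge_same_colors sv by blast
qed

text \<open>
  A penultimate vertex in \<open>L\<close> would be complete to \<open>K1\<close> by condition (iii), but some vertex of \<open>K1\<close> has its color.
\<close>

lemma two_colored_path_full:
  assumes "two_colored_path c1 L i h x p" "i \<in> c1 ` K1" "h \<in> c1 ` K1"
  shows "x \<rightarrow> last p"
proof (rule ccontr)
  assume n: "\<not> x \<rightarrow> last p"
  have sp: "side_path L x p" and col: "\<And>y. y \<in> set p \<Longrightarrow> c1 y = i \<or> c1 y = h"
    using assms by (auto simp: two_colored_path_def)
  obtain q z w where pq: "p = q @ [z, w]" "q \<noteq> []"
    using path_last_two[OF side_path_length(2)[OF sp n]] .
  have "c1 z \<in> c1 ` K1" using col[of z] pq assms by auto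
  then obtain w' where w': "w' \<in> K1" "c1 z = c1 w'" by auto
  have "z \<rightarrow> w'" using L_path_penultimate sp pq w' by blast
  moreover have "z \<in> K1 \<union> K2 \<union> K3 \<union> L" using side_path_vertices(1)[OF sp] pq by auto
  ultimately show False using proper1'[of z w'] w' by auto
qed

text \<open>
  The path \<open>p\<close>, in the colors of \<open>u\<close> under \<open>c1\<close> and \<open>c2\<close>, starts in \<open>v\<close>; the path \<open>q\<close>, in the colors of \<open>v\<close>,
  starts in \<open>u\<close>. A chord from \<open>u\<close> to \<open>p\<close> or from \<open>v\<close> to \<open>q\<close> would give a path in the same two colors that links \<open>u\<close>
  on the left or \<open>v\<close> on the right. As both paths start in the color \<open>c1 v = c2 u\<close>, they have the same
  parity, and the edge between \<open>u\<close> and \<open>v\<close> makes the hole odd.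
\<close>

lemma crossing_paths:
  assumes uv: "u \<in> K3" "v \<in> K3" "c1 v = c2 u"
    and types: "(c1 u \<in> c1 ` K1) \<noteq> (c1 v \<in> c1 ` K1)" "(c1 v \<in> c1 ` K1) \<noteq> (c2 v \<in> c1 ` K1)"
    and p: "two_colored_path c1 L (c1 u) (c1 v) v p" "length p \<ge> 3" and u: "\<not> linked c1 L u"
    and q: "two_colored_path c2 R (c1 v) (c2 v) u q" and v: "\<not> linked c2 R v"
  shows False
proof -
  have sp: "side_path L v p" and sq: "side_path R u q"
    using p q by (auto simp: two_colored_path_def)
  note vq = side_path_vertices[OF sq]
  have "c2 (last q) = c1 v \<or> c2 (last q) = c2 v" using q vq(3) by (auto simp: two_colored_path_def)
  then have w: "\<not> v \<rightarrow> last q" using no_edge_same_colors[OF uv(2) vq(4)] agree[of "last q"] vq(4) by auto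
  have qf: "\<not> v \<rightarrow> y" if y: "y \<in> path_interior q" for y
  proof
    assume "v \<rightarrow> y"
    then obtain r where r: "two_colored_path c2 R (c1 v) (c2 v) v r"
      using reroute_two_colored[OF q uv(2) _ y] by auto
    have "linked c2 R v"
      by (rule linkedI[OF proper_side_R r types(2) two_colored_path_long[OF r proper_side_R]]) simp
    then show False using v by simp
  qed
  have pf: "\<not> u \<rightarrow> y" if y: "y \<in> path_interior p" for y
  proof
    assume "u \<rightarrow> y"
    then obtain r where r: "two_colored_path c1 L (c1 u) (c1 v) u r"
      using reroute_two_colored[OF p(1) uv(1) _ y] by auto
    have "linked c1 L u"
      by (rule linkedI[OF proper_side_L r types(1) two_colored_path_long[OF r proper_side_L]])
        (simp add: uv)
    then show False using u by simp
  qed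
  have "u \<noteq> v" using types(1) by auto
  then have "odd (length p + length q)"
    using two_sides_parity[OF uv(1,2) _ sp p(2) sq w qf pf] by blast
  moreover have "odd (length p) \<longleftrightarrow> c1 v \<in> c1 ` K1"
    by (rule parity_of_two_colored[OF proper_side_L p(1) types(1)])
  moreover have "odd (length q) \<longleftrightarrow> c2 u \<in> c1 ` K1"
    by (rule parity_of_two_colored[OF proper_side_R q types(2)])
  ultimately show False using uv(3) by auto
qed

lemma kempe_chain_K3:
  assumes "x \<in> K3" "K3 \<subseteq> S"
  shows "kempe_chain (dominates G) S c x h \<inter> K3 = {z \<in> K3. c z \<in> {c x, h}}"
proof
  show "kempe_chain (dominates G) S c x h \<inter> K3 \<subseteq> {z \<in> K3. c z \<in> {c x, h}}"
    by (auto dest: kempe_chain_color)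
  show "{z \<in> K3. c z \<in> {c x, h}} \<subseteq> kempe_chain (dominates G) S c x h \<inter> K3"
  proof
    fix z assume z: "z \<in> {z \<in> K3. c z \<in> {c x, h}}"
    show "z \<in> kempe_chain (dominates G) S c x h \<inter> K3"
    proof (cases "z = x")
      case False
      then have "x \<rightarrow> z" using clique23 z assms by auto
      then show ?thesis using kempe_chain_step[OF kempe_chain_self, of "dominates G"] z assms by auto
    qed (use assms kempe_chain_self in auto)
  qed
qed

lemma two_colored_path_of_chain:
  assumes ps: "proper_side c X" and x: "x \<in> K3"
    and S: "S = K1 \<union> K2 \<union> K3 \<union> X" "S \<subseteq> verts G"
    and meets: "kempe_chain (dominates G) S c x h \<inter> (K1 \<union> K2) \<noteq> {}"
    and K2: "\<And>z. z \<in> K2 \<Longrightarrow> c z \<noteq> c x \<and> c z \<noteq> h"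
  obtains y p where "y \<in> K3" "c y = c x \<or> c y = h" "two_colored_path c X (c x) h y p"
proof -
  let ?r = "\<lambda>a b. a \<rightarrow> b \<and> b \<in> S \<and> c b \<in> {c x, h}"
  let ?S = "{z \<in> S. c z \<in> {c x, h}}"
  obtain w where w: "w \<in> K1 \<union> K2" "w \<in> kempe_chain (dominates G) S c x h" using meets by blast
  then have "c w \<in> {c x, h}" using kempe_chain_color by metis
  then have w1: "w \<in> K1" using w K2 by auto
  have "?r\<^sup>*\<^sup>* x w" using w by (simp add: kempe_chain_def)
  then have "\<exists>p. successively (dominates G) p \<and> p \<noteq> [] \<and> set p \<subseteq> ?S \<and> hd p = x \<and> last p = w"
  proof induction
    case base
    show ?case using x S by (intro exI[of _ "[x]"]) auto
  next
    case (step y z)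
    then obtain p where "successively (dominates G) p \<and> p \<noteq> [] \<and> set p \<subseteq> ?S \<and> hd p = x \<and> last p = y"
      by blast
    then show ?case using step.hyps
      by (intro exI[of _ "p @ [z]"]) (auto simp: successively_append_iff)
  qed
  then obtain p where p: "successively (dominates G) p" "p \<noteq> []" "set p \<subseteq> ?S" "hd p = x" "last p = w"
    by blast
  have sub: "?S \<subseteq> verts G" using S by auto
  obtain q where q: "chordless_path G q" "set q \<subseteq> ?S" "hd q \<in> K3" "last q \<in> K1"
    "path_interior q \<inter> (K3 \<union> K1) = {}"
    by (rule shortest_path[OF p(1-3) sub, of K3 K1]) (use p x w1 in auto)
  have "path_interior q \<subseteq> ?S" using q(2) by (auto simp: path_interior_def)
  then have "path_interior q \<subseteq> X" using q(5) K2 S(1) by auto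
  then have "side_path X (hd q) q" using q by (simp add: side_path_def)
  moreover have col: "\<forall>z\<in>set q. c z = c x \<or> c z = h" using q(2) by auto
  moreover have "q \<noteq> []" using q(1) by (simp add: chordless_path_def)
  ultimately show thesis using that[of "hd q" q] q(3) by (simp add: two_colored_path_def)
qed

end

section \<open>Kempe-optimal pairs of colorings agree\<close>

locale kempe_optimal = colored_good_partition +
  assumes optimal1: "\<And>x y C. x \<in> K3 \<Longrightarrow> y \<in> K3 \<Longrightarrow>
      C = kempe_chain (dominates G) (verts G - R) c1 x (c2 y) \<Longrightarrow> C \<inter> (K1 \<union> K2) = {} \<Longrightarrow>
      \<not> potential K3 c1 c2 < potential K3 (swap_on C (c1 x) (c2 y) c1) c2"
    and optimal2: "\<And>x y C. x \<in> K3 \<Longrightarrow> y \<in> K3 \<Longrightarrow>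
      C = kempe_chain (dominates G) (verts G - L) c2 x (c1 y) \<Longrightarrow> C \<inter> (K1 \<union> K2) = {} \<Longrightarrow>
      \<not> potential K3 c2 c1 < potential K3 (swap_on C (c2 x) (c1 y) c2) c1"
begin

abbreviation "T \<equiv> c1 ` K1"

lemma K2_colors:
  assumes "x \<in> K3" "z \<in> K2"
  shows "c1 z \<noteq> c1 x" "c2 z \<noteq> c2 x" "c1 z \<noteq> c2 x" "c2 z \<noteq> c1 x"
proof -
  have "z \<noteq> x" using assms disjoint(3) by auto
  then have "z \<rightarrow> x" using clique23 assms by blast
  then show "c1 z \<noteq> c1 x" "c2 z \<noteq> c2 x"
    using proper1'[of z x] proper2'[of z x] assms by auto
  then show "c1 z \<noteq> c2 x" "c2 z \<noteq> c1 x" using agree[of z] assms by auto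
qed

text \<open>
  If the chain of \<open>u\<close> in its two colors avoided \<open>K1 \<union> K2\<close>, swapping it would make \<open>u\<close> agree. It cannot
  meet \<open>K2\<close>, whose vertices are complete to \<open>K3\<close> and equally colored on both sides. The path may start
  in the only other vertex of \<open>K3\<close> on the chain, the next vertex here and the previous vertex in
  the mirror image below.
\<close>

lemma left_path_of_disagreeing:
  assumes u: "u \<in> K3" "c1 u \<noteq> c2 u"
  obtains y p where "y \<in> K3" "y = u \<or> c1 y = c2 u" "two_colored_path c1 L (c1 u) (c2 u) y p"
proof -
  let ?C = "kempe_chain (dominates G) (verts G - R) c1 u (c2 u)"
  have "?C \<inter> K3 = {x \<in> K3. c1 x \<in> {c1 u, c2 u}}"
    using u(1) by (intro kempe_chain_K3) (auto simp: sides)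
  then have "?C \<inter> (K1 \<union> K2) \<noteq> {}"
    using potential_increase_single[OF finite_K3 inj1 inj2 u] optimal1[OF u(1,1) refl] by blast
  then obtain y p where "y \<in> K3" "c1 y = c1 u \<or> c1 y = c2 u"
      "two_colored_path c1 L (c1 u) (c2 u) y p"
    using two_colored_path_of_chain[OF proper_side_L u(1) sides(1)] K2_colors[OF u(1)] by blast
  then show thesis using that c1_eq[OF _ u(1)] by blast
qed

lemma right_path_of_disagreeing:
  assumes u: "u \<in> K3" "c1 u \<noteq> c2 u"
  obtains y p where "y \<in> K3" "y = u \<or> c2 y = c1 u" "two_colored_path c2 R (c2 u) (c1 u) y p"
proof -
  let ?C = "kempe_chain (dominates G) (verts G - L) c2 u (c1 u)"
  have "?C \<inter> K3 = {x \<in> K3. c2 x \<in> {c2 u, c1 u}}"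
    using u(1) by (intro kempe_chain_K3) (auto simp: sides)
  then have "?C \<inter> (K1 \<union> K2) \<noteq> {}"
    using potential_increase_single[OF finite_K3 inj2 inj1 u(1) u(2)[symmetric]]
      optimal2[OF u(1,1) refl] by blast
  then obtain y p where "y \<in> K3" "c2 y = c2 u \<or> c2 y = c1 u"
      "two_colored_path c2 R (c2 u) (c1 u) y p"
    using two_colored_path_of_chain[OF proper_side_R u(1) sides(2)] K2_colors[OF u(1)] by blast
  then show thesis using that c2_eq[OF _ u(1)] by blast
qed

lemma last_color:
  assumes "two_colored_path c1 L i h y p \<or> two_colored_path c2 R i h y p"
  shows "last p \<in> K1" "c1 (last p) = i \<or> c1 (last p) = h"
proof -
  have sp: "side_path L y p \<or> side_path R y p"
    using assms by (auto simp: two_colored_path_def)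
  then have l: "last p \<in> K1" "last p \<in> set p" using side_path_vertices by blast+
  show "last p \<in> K1" by (rule l(1))
  show "c1 (last p) = i \<or> c1 (last p) = h"
    using assms l agree[of "last p"] by (auto simp: two_colored_path_def)
qed

lemma some_color_in_T:
  assumes "u \<in> K3" "c1 u \<noteq> c2 u"
  shows "c1 u \<in> T \<or> c2 u \<in> T"
proof -
  obtain y p where "two_colored_path c1 L (c1 u) (c2 u) y p" using left_path_of_disagreeing[OF assms] .
  note l = last_color[OF disjI1[OF this]]
  have "c1 (last p) \<in> T" using l(1) by blast
  then show ?thesis using l(2) by auto
qed

text \<open>
  The path through \<open>L\<close> degenerates to an edge, whose end in \<open>K3\<close> cannot be \<open>u\<close>.
\<close>

lemma both_colors_in_T:
  assumes u: "u \<in> K3" "c1 u \<noteq> c2 u" and T: "c1 u \<in> T" "c2 u \<in> T"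
  obtains v w where "v \<in> K3" "c1 v = c2 u" "w \<in> K1" "c1 w = c1 u" "v \<rightarrow> w"
proof -
  obtain y p where y: "y \<in> K3" "y = u \<or> c1 y = c2 u" and p: "two_colored_path c1 L (c1 u) (c2 u) y p"
    using left_path_of_disagreeing[OF u] .
  have e: "y \<rightarrow> last p" by (rule two_colored_path_full[OF p T])
  note l = last_color[OF disjI1[OF p]]
  have "y \<noteq> u" using e no_edge_same_colors[OF u(1) l(1,2)] by blast
  then have cy: "c1 y = c2 u" using y by blast
  then have "c1 (last p) = c1 u" using l e no_edge_same_colors[OF y(1) l(1)] by auto
  then show thesis using that y cy l e by blast
qed

lemma next_disagrees:
  assumes "u \<in> K3" "c1 u \<noteq> c2 u" "v \<in> K3" "c1 v = c2 u"
  shows "c1 v \<noteq> c2 v"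
  using assms c2_eq[of v u] by auto

lemma previous_disagrees:
  assumes "u \<in> K3" "c1 u \<noteq> c2 u" "v \<in> K3" "c2 v = c1 u"
  shows "c1 v \<noteq> c2 v"
  using assms c1_eq[of v u] by auto

lemma K1_neighborhoods_chain:
  assumes "x \<in> K3" "y \<in> K3" "w \<in> K1" "x \<rightarrow> w" "\<not> y \<rightarrow> w" "v \<in> K1" "y \<rightarrow> v"
  shows "x \<rightarrow> v"
proof (rule ccontr)
  assume n: "\<not> x \<rightarrow> v"
  have "x \<noteq> y" "w \<noteq> v" using assms n by auto
  then have "x \<rightarrow> y" "w \<rightarrow> v" using clique12 clique23 assms by auto
  then show False
    using square_free_no_square[OF square_free, of x w v y] assms n adj_sym disjoint(2) by auto
qed

lemma obtain_max_disagreeing: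
  assumes "u \<in> K3" "c1 u \<noteq> c2 u"
  obtains m where "m \<in> K3" "c1 m \<noteq> c2 m"
    "\<And>v w. v \<in> K3 \<Longrightarrow> c1 v \<noteq> c2 v \<Longrightarrow> w \<in> K1 \<Longrightarrow> v \<rightarrow> w \<Longrightarrow> m \<rightarrow> w"
proof -
  let ?B = "{v \<in> K3. c1 v \<noteq> c2 v}"
  let ?N = "\<lambda>v. {w \<in> K1. v \<rightarrow> w}"
  have finN: "finite (?N v)" for v
    using finite_subset[of "?N v" "verts G"] finite_verts verts_eq by auto
  have "finite ?B" "?B \<noteq> {}" using finite_K3 assms by auto
  then have fin: "finite ((\<lambda>v. card (?N v)) ` ?B)" and ne: "(\<lambda>v. card (?N v)) ` ?B \<noteq> {}"
    by blast+
  from Max_in[OF fin ne] obtain m where m1: "m \<in> ?B" "Max ((\<lambda>v. card (?N v)) ` ?B) = card (?N m)"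
    by (rule imageE)
  then have m: "m \<in> ?B" "\<And>v. v \<in> ?B \<Longrightarrow> card (?N v) \<le> card (?N m)"
    using Max_ge[OF fin] by force+
  have "m \<rightarrow> w" if v: "v \<in> K3" "c1 v \<noteq> c2 v" "w \<in> K1" "v \<rightarrow> w" for v w
  proof (rule ccontr)
    assume n: "\<not> m \<rightarrow> w"
    have "?N m \<subset> ?N v"
      using K1_neighborhoods_chain[OF v(1) _ v(3,4) n] m(1) v n by blast
    then have "card (?N m) < card (?N v)" by (rule psubset_card_mono[OF finN])
    then show False using m(2)[of v] v by simp
  qed
  then show thesis using that[of m] m(1) by blast
qed

text \<open>
  If both colors of \<open>v\<close> occurred on \<open>K1\<close>, the vertex after \<open>v\<close> would see the vertex of \<open>K1\<close> with color \<open>c1 v\<close>,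
  and by maximality so would \<open>m\<close>; but this color is one of the colors of \<open>m\<close>.
\<close>

lemma one_color_in_T:
  assumes m: "m \<in> K3" "c1 m \<noteq> c2 m"
    and max: "\<And>v w. v \<in> K3 \<Longrightarrow> c1 v \<noteq> c2 v \<Longrightarrow> w \<in> K1 \<Longrightarrow> v \<rightarrow> w \<Longrightarrow> m \<rightarrow> w"
    and v: "v \<in> K3" "c1 v \<noteq> c2 v" "c1 v = c1 m \<or> c1 v = c2 m"
  shows "(c1 v \<in> T) \<noteq> (c2 v \<in> T)"
proof -
  have "\<not> (c1 v \<in> T \<and> c2 v \<in> T)"
  proof
    assume "c1 v \<in> T \<and> c2 v \<in> T"
    then obtain z w where z: "z \<in> K3" "c1 z = c2 v" "w \<in> K1" "c1 w = c1 v" "z \<rightarrow> w"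
      using both_colors_in_T[OF v(1,2)] by blast
    have "m \<rightarrow> w" using max[OF z(1) next_disagrees[OF v(1,2) z(1,2)] z(3,5)] .
    then show False using no_edge_same_colors[OF m(1) z(3)] z(4) v(3) by auto
  qed
  then show ?thesis using some_color_in_T[OF v(1,2)] by blast
qed

lemma unlinked_previous:
  assumes u: "u \<in> K3" "c1 u \<noteq> c2 u" and T: "(c1 u \<in> T) \<noteq> (c2 u \<in> T)" and n: "\<not> linked c2 R u"
  obtains y q where "y \<in> K3" "c2 y = c1 u" "y \<noteq> u" "two_colored_path c2 R (c2 u) (c1 u) y q"
proof -
  obtain y q where y: "y \<in> K3" "y = u \<or> c2 y = c1 u" and q: "two_colored_path c2 R (c2 u) (c1 u) y q"
    using right_path_of_disagreeing[OF u] .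
  have "y \<noteq> u"
  proof
    assume "y = u"
    then have "linked c2 R u"
      using linkedI[OF proper_side_R, of "c2 u" "c1 u" u q] q T
        two_colored_path_long[OF _ proper_side_R, of "c2 u" "c1 u" u q] by auto
    then show False using n by simp
  qed
  then show thesis using that y q by blast
qed

lemma unlinked_next:
  assumes u: "u \<in> K3" "c1 u \<noteq> c2 u" and T: "(c1 u \<in> T) \<noteq> (c2 u \<in> T)" and n: "\<not> linked c1 L u"
  obtains y q where "y \<in> K3" "c1 y = c2 u" "y \<noteq> u" "two_colored_path c1 L (c1 u) (c2 u) y q"
proof -
  obtain y q where y: "y \<in> K3" "y = u \<or> c1 y = c2 u" and q: "two_colored_path c1 L (c1 u) (c2 u) y q"
    using left_path_of_disagreeing[OF u] .
  have "y \<noteq> u"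
  proof
    assume "y = u"
    then have "linked c1 L u"
      using linkedI[OF proper_side_L, of "c1 u" "c2 u" u q] q T
        two_colored_path_long[OF _ proper_side_L, of "c1 u" "c2 u" u q] by auto
    then show False using n by simp
  qed
  then show thesis using that y q by blast
qed

lemma two_colored_path_commute: "two_colored_path c X i h x p = two_colored_path c X h i x p"
  by (auto simp: two_colored_path_def)

text \<open>
  As \<open>v\<close> is linked on the left, it is not linked on the right, so the right path of \<open>v\<close> starts in its
  previous vertex \<open>u\<close> and crosses \<open>p\<close>.
\<close>

lemma path_from_next_contradiction:
  assumes u: "u \<in> K3" "c1 u \<noteq> c2 u" and v: "v \<in> K3" "c1 v = c2 u"
    and types: "(c1 u \<in> T) \<noteq> (c2 u \<in> T)" "(c1 v \<in> T) \<noteq> (c2 v \<in> T)"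
    and p: "two_colored_path c1 L (c1 u) (c2 u) v p" "length p \<ge> 3" and n: "\<not> linked c1 L u"
  shows False
proof -
  have bv: "c1 v \<noteq> c2 v" using next_disagrees[OF u v] .
  have "linked c1 L v" by (rule linkedI[OF proper_side_L p(1) types(1) p(2)])
  then have nv: "\<not> linked c2 R v" using not_linked_both types(2) by blast
  obtain y q where y: "y \<in> K3" "c2 y = c1 v" and q: "two_colored_path c2 R (c2 v) (c1 v) y q"
    using unlinked_previous[OF v(1) bv types(2) nv] by blast
  have "y = u" using c2_eq[OF y(1) u(1)] y v by simp
  then show False
    using crossing_paths[OF u(1) v _ types(2) _ p(2) n _ nv, of q] types p q v
    by (simp add: two_colored_path_commute[of c2])
qed

text \<open>
  The vertex \<open>u\<close> is a disagreeing vertex with largest neighborhood in \<open>K1\<close>, and \<open>v\<close> the vertex before it.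
  First \<open>u\<close> is linked on the left, so it is not linked on the right and the right path of \<open>u\<close> starts in \<open>v\<close>.
  If both colors of \<open>v\<close> occur on \<open>K1\<close>, then \<open>u\<close> sees the vertex \<open>w\<close> of \<open>K1\<close> with color \<open>c1 v\<close>, and condition
  (iv) excludes the chords that could prevent an odd hole. Otherwise the left path of \<open>v\<close> starts in
  \<open>u\<close>. If it is not an edge, the two paths cross. If it is an edge, the chain of \<open>v\<close> in the colors
  \<open>c1 v\<close> and \<open>c2 u\<close> comes into play; it can only be unswappable because of a vertex \<open>z\<close> after \<open>u\<close>, and then
  the paths of \<open>z\<close> and of the vertex \<open>t\<close> after it cross.
\<close>

theorem agree_on_K3:
  assumes "x \<in> K3"
  shows "c1 x = c2 x"
proof (rule ccontr)
  assume "c1 x \<noteq> c2 x"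
  then obtain u where u: "u \<in> K3" "c1 u \<noteq> c2 u" and
    max: "\<And>v w. v \<in> K3 \<Longrightarrow> c1 v \<noteq> c2 v \<Longrightarrow> w \<in> K1 \<Longrightarrow> v \<rightarrow> w \<Longrightarrow> u \<rightarrow> w"
    using obtain_max_disagreeing[OF assms] by metis
  have one: "(c1 v \<in> T) \<noteq> (c2 v \<in> T)"
    if "v \<in> K3" "c1 v \<noteq> c2 v" "c1 v = c1 u \<or> c1 v = c2 u" for v
    using one_color_in_T[OF u _ that] max by blast
  have Tu: "(c1 u \<in> T) \<noteq> (c2 u \<in> T)" using one[OF u] by simp
  have linku: "linked c1 L u"
  proof (rule ccontr)
    assume n: "\<not> linked c1 L u"
    obtain v p where v: "v \<in> K3" "c1 v = c2 u" and p: "two_colored_path c1 L (c1 u) (c2 u) v p"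
      using unlinked_next[OF u Tu n] by blast
    have bv: "c1 v \<noteq> c2 v" by (rule next_disagrees[OF u v])
    note l = last_color[OF disjI1[OF p]]
    have "\<not> v \<rightarrow> last p"
      using max[OF v(1) bv l(1)] no_edge_same_colors[OF u(1) l(1,2)] by blast
    then have len: "length p \<ge> 3"
      using side_path_length(2) p unfolding two_colored_path_def by blast
    show False
      using path_from_next_contradiction[OF u v Tu one[OF v(1) bv] p len n] v by simp
  qed
  then have nu: "\<not> linked c2 R u" using not_linked_both Tu by blast
  obtain v q where v: "v \<in> K3" "c2 v = c1 u" "v \<noteq> u" and q: "two_colored_path c2 R (c2 u) (c1 u) v q"
    using unlinked_previous[OF u Tu nu] .
  have bv: "c1 v \<noteq> c2 v" by (rule previous_disagrees[OF u v(1,2)])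
  note lq = last_color[OF disjI2[OF q]]
  have uq: "\<not> u \<rightarrow> last q" using no_edge_same_colors[OF u(1) lq(1)] lq(2) by auto
  then have "\<not> v \<rightarrow> last q" using max[OF v(1) bv lq(1)] by blast
  then have lenq: "length q \<ge> 3"
    using side_path_length(2) q unfolding two_colored_path_def by blast
  have sq: "side_path R v q" using q by (simp add: two_colored_path_def)
  obtain P where P: "side_path L u P" "length P \<ge> 3" "odd (length P) \<longleftrightarrow> c1 u \<in> T"
    using linku unfolding linked_def by blast
  have Tq: "(c2 u \<in> T) \<noteq> (c1 u \<in> T)" using Tu by blast
  have parq: "odd (length q) \<longleftrightarrow> c1 u \<in> T"
    using parity_of_two_colored[OF proper_side_R q Tq] v(2) by simp
  have uq_free: "\<not> u \<rightarrow> y" if y: "y \<in> path_interior q" for y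
  proof
    assume "u \<rightarrow> y"
    then obtain r where r: "two_colored_path c2 R (c2 u) (c1 u) u r"
      using reroute_two_colored[OF q u(1) _ y] by auto
    have "linked c2 R u"
      by (rule linkedI[OF proper_side_R r Tq two_colored_path_long[OF r proper_side_R]]) auto
    then show False using nu by simp
  qed
  show False
  proof (cases "(c1 v \<in> T) = (c2 v \<in> T)")
    case True
    then have Tv: "c1 v \<in> T" "c2 v \<in> T" using some_color_in_T[OF v(1) bv] by blast+
    obtain y w where y: "y \<in> K3" "c1 y = c2 v" and w: "w \<in> K1" "c1 w = c1 v" "y \<rightarrow> w"
      using both_colors_in_T[OF v(1) bv Tv] .
    have "y = u" using c1_eq[OF y(1) u(1)] y v by simp
    then have uw: "u \<rightarrow> w" using w by simp
    have vw: "\<not> v \<rightarrow> w" using no_edge_same_colors[OF v(1) w(1)] w(2) by blast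
    have oddP: "odd (length P)" using P(3) Tv v by simp
    (* P has an odd number of vertices, whereas a neighbor of v on it would force an even number. *)
    have "\<not> v \<rightarrow> s" if "s \<in> path_interior P" for s
      using attached_L_path_parity[OF w(1) uw v(1) vw P(1,2) that] oddP by blast
    then have "odd (length P + length q)"
      using two_sides_parity[OF v(1) u(1) v(3) P(1,2) sq uq uq_free] by blast
    then show False using P(3) parq by simp
  next
    case Tv: False
    have "linked c2 R v"
      using sq lenq parq v(2) unfolding linked_def by auto
    then have nv: "\<not> linked c1 L v" using not_linked_both Tv by blast
    obtain y p where y: "y \<in> K3" "c1 y = c2 v" and p: "two_colored_path c1 L (c1 v) (c2 v) y p"
      using unlinked_next[OF v(1) bv Tv nv] by blast
    have yu: "y = u" using c1_eq[OF y(1) u(1)] y v by simp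
    show False
    proof (cases "length p \<ge> 3")
      case True
      show False
        using path_from_next_contradiction[OF v(1) bv u(1) _ Tv Tu _ True nv] p yu v by simp
    next
      case False
      let ?w = "last p"
      note lp = last_color[OF disjI1[OF p]]
      have uw: "u \<rightarrow> ?w"
        using side_path_length(2)[of L u p] False p yu unfolding two_colored_path_def by blast
      have cw: "c1 ?w = c1 v" using lp no_edge_same_colors[OF u(1) lp(1)] uw v(2) by auto
      have T': "c1 v \<in> T" "c2 v \<notin> T" "c1 u \<notin> T" "c2 u \<in> T"
        using cw lp(1) Tv Tu v(2) by (auto simp: image_iff) metis+
      have neq: "c1 v \<noteq> c2 u"
        using no_edge_same_colors[OF u(1) lp(1)] uw cw by auto
      let ?C = "kempe_chain (dominates G) (verts G - R) c1 v (c2 u)"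
      have "?C \<inter> K3 = {x \<in> K3. c1 x \<in> {c1 v, c2 u}}"
        using v(1) by (intro kempe_chain_K3) (auto simp: sides)
      then have "?C \<inter> (K1 \<union> K2) \<noteq> {}"
        using potential_increase_pair[OF finite_K3 inj1 inj2 u(1) v(1,2) u(2) bv neq]
          optimal1[OF v(1) u(1) refl] by blast
      then obtain z r where z: "z \<in> K3" "c1 z = c1 v \<or> c1 z = c2 u"
          and r: "two_colored_path c1 L (c1 v) (c2 u) z r"
        using two_colored_path_of_chain[OF proper_side_L v(1) sides(1)] K2_colors[OF v(1)] K2_colors[OF u(1)]
        by blast
      have zr: "z \<rightarrow> last r" by (rule two_colored_path_full[OF r T'(1,4)])
      note lr = last_color[OF disjI1[OF r]]
      have "z \<noteq> v"
      proof
        assume "z = v"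
        then have "c1 (last r) = c2 u" using lr zr no_edge_same_colors[OF v(1) lr(1)] by blast
        then show False
          using max[OF v(1) bv lr(1)] zr \<open>z = v\<close> no_edge_same_colors[OF u(1) lr(1)] by blast
      qed
      then have cz: "c1 z = c2 u" using z c1_eq[OF z(1) v(1)] by blast
      have bz: "c1 z \<noteq> c2 z" by (rule next_disagrees[OF u z(1) cz])
      have Tz: "(c1 z \<in> T) \<noteq> (c2 z \<in> T)" using one[OF z(1) bz] cz by simp
      (* A left link of z would make the right path of z start in u and link u on the right. *)
      have nz: "\<not> linked c1 L z"
      proof
        assume "linked c1 L z"
        then have nR: "\<not> linked c2 R z" using not_linked_both Tz by blast
        obtain s k where s: "s \<in> K3" "c2 s = c1 z" and k: "two_colored_path c2 R (c2 z) (c1 z) s k"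
          using unlinked_previous[OF z(1) bz Tz nR] by blast
        have su: "s = u" using c2_eq[OF s(1) u(1)] s cz by simp
        note lk = last_color[OF disjI2[OF k]]
        have "c1 (last k) = c2 u" using lk T' Tz cz by (auto simp: image_iff)
        then have "\<not> u \<rightarrow> last k" using no_edge_same_colors[OF u(1) lk(1)] by blast
        then have "length k \<ge> 3" using side_path_length(2)[of R u k] k su unfolding two_colored_path_def by blast
        then have "linked c2 R u" using linkedI[OF proper_side_R k] Tz su by blast
        then show False using nu by simp
      qed
      obtain t k where t: "t \<in> K3" "c1 t = c2 z" and k: "two_colored_path c1 L (c1 z) (c2 z) t k"
        using unlinked_next[OF z(1) bz Tz nz] by blast
      have bt: "c1 t \<noteq> c2 t" by (rule next_disagrees[OF z(1) bz t])
      note lk = last_color[OF disjI1[OF k]]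
      have "c1 (last k) = c2 u" using lk T' Tz cz by (auto simp: image_iff)
      then have "\<not> u \<rightarrow> last k" using no_edge_same_colors[OF u(1) lk(1)] by blast
      then have "\<not> t \<rightarrow> last k" using max[OF t(1) bt lk(1)] by blast
      then have lenk: "length k \<ge> 3"
        using side_path_length(2) k unfolding two_colored_path_def by blast
      have "c1 t \<notin> T" using Tz T'(4) cz t(2) by simp
      then have "(c1 t \<in> T) \<noteq> (c2 t \<in> T)" using some_color_in_T[OF t(1) bt] by blast
      then show False
        using path_from_next_contradiction[OF z(1) bz t Tz _ k lenk nz] by blast
    qed
  qed
qed

end

section \<open>Reasoning about running times\<close>

text \<open>
  Total correctness with a time bound. The bound is a number, not a function of the state: all loops run
  over the vertices, so only the initial value of \<open>n\<close> matters.
\<close>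

definition runs :: "com \<Rightarrow> nat \<Rightarrow> state \<Rightarrow> (state \<Rightarrow> bool) \<Rightarrow> bool" where
  "runs c T s Q \<longleftrightarrow> (\<exists>t s'. exec c s t s' \<and> t \<le> T \<and> Q s')"

primrec assigned :: "com \<Rightarrow> string set" where
  "assigned Skip = {}"
| "assigned (Assign x e) = {x}"
| "assigned (Store a e f) = {}"
| "assigned (Seq c d) = assigned c \<union> assigned d"
| "assigned (Cond b c d) = assigned c \<union> assigned d"
| "assigned (While b c) = assigned c"

primrec stored :: "com \<Rightarrow> string set" where
  "stored Skip = {}"
| "stored (Assign x e) = {}"
| "stored (Store a e f) = {a}"
| "stored (Seq c d) = stored c \<union> stored d"
| "stored (Cond b c d) = stored c \<union> stored d"
| "stored (While b c) = stored c"

text \<open>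
  Frame conditions are read off from the program text by \<open>assigned\<close> and \<open>stored\<close>, so that the specifications
  below mention only what a program computes.
\<close>

definition unchanged :: "string set \<Rightarrow> string set \<Rightarrow> state \<Rightarrow> state \<Rightarrow> bool" where
  "unchanged X A s s' \<longleftrightarrow>
     (\<forall>x. x \<notin> X \<longrightarrow> scalar s' x = scalar s x) \<and> (\<forall>a. a \<notin> A \<longrightarrow> arr s' a = arr s a)"

abbreviation frame :: "com \<Rightarrow> state \<Rightarrow> state \<Rightarrow> bool" where
  "frame c \<equiv> unchanged (assigned c) (stored c)"

lemma unchanged_mono: "unchanged X A s s' \<Longrightarrow> X \<subseteq> Y \<Longrightarrow> A \<subseteq> B \<Longrightarrow> unchanged Y B s s'"
  by (auto simp: unchanged_def)

lemma exec_unchanged: "exec c s t s' \<Longrightarrow> frame c s s'"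
  by (induction rule: exec.induct) (auto simp: unchanged_def)

lemma runs_consequence:
  assumes "runs c T s P" "T \<le> U"
    and "\<And>s'. P s' \<Longrightarrow> frame c s s' \<Longrightarrow> Q s'"
  shows "runs c U s Q"
  using assms exec_unchanged unfolding runs_def by (meson le_trans)

lemma runs_Skip: "Q s \<Longrightarrow> runs Skip 1 s Q"
  using exec.Skip unfolding runs_def by blast

lemma runs_Assign: "Q (s\<lparr>scalar := (scalar s)(x := aval e s)\<rparr>) \<Longrightarrow> runs (Assign x e) 1 s Q"
  using exec.Assign unfolding runs_def by blast

lemma runs_Store:
  "Q (s\<lparr>arr := (arr s)(a := (arr s a)(aval e s := aval f s))\<rparr>) \<Longrightarrow> runs (Store a e f) 1 s Q"
  using exec.Store unfolding runs_def by blast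

lemma runs_Seq: "runs c T s (\<lambda>s'. runs d U s' Q) \<Longrightarrow> runs (Seq c d) (T + U) s Q"
  unfolding runs_def by (meson add_mono exec.Seq)

lemma runs_Seq':
  assumes "runs c T s P" "\<And>s'. P s' \<Longrightarrow> frame c s s' \<Longrightarrow> runs d U s' Q"
  shows "runs (Seq c d) (T + U) s Q"
  by (rule runs_Seq, rule runs_consequence[OF assms(1) order_refl assms(2)])

lemma runs_Cond:
  assumes "bval b s \<Longrightarrow> runs c T s Q" "\<not> bval b s \<Longrightarrow> runs d U s Q"
  shows "runs (Cond b c d) (1 + T + U) s Q"
proof (cases "bval b s")
  case True
  then obtain t s' where "exec c s t s'" "t \<le> T" "Q s'" using assms(1) by (auto simp: runs_def)
  then show ?thesis using True exec.CondTrue[of b s c t s' d] unfolding runs_def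
    by (intro exI[of _ "1 + t"] exI[of _ s']) auto
next
  case False
  then obtain t s' where "exec d s t s'" "t \<le> U" "Q s'" using assms(2) by (auto simp: runs_def)
  then show ?thesis using False exec.CondFalse[of b s d t s' c] unfolding runs_def
    by (intro exI[of _ "1 + t"] exI[of _ s']) auto
qed

definition for_up :: "string \<Rightarrow> com \<Rightarrow> com" where
  "for_up i c = Seq (Assign i (Lit 0))
     (While (Less (Var i) (Var ''n'')) (Seq c (Assign i (Plus (Var i) (Lit 1)))))"

definition for_time :: "nat \<Rightarrow> nat \<Rightarrow> nat" where
  "for_time n T = n * (T + 2) + 2"

lemma assigned_for_up [simp]: "assigned (for_up i c) = insert i (assigned c)"
  and stored_for_up [simp]: "stored (for_up i c) = stored c"
  by (auto simp: for_up_def)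

text \<open>
  The invariant must not depend on the loop counter, whose value \<open>k\<close> is its first argument instead. The
  body may rely on the frame condition relative to the state before the loop, which therefore need not be
  repeated in the invariant.
\<close>

lemma runs_for_up:
  assumes n: "scalar s ''n'' = n" and i: "i \<notin> assigned c" "i \<noteq> ''n''" "''n'' \<notin> assigned c"
    and init: "I 0 s"
    and stable: "\<And>k s v. I k s \<Longrightarrow> I k (s\<lparr>scalar := (scalar s)(i := v)\<rparr>)"
    and step: "\<And>k s'. k < n \<Longrightarrow> I k s' \<Longrightarrow> scalar s' i = k \<Longrightarrow>
      unchanged (insert i (assigned c)) (stored c) s s' \<Longrightarrow> runs c T s' (I (Suc k))"
    and post: "\<And>s'. I n s' \<Longrightarrow> unchanged (insert i (assigned c)) (stored c) s s' \<Longrightarrow> Q s'"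
  shows "runs (for_up i c) (for_time n T) s Q"
proof -
  let ?X = "insert i (assigned c)" and ?A = "stored c"
  let ?w = "While (Less (Var i) (Var ''n'')) (Seq c (Assign i (Plus (Var i) (Lit 1))))"
  have loop: "\<exists>t s''. exec ?w s' t s'' \<and> t \<le> (n - k) * (T + 2) + 1 \<and> I n s'' \<and> unchanged ?X ?A s s''"
    if "k \<le> n" "I k s'" "scalar s' i = k" "unchanged ?X ?A s s'" for k s'
    using that
  proof (induction "n - k" arbitrary: k s')
    case 0
    then have "\<not> bval (Less (Var i) (Var ''n'')) s'"
      using n i by (auto simp: unchanged_def)
    then have "exec ?w s' 1 s'" by (rule exec.WhileFalse)
    moreover have "k = n" using 0 by simp
    ultimately show ?case using 0 by (intro exI[of _ 1] exI[of _ s']) auto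
  next
    case (Suc m)
    then have kn: "k < n" by simp
    then have b: "bval (Less (Var i) (Var ''n'')) s'"
      using n i Suc.prems by (auto simp: unchanged_def)
    obtain t1 s1 where s1: "exec c s' t1 s1" "t1 \<le> T" "I (Suc k) s1"
      using step[OF kn Suc.prems(2-4)] by (auto simp: runs_def)
    have u1: "frame c s' s1" by (rule exec_unchanged[OF s1(1)])
    let ?s2 = "s1\<lparr>scalar := (scalar s1)(i := aval (Plus (Var i) (Lit 1)) s1)\<rparr>"
    have "scalar s1 i = k" using u1 i Suc.prems by (simp add: unchanged_def)
    then have "scalar ?s2 i = Suc k" by simp
    moreover have "I (Suc k) ?s2" by (rule stable[OF s1(3)])
    moreover have "unchanged ?X ?A s ?s2"
      using u1 Suc.prems(4) by (auto simp: unchanged_def)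
    moreover have "m = n - Suc k" "Suc k \<le> n" using Suc.hyps kn by auto
    ultimately obtain t2 s3 where s3: "exec ?w ?s2 t2 s3" "t2 \<le> (n - Suc k) * (T + 2) + 1"
      "I n s3" "unchanged ?X ?A s s3"
      using Suc.hyps(1)[of "Suc k" ?s2] by blast
    have "exec (Seq c (Assign i (Plus (Var i) (Lit 1)))) s' (t1 + 1) ?s2"
      by (rule exec.Seq[OF s1(1) exec.Assign])
    from exec.WhileTrue[OF b this s3(1)] have "exec ?w s' (1 + (t1 + 1) + t2) s3" .
    moreover have "1 + (t1 + 1) + t2 \<le> (n - k) * (T + 2) + 1"
    proof -
      have "n - k = Suc (n - Suc k)" using kn by simp
      then show ?thesis using s1(2) s3(2) by simp
    qed
    ultimately show ?case using s3 by blast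
  qed
  let ?s0 = "s\<lparr>scalar := (scalar s)(i := 0)\<rparr>"
  have "unchanged ?X ?A s ?s0" by (auto simp: unchanged_def)
  then obtain t s' where "exec ?w ?s0 t s'" "t \<le> n * (T + 2) + 1" "I n s'" "unchanged ?X ?A s s'"
    using loop[of 0 ?s0] stable[OF init, of 0] by auto
  moreover have "exec (Assign i (Lit 0)) s 1 ?s0" using exec.Assign[of i "Lit 0" s] by simp
  ultimately have "exec (for_up i c) s (1 + t) s'" "1 + t \<le> for_time n T" "Q s'"
    using exec.Seq[of "Assign i (Lit 0)" s 1 ?s0 ?w t s'] post
    by (simp_all add: for_up_def for_time_def)
  then show ?thesis unfolding runs_def by blast
qed

text \<open>
  Equality with a polynomial instead of a bound makes the closure properties immediate, also for
  \<open>for_time\<close>, which multiplies by the length of the loop.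
\<close>

definition poly_bounded :: "(nat \<Rightarrow> nat) \<Rightarrow> bool" where
  "poly_bounded f \<longleftrightarrow> (\<exists>q :: nat poly. \<forall>n. f n = poly q n)"

lemma poly_bounded_const: "poly_bounded (\<lambda>n. k)"
  unfolding poly_bounded_def by (intro exI[of _ "[:k:]"]) simp

lemma poly_bounded_add: "poly_bounded f \<Longrightarrow> poly_bounded g \<Longrightarrow> poly_bounded (\<lambda>n. f n + g n)"
  unfolding poly_bounded_def by (metis poly_add)

lemma poly_bounded_for_time: "poly_bounded f \<Longrightarrow> poly_bounded (\<lambda>n. for_time n (f n))"
proof -
  assume "poly_bounded f"
  then obtain q where "\<forall>n. f n = poly q n" by (auto simp: poly_bounded_def)
  then have "\<forall>n. for_time n (f n) = poly ([:0, 1:] * (q + [:2:]) + [:2:]) n"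
    by (simp add: for_time_def)
  then show ?thesis unfolding poly_bounded_def by blast
qed

section \<open>Programs for Kempe chains and the potential\<close>

definition either :: "bexp \<Rightarrow> bexp \<Rightarrow> bexp" where "either b c = Neg (Conj (Neg b) (Neg c))"

lemma bval_either [simp]: "bval (either b c) s \<longleftrightarrow> bval b s \<or> bval c s"
  by (simp add: either_def)

text \<open>
  For want of multiplication the offsets \<open>a * n\<close> of the rows of the adjacency matrix are tabulated in
  the array \<open>row\<close>.
\<close>

locale graph_memory =
  fixes n :: nat and E :: "nat \<Rightarrow> nat \<Rightarrow> bool" and part :: "nat \<Rightarrow> nat"
  assumes E_less: "E a b \<Longrightarrow> a < n \<and> b < n"
begin

definition memory :: "state \<Rightarrow> bool" where
  "memory s \<longleftrightarrow> scalar s ''n'' = n \<and> arr s ''part'' = part \<and> (\<forall>a<n. arr s ''row'' a = a * n) \<and>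
     (\<forall>a<n. \<forall>b<n. arr s ''adj'' (a * n + b) = (if E a b then 1 else 0))"

lemma memory_unchanged:
  "memory s \<Longrightarrow> unchanged X A s s' \<Longrightarrow> ''n'' \<notin> X \<Longrightarrow> ''part'' \<notin> A \<Longrightarrow> ''row'' \<notin> A \<Longrightarrow> ''adj'' \<notin> A \<Longrightarrow>
    memory s'"
  by (simp add: memory_def unchanged_def)

end

definition mark_step :: "string \<Rightarrow> nat \<Rightarrow> com" where
  "mark_step c excl =
     Cond (Conj (Conj (Equal (Arr ''mark'' (Var ''a'')) (Lit 1))
                      (Equal (Arr ''adj'' (Plus (Arr ''row'' (Var ''a'')) (Var ''b''))) (Lit 1)))
                (Conj (Neg (Equal (Arr ''part'' (Var ''b'')) (Lit excl)))
                      (either (Equal (Arr c (Var ''b'')) (Var ''i''))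
                              (Equal (Arr c (Var ''b'')) (Var ''h'')))))
       (Store ''mark'' (Var ''b'') (Lit 1)) Skip"

definition mark_chain :: "string \<Rightarrow> nat \<Rightarrow> com" where
  "mark_chain c excl = for_up ''r'' (for_up ''a'' (for_up ''b'' (mark_step c excl)))"

lemma mark_vars [simp]:
  "assigned (mark_step c excl) = {}" "stored (mark_step c excl) = {''mark''}"
  "assigned (mark_chain c excl) = {''r'', ''a'', ''b''}" "stored (mark_chain c excl) = {''mark''}"
  by (auto simp: mark_step_def mark_chain_def)

definition marked :: "nat \<Rightarrow> state \<Rightarrow> nat set" where
  "marked n s = {a. a < n \<and> arr s ''mark'' a = 1}"

lemma marked_scalar [simp]: "marked n (s\<lparr>scalar := f\<rparr>) = marked n s"
  by (simp add: marked_def)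

context graph_memory
begin

abbreviation step_rel where
  "step_rel c excl i h a b \<equiv> E a b \<and> part b \<noteq> excl \<and> (c b = i \<or> c b = h)"

lemma runs_mark_step:
  assumes "memory s" "arr s c = col" "scalar s ''i'' = i" "scalar s ''h'' = h"
    and "scalar s ''a'' = u" "u < n" "scalar s ''b'' = v" "v < n"
    and "\<And>s'. marked n s' =
      (if u \<in> marked n s \<and> step_rel col excl i h u v then insert v (marked n s) else marked n s) \<Longrightarrow> Q s'"
  shows "runs (mark_step c excl) 3 s Q"
proof -
  have t: "bval (Conj (Conj (Equal (Arr ''mark'' (Var ''a'')) (Lit 1))
                      (Equal (Arr ''adj'' (Plus (Arr ''row'' (Var ''a'')) (Var ''b''))) (Lit 1)))
                (Conj (Neg (Equal (Arr ''part'' (Var ''b'')) (Lit excl)))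
                      (either (Equal (Arr c (Var ''b'')) (Var ''i''))
                              (Equal (Arr c (Var ''b'')) (Var ''h''))))) s
    \<longleftrightarrow> u \<in> marked n s \<and> step_rel col excl i h u v"
    using assms(1-8) by (auto simp: memory_def marked_def)
  have "runs (mark_step c excl) (1 + 1 + 1) s Q"
    unfolding mark_step_def
  proof (rule runs_Cond; unfold t)
    assume r: "u \<in> marked n s \<and> step_rel col excl i h u v"
    show "runs (Store ''mark'' (Var ''b'') (Lit 1)) 1 s Q"
      by (rule runs_Store, rule assms(9)) (use r assms(7,8) in \<open>auto simp: marked_def\<close>)
  next
    assume "\<not> (u \<in> marked n s \<and> step_rel col excl i h u v)"
    then show "runs Skip 1 s Q"
      by (intro runs_Skip assms(9)) auto
  qed
  then show ?thesis by (simp add: numeral_3_eq_3)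
qed

lemma runs_mark_row:
  assumes s: "memory s" "c \<noteq> ''mark''" "arr s c = col" "scalar s ''i'' = i" "scalar s ''h'' = h"
    and u: "scalar s ''a'' = u" "u < n"
    and Q: "\<And>s'. marked n s' =
      marked n s \<union> {v. u \<in> marked n s \<and> step_rel col excl i h u v} \<Longrightarrow> Q s'"
  shows "runs (for_up ''b'' (mark_step c excl)) (for_time n 3) s Q"
proof (rule runs_for_up[where I = "\<lambda>k s'. marked n s' =
    marked n s \<union> {v. v < k \<and> u \<in> marked n s \<and> step_rel col excl i h u v}"])
  show "scalar s ''n'' = n" using s by (simp add: memory_def)
next
  fix k s' assume k: "k < n" and I: "marked n s' =
    marked n s \<union> {v. v < k \<and> u \<in> marked n s \<and> step_rel col excl i h u v}"
    and b: "scalar s' ''b'' = k"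
    and un: "unchanged (insert ''b'' (assigned (mark_step c excl))) (stored (mark_step c excl)) s s'"
  show "runs (mark_step c excl) 3 s' (\<lambda>s'. marked n s' =
    marked n s \<union> {v. v < Suc k \<and> u \<in> marked n s \<and> step_rel col excl i h u v})"
  proof (rule runs_mark_step[where u = u and v = k])
    show "memory s'" by (rule memory_unchanged[OF s(1) un]) simp_all
    show "arr s' c = col" "scalar s' ''i'' = i" "scalar s' ''h'' = h" "scalar s' ''a'' = u"
      using un s u by (simp_all add: unchanged_def)
    fix s'' assume *: "marked n s'' = (if u \<in> marked n s' \<and> step_rel col excl i h u k
        then insert k (marked n s') else marked n s')"
    show "marked n s'' =
      marked n s \<union> {v. v < Suc k \<and> u \<in> marked n s \<and> step_rel col excl i h u v}"
      unfolding * unfolding I by (auto simp: less_Suc_eq)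
  qed (use u k b in auto)
next
  fix s' assume "marked n s' =
    marked n s \<union> {v. v < n \<and> u \<in> marked n s \<and> step_rel col excl i h u v}"
  then show "Q s'" using E_less by (intro Q) auto
qed auto

lemma runs_mark_round:
  assumes s: "memory s" "c \<noteq> ''mark''" "arr s c = col" "scalar s ''i'' = i" "scalar s ''h'' = h"
    and Q: "\<And>s'. marked n s \<subseteq> marked n s' \<Longrightarrow>
       (\<forall>a\<in>marked n s. \<forall>b. step_rel col excl i h a b \<longrightarrow> b \<in> marked n s') \<Longrightarrow>
       (\<forall>b\<in>marked n s'. \<exists>a\<in>marked n s. (step_rel col excl i h)\<^sup>*\<^sup>* a b) \<Longrightarrow> Q s'"
  shows "runs (for_up ''a'' (for_up ''b'' (mark_step c excl))) (for_time n (for_time n 3)) s Q"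
proof -
  let ?r = "step_rel col excl i h"
  let ?I = "\<lambda>k s'. marked n s \<subseteq> marked n s' \<and>
       (\<forall>a\<in>marked n s. a < k \<longrightarrow> (\<forall>b. ?r a b \<longrightarrow> b \<in> marked n s')) \<and>
       (\<forall>b\<in>marked n s'. \<exists>a\<in>marked n s. ?r\<^sup>*\<^sup>* a b)"
  show ?thesis
  proof (rule runs_for_up[where I = ?I])
    show "scalar s ''n'' = n" using s by (simp add: memory_def)
  next
    fix k s' assume k: "k < n" and I: "?I k s'" and a: "scalar s' ''a'' = k"
      and un: "unchanged (insert ''a'' (assigned (for_up ''b'' (mark_step c excl))))
        (stored (for_up ''b'' (mark_step c excl))) s s'"
    show "runs (for_up ''b'' (mark_step c excl)) (for_time n 3) s' (?I (Suc k))"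
    proof (rule runs_mark_row)
      show "memory s'" by (rule memory_unchanged[OF s(1) un]) simp_all
      show "arr s' c = col" "scalar s' ''i'' = i" "scalar s' ''h'' = h" "scalar s' ''a'' = k"
        using un s a by (simp_all add: unchanged_def)
      show "c \<noteq> ''mark''" "k < n" by fact+
      fix s'' assume M: "marked n s'' = marked n s' \<union> {v. k \<in> marked n s' \<and> ?r k v}"
      have "\<exists>a\<in>marked n s. ?r\<^sup>*\<^sup>* a b" if b: "b \<in> marked n s''" for b
      proof (cases "b \<in> marked n s'")
        case False
        then have "k \<in> marked n s'" "?r k b" using b M by auto
        moreover from this obtain a where "a \<in> marked n s" "?r\<^sup>*\<^sup>* a k" using I by blast
        ultimately show ?thesis using rtranclp.rtrancl_into_rtrancl[of ?r a k b] by blast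
      qed (use I in blast)
      moreover have "b \<in> marked n s''" if "a \<in> marked n s" "a < Suc k" "?r a b" for a b
        using that I unfolding M less_Suc_eq by blast
      moreover have "marked n s \<subseteq> marked n s''" using I M by blast
      ultimately show "?I (Suc k) s''" by blast
    qed
  next
    fix s' assume I: "?I n s'"
    have "\<forall>a\<in>marked n s. a < n" by (simp add: marked_def)
    then show "Q s'" using I by (intro Q) blast+
  qed auto
qed

text \<open>
  A round that marks no new vertex has reached the whole chain; otherwise the number of marked
  vertices grows. So \<open>n\<close> rounds suffice.
\<close>

lemma runs_mark_chain:
  assumes s: "memory s" "c \<noteq> ''mark''" "arr s c = col" "scalar s ''i'' = col x" "scalar s ''h'' = h"
    and x: "marked n s = {x}"
    and Q: "\<And>s'. marked n s' = kempe_chain E {v. v < n \<and> part v \<noteq> excl} col x h \<Longrightarrow> Q s'"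
  shows "runs (mark_chain c excl) (for_time n (for_time n (for_time n 3))) s Q"
  unfolding mark_chain_def
proof -
  let ?r = "step_rel col excl (col x) h"
  let ?C = "{v. ?r\<^sup>*\<^sup>* x v}"
  let ?I = "\<lambda>k s'. x \<in> marked n s' \<and> marked n s' \<subseteq> ?C \<and> (marked n s' = ?C \<or> k < card (marked n s'))"
  have fin: "finite (marked n s')" for s' by (simp add: marked_def)
  have C: "?C = kempe_chain E {v. v < n \<and> part v \<noteq> excl} col x h"
  proof -
    have "?r = (\<lambda>a b. E a b \<and> b \<in> {v. v < n \<and> part v \<noteq> excl} \<and> col b \<in> {col x, h})"
      using E_less by (auto simp: fun_eq_iff)
    then show ?thesis by (simp only: kempe_chain_def)
  qed
  have closed: "?C \<subseteq> M" if "x \<in> M" "\<And>a b. a \<in> M \<Longrightarrow> ?r a b \<Longrightarrow> b \<in> M" for M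
  proof
    fix v assume "v \<in> ?C"
    then have "?r\<^sup>*\<^sup>* x v" by simp
    then show "v \<in> M" by induction (use that in blast)+
  qed
  show "runs (for_up ''r'' (for_up ''a'' (for_up ''b'' (mark_step c excl))))
    (for_time n (for_time n (for_time n 3))) s Q"
  proof (rule runs_for_up[where I = ?I])
    show "scalar s ''n'' = n" using s by (simp add: memory_def)
  next
    fix k s' assume k: "k < n" and I: "?I k s'"
      and un: "unchanged (insert ''r'' (assigned (for_up ''a'' (for_up ''b'' (mark_step c excl)))))
        (stored (for_up ''a'' (for_up ''b'' (mark_step c excl)))) s s'"
    show "runs (for_up ''a'' (for_up ''b'' (mark_step c excl))) (for_time n (for_time n 3)) s' (?I (Suc k))"
    proof (rule runs_mark_round)
      show "memory s'" by (rule memory_unchanged[OF s(1) un]) simp_all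
      show "c \<noteq> ''mark''" by fact
      show "arr s' c = col" "scalar s' ''i'' = col x" "scalar s' ''h'' = h"
        using un s by (simp_all add: unchanged_def)
      fix s''
      assume sub: "marked n s' \<subseteq> marked n s''"
        and next_marked: "\<forall>a\<in>marked n s'. \<forall>b. ?r a b \<longrightarrow> b \<in> marked n s''"
        and reach: "\<forall>b\<in>marked n s''. \<exists>a\<in>marked n s'. ?r\<^sup>*\<^sup>* a b"
      have inC: "marked n s'' \<subseteq> ?C"
      proof
        fix b assume "b \<in> marked n s''"
        then obtain a where "a \<in> marked n s'" "?r\<^sup>*\<^sup>* a b" using reach by blast
        moreover from this have "?r\<^sup>*\<^sup>* x a" using I by blast
        ultimately show "b \<in> ?C" using rtranclp_trans[of ?r x a b] by simp
      qed
      have "marked n s'' = ?C \<or> Suc k < card (marked n s'')"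
      proof (cases "marked n s' = marked n s''")
        case True
        have "?C \<subseteq> marked n s''"
          by (rule closed) (use I True next_marked in blast)+
        then show ?thesis using inC by blast
      next
        case False
        then have "marked n s' \<subset> marked n s''" using sub by blast
        then have "card (marked n s') < card (marked n s'')" by (rule psubset_card_mono[OF fin])
        moreover have "marked n s' \<noteq> ?C" using False sub inC by blast
        ultimately show ?thesis using I by auto
      qed
      then show "?I (Suc k) s''" using inC sub I by blast
    qed
  next
    fix s' assume I: "?I n s'"
    have "card (marked n s') \<le> card {..<n}" by (intro card_mono) (auto simp: marked_def)
    then have "marked n s' = ?C" using I by auto
    then show "Q s'" using C by (intro Q) simp
  next
    show "?I 0 s" using x by auto
  qed auto
qed

end

definition kempe_improve :: "('a \<Rightarrow> 'a \<Rightarrow> bool) \<Rightarrow> 'a set \<Rightarrow> 'a set \<Rightarrow> 'a set \<Rightarrow>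
    ('a \<Rightarrow> nat) \<Rightarrow> ('a \<Rightarrow> nat) \<Rightarrow> 'a \<Rightarrow> 'a \<Rightarrow> 'a \<Rightarrow> nat" where
  "kempe_improve E S F K c d x y =
     (let C = kempe_chain E S c x (d y); c' = swap_on C (c x) (d y) c
      in if C \<inter> F = {} \<and> potential K c d < potential K c' d then c' else c)"

definition potential_step :: "string \<Rightarrow> string \<Rightarrow> string \<Rightarrow> com" where
  "potential_step p c d =
     Cond (Conj (Conj (Equal (Arr ''part'' (Var ''a'')) (Lit 3)) (Equal (Arr ''part'' (Var ''b'')) (Lit 3)))
                (Conj (Equal (Arr c (Var ''a'')) (Arr d (Var ''b''))) (Equal (Arr c (Var ''b'')) (Arr d (Var ''a'')))))
       (Cond (Equal (Var ''a'') (Var ''b'')) (Assign p (Plus (Var p) (Lit 2)))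
             (Assign p (Plus (Var p) (Lit 1))))
       Skip"

definition compute_potential :: "string \<Rightarrow> string \<Rightarrow> string \<Rightarrow> com" where
  "compute_potential p c d =
     Seq (Assign p (Lit 0)) (for_up ''a'' (for_up ''b'' (potential_step p c d)))"

lemma potential_vars [simp]:
  "assigned (potential_step p c d) = {p}" "stored (potential_step p c d) = {}"
  "assigned (compute_potential p c d) = {p, ''a'', ''b''}" "stored (compute_potential p c d) = {}"
  by (auto simp: potential_step_def compute_potential_def)

definition check_chain :: com where
  "check_chain = Seq (Assign ''ok'' (Lit 1))
     (for_up ''a'' (Cond (Conj (Equal (Arr ''mark'' (Var ''a'')) (Lit 1))
                               (Less (Arr ''part'' (Var ''a'')) (Lit 3)))
                      (Assign ''ok'' (Lit 0)) Skip))"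

definition swapped_copy :: "string \<Rightarrow> com" where
  "swapped_copy c = for_up ''a'' (Cond (Equal (Arr ''mark'' (Var ''a'')) (Lit 1))
     (Store ''new'' (Var ''a'') (Minus (Plus (Var ''i'') (Var ''h'')) (Arr c (Var ''a''))))
     (Store ''new'' (Var ''a'') (Arr c (Var ''a''))))"

definition copy_back :: "string \<Rightarrow> com" where
  "copy_back c = for_up ''a'' (Store c (Var ''a'') (Arr ''new'' (Var ''a'')))"

definition clear_marks :: com where
  "clear_marks = for_up ''a'' (Store ''mark'' (Var ''a'') (Lit 0))"

text \<open>
  The literal \<open>excl\<close> is the part that is missing on the side that is recolored: 5, that is \<open>R\<close>, for \<open>c1\<close>
  and 4, that is \<open>L\<close>, for \<open>c2\<close>. The swapped coloring is first written to the array \<open>new\<close>, so that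
  it can be dropped when the chain meets \<open>K1 \<union> K2\<close>, the parts below 3, or the potential does not grow.
\<close>

definition improve :: "string \<Rightarrow> string \<Rightarrow> nat \<Rightarrow> com" where
  "improve c d excl =
     Seq (Assign ''i'' (Arr c (Var ''x''))) (Seq (Assign ''h'' (Arr d (Var ''y'')))
     (Seq clear_marks (Seq (Store ''mark'' (Var ''x'') (Lit 1)) (Seq (mark_chain c excl)
     (Seq check_chain (Seq (swapped_copy c)
     (Seq (compute_potential ''p'' c d) (Seq (compute_potential ''q'' ''new'' d)
     (Cond (Conj (Equal (Var ''ok'') (Lit 1)) (Less (Var ''p'') (Var ''q''))) (copy_back c) Skip)))))))))"

lemma improve_vars [simp]:
  "assigned check_chain = {''ok'', ''a''}" "stored check_chain = {}"
  "assigned (swapped_copy c) = {''a''}" "stored (swapped_copy c) = {''new''}"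
  "assigned (copy_back c) = {''a''}" "stored (copy_back c) = {c}"
  "assigned clear_marks = {''a''}" "stored clear_marks = {''mark''}"
  "assigned (improve c d excl) = {''i'', ''h'', ''a'', ''b'', ''r'', ''ok'', ''p'', ''q''}"
  "stored (improve c d excl) = {''mark'', ''new'', c}"
  by (auto simp: check_chain_def swapped_copy_def copy_back_def clear_marks_def improve_def)

lemma runs_check_chain:
  assumes s: "scalar s ''n'' = n"
    and Q: "\<And>s'. (scalar s' ''ok'' = 1 \<longleftrightarrow> (\<forall>v\<in>marked n s. \<not> arr s ''part'' v < 3)) \<Longrightarrow> Q s'"
  shows "runs check_chain (1 + for_time n 3) s Q"
  unfolding check_chain_def
proof (rule runs_Seq'[OF runs_Assign[where Q = "\<lambda>s'. scalar s' ''ok'' = 1"]])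
  let ?c = "Cond (Conj (Equal (Arr ''mark'' (Var ''a'')) (Lit 1)) (Less (Arr ''part'' (Var ''a'')) (Lit 3)))
                      (Assign ''ok'' (Lit 0)) Skip"
  fix s1 :: state assume s1: "scalar s1 ''ok'' = 1"
    and u1: "frame (Assign ''ok'' (Lit 1)) s s1"
  let ?I = "\<lambda>k (s' :: state). scalar s' ''ok'' = 1 \<longleftrightarrow> (\<forall>v\<in>marked n s. v < k \<longrightarrow> \<not> arr s ''part'' v < 3)"
  show "runs (for_up ''a'' ?c) (for_time n 3) s1 Q"
  proof (rule runs_for_up[where I = ?I])
    show "scalar s1 ''n'' = n" using s u1 by (simp add: unchanged_def)
  next
    fix k and s' :: state assume k: "k < n" and I: "?I k s'" and a: "scalar s' ''a'' = k"
      and u: "unchanged (insert ''a'' (assigned ?c)) (stored ?c) s1 s'"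
    have ar: "arr s' = arr s" using u u1 by (auto simp: unchanged_def)
    have "runs ?c (1 + 1 + 1) s' (?I (Suc k))"
    proof (rule runs_Cond)
      assume "bval (Conj (Equal (Arr ''mark'' (Var ''a'')) (Lit 1)) (Less (Arr ''part'' (Var ''a'')) (Lit 3))) s'"
      then have "k \<in> marked n s" "arr s ''part'' k < 3" using a ar k by (auto simp: marked_def)
      then show "runs (Assign ''ok'' (Lit 0)) 1 s' (?I (Suc k))"
        by (intro runs_Assign) auto
    next
      assume "\<not> bval (Conj (Equal (Arr ''mark'' (Var ''a'')) (Lit 1)) (Less (Arr ''part'' (Var ''a'')) (Lit 3))) s'"
      then have "k \<in> marked n s \<longrightarrow> \<not> arr s ''part'' k < 3" using a ar by (auto simp: marked_def)
      then show "runs Skip 1 s' (?I (Suc k))"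
        using I by (intro runs_Skip) (auto simp: less_Suc_eq)
    qed
    then show "runs ?c 3 s' (?I (Suc k))" by (simp add: numeral_3_eq_3)
  next
    fix s' :: state assume "?I n s'"
    then show "Q s'" by (intro Q) (auto simp: marked_def)
  qed (use s1 in auto)
qed simp

lemma runs_fill:
  assumes s: "scalar s ''n'' = n" and c: "i \<noteq> ''n''" "i \<notin> assigned c" "''n'' \<notin> assigned c"
    and body: "\<And>k s'. k < n \<Longrightarrow> scalar s' i = k \<Longrightarrow> unchanged (insert i (assigned c)) (stored c) s s' \<Longrightarrow>
      arr s' a = (\<lambda>v. if v < k then f v else arr s a v) \<Longrightarrow>
      runs c T s' (\<lambda>s''. arr s'' a = (arr s' a)(k := f k))"
    and Q: "\<And>s'. arr s' a = (\<lambda>v. if v < n then f v else arr s a v) \<Longrightarrow>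
      unchanged (insert i (assigned c)) (stored c) s s' \<Longrightarrow> Q s'"
  shows "runs (for_up i c) (for_time n T) s Q"
proof (rule runs_for_up[where I = "\<lambda>k s'. arr s' a = (\<lambda>v. if v < k then f v else arr s a v)"])
  fix k and s' :: state assume k: "k < n" "scalar s' i = k" "unchanged (insert i (assigned c)) (stored c) s s'"
    and I: "arr s' a = (\<lambda>v. if v < k then f v else arr s a v)"
  show "runs c T s' (\<lambda>s''. arr s'' a = (\<lambda>v. if v < Suc k then f v else arr s a v))"
    by (rule runs_consequence[OF body[OF k I] order_refl]) (auto simp: I fun_eq_iff)
qed (use assms in auto)

lemma runs_clear_marks:
  assumes "scalar s ''n'' = n" "\<And>s'. marked n s' = {} \<Longrightarrow> Q s'"
  shows "runs clear_marks (for_time n 1) s Q"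
  unfolding clear_marks_def
proof (rule runs_fill[where a = "''mark''" and f = "\<lambda>v. 0"])
  fix k and s' :: state assume "scalar s' ''a'' = k"
  then show "runs (Store ''mark'' (Var ''a'') (Lit 0)) 1 s'
      (\<lambda>s''. arr s'' ''mark'' = (arr s' ''mark'')(k := 0))"
    by (intro runs_Store) simp
qed (use assms in \<open>auto simp: marked_def\<close>)

lemma runs_copy_back:
  assumes "scalar s ''n'' = n" "c \<noteq> ''new''"
    and "\<And>s'. arr s' c = (\<lambda>v. if v < n then arr s ''new'' v else arr s c v) \<Longrightarrow> Q s'"
  shows "runs (copy_back c) (for_time n 1) s Q"
  unfolding copy_back_def
proof (rule runs_fill[where a = c and f = "arr s ''new''"])
  let ?c = "Store c (Var ''a'') (Arr ''new'' (Var ''a''))"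
  fix k and s' :: state assume "scalar s' ''a'' = k" "unchanged (insert ''a'' (assigned ?c)) (stored ?c) s s'"
  then show "runs ?c 1 s' (\<lambda>s''. arr s'' c = (arr s' c)(k := arr s ''new'' k))"
    using assms(2) by (intro runs_Store) (simp add: unchanged_def)
qed (use assms in auto)

text \<open>
  On the marked vertices the color is \<open>i\<close> or \<open>h\<close>, so subtracting it from \<open>i + h\<close> gives the other one.
\<close>

lemma runs_swapped_copy:
  assumes s: "scalar s ''n'' = n" and c: "c \<noteq> ''new''" "arr s c = col"
    and ih: "scalar s ''i'' = i" "scalar s ''h'' = h"
    and M: "marked n s = M" "\<And>v. v \<in> M \<Longrightarrow> col v = i \<or> col v = h"
    and Q: "\<And>s'. (\<And>v. v < n \<Longrightarrow> arr s' ''new'' v = swap_on M i h col v) \<Longrightarrow> Q s'"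
  shows "runs (swapped_copy c) (for_time n 3) s Q"
  unfolding swapped_copy_def
proof (rule runs_fill[where a = "''new''" and f = "swap_on M i h col"])
  let ?c = "Cond (Equal (Arr ''mark'' (Var ''a'')) (Lit 1))
     (Store ''new'' (Var ''a'') (Minus (Plus (Var ''i'') (Var ''h'')) (Arr c (Var ''a''))))
     (Store ''new'' (Var ''a'') (Arr c (Var ''a'')))"
  fix k and s' :: state assume k: "k < n" "scalar s' ''a'' = k"
    and u: "unchanged (insert ''a'' (assigned ?c)) (stored ?c) s s'"
  have e: "arr s' c = col" "scalar s' ''i'' = i" "scalar s' ''h'' = h" "arr s' ''mark'' = arr s ''mark''"
    using u c ih by (simp_all add: unchanged_def)
  have m: "arr s ''mark'' k = 1 \<longleftrightarrow> k \<in> M" using k M(1) by (auto simp: marked_def)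
  have "runs ?c (1 + 1 + 1) s' (\<lambda>s''. arr s'' ''new'' = (arr s' ''new'')(k := swap_on M i h col k))"
  proof (rule runs_Cond)
    assume "bval (Equal (Arr ''mark'' (Var ''a'')) (Lit 1)) s'"
    then have kM: "k \<in> M" using e k m by simp
    have "i + h - col k = swap_on M i h col k"
      using M(2)[OF kM] kM by (auto simp: swap_on_def)
    then show "runs (Store ''new'' (Var ''a'') (Minus (Plus (Var ''i'') (Var ''h'')) (Arr c (Var ''a''))))
      1 s' (\<lambda>s''. arr s'' ''new'' = (arr s' ''new'')(k := swap_on M i h col k))"
      using e k by (intro runs_Store) simp
  next
    assume "\<not> bval (Equal (Arr ''mark'' (Var ''a'')) (Lit 1)) s'"
    then have "k \<notin> M" using e k m by simp
    then show "runs (Store ''new'' (Var ''a'') (Arr c (Var ''a'')))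
      1 s' (\<lambda>s''. arr s'' ''new'' = (arr s' ''new'')(k := swap_on M i h col k))"
      using e k by (intro runs_Store) (simp add: swap_on_def)
  qed
  then show "runs ?c 3 s' (\<lambda>s''. arr s'' ''new'' = (arr s' ''new'')(k := swap_on M i h col k))"
    by (simp add: numeral_3_eq_3)
qed (use s Q in auto)

lemma potential_as_nested_sum:
  fixes n :: nat
  shows "potential {v. v < n \<and> part v = (3::nat)} c d =
    (\<Sum>u<n. \<Sum>v<n. if part u = 3 \<and> part v = 3 \<and> c u = d v \<and> c v = d u
       then (if u = v then 2 else 1) else 0)"
proof -
  let ?K = "{v. v < n \<and> part v = 3}"
  let ?f = "\<lambda>u v. if c u = d v \<and> c v = d u then (if u = v then 2 else 1) else (0::nat)"
  have K: "?K = {v \<in> {..<n}. part v = 3}" by auto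
  have "potential ?K c d = (\<Sum>u<n. if part u = 3 then \<Sum>v\<in>?K. ?f u v else 0)"
    unfolding potential_def K by (rule sum.inter_filter) simp
  also have "\<dots> = (\<Sum>u<n. \<Sum>v<n. if part u = 3 \<and> part v = 3 \<and> c u = d v \<and> c v = d u
       then (if u = v then 2 else 1) else 0)"
  proof (rule sum.cong[OF refl])
    fix u
    have "(\<Sum>v\<in>?K. ?f u v) = (\<Sum>v<n. if part v = 3 then ?f u v else 0)"
      unfolding K by (rule sum.inter_filter) simp
    then show "(if part u = 3 then \<Sum>v\<in>?K. ?f u v else 0) =
      (\<Sum>v<n. if part u = 3 \<and> part v = 3 \<and> c u = d v \<and> c v = d u then (if u = v then 2 else 1) else 0)"
      by (auto intro: sum.cong)
  qed
  finally show ?thesis .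
qed

lemma runs_compute_potential:
  assumes s: "scalar s ''n'' = n" "p \<noteq> ''n''" "p \<noteq> ''a''" "p \<noteq> ''b''"
    and Q: "\<And>s'. scalar s' p = potential {v. v < n \<and> arr s ''part'' v = 3} (arr s c) (arr s d) \<Longrightarrow> Q s'"
  shows "runs (compute_potential p c d) (1 + for_time n (for_time n 5)) s Q"
  unfolding compute_potential_def
proof (rule runs_Seq'[OF runs_Assign[where Q = "\<lambda>s'. scalar s' p = 0"]])
  let ?f = "\<lambda>u v. if arr s ''part'' u = 3 \<and> arr s ''part'' v = 3 \<and> arr s c u = arr s d v \<and> arr s c v = arr s d u
       then (if u = v then 2 else 1) else (0::nat)"
  let ?b = "potential_step p c d"
  fix s1 :: state assume s1: "scalar s1 p = 0"
    and u1: "frame (Assign p (Lit 0)) s s1"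
  have ar1: "arr s1 = arr s" using u1 by (auto simp: unchanged_def)
  let ?I = "\<lambda>k (s' :: state). scalar s' p = (\<Sum>u<k. \<Sum>v<n. ?f u v)"
  show "runs (for_up ''a'' (for_up ''b'' ?b)) (for_time n (for_time n 5)) s1 Q"
  proof (rule runs_for_up[where I = ?I])
    show n1: "scalar s1 ''n'' = n" using s u1 by (simp add: unchanged_def)
    fix k and s2 :: state assume k: "k < n" and I: "?I k s2" and a: "scalar s2 ''a'' = k"
      and u2: "unchanged (insert ''a'' (assigned (for_up ''b'' ?b))) (stored (for_up ''b'' ?b)) s1 s2"
    have ar2: "arr s2 = arr s" using u2 ar1 by (auto simp: unchanged_def)
    let ?J = "\<lambda>j (s' :: state). scalar s' p = (\<Sum>u<k. \<Sum>v<n. ?f u v) + (\<Sum>v<j. ?f k v)"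
    show "runs (for_up ''b'' ?b) (for_time n 5) s2 (?I (Suc k))"
    proof (rule runs_for_up[where I = ?J])
      show "scalar s2 ''n'' = n" using s n1 u2 by (simp add: unchanged_def)
      fix j and s3 :: state assume j: "j < n" and J: "?J j s3" and b: "scalar s3 ''b'' = j"
        and u3: "unchanged (insert ''b'' (assigned ?b)) (stored ?b) s2 s3"
      have ar3: "arr s3 = arr s" using u3 ar2 by (auto simp: unchanged_def)
      have a3: "scalar s3 ''a'' = k" using a u3 s by (simp add: unchanged_def)
      have "runs ?b (1 + (1 + 1 + 1) + 1) s3 (?J (Suc j))"
        unfolding potential_step_def
        by (intro runs_Cond runs_Assign runs_Skip; insert J ar3 a3 b s(3,4); auto)
      moreover have "1 + (1 + 1 + 1) + 1 = (5 :: nat)" by simp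
      ultimately show "runs ?b 5 s3 (?J (Suc j))" by (simp only:)
    qed (use I s in auto)
  next
    fix s' :: state assume "?I n s'"
    then show "Q s'" by (intro Q) (simp only: potential_as_nested_sum)
  qed (use s s1 in auto)
qed simp

context graph_memory
begin

lemma runs_improve:
  assumes s: "memory s" and c: "c = ''c1'' \<or> c = ''c2''" and d: "d = ''c1'' \<or> d = ''c2''" "c \<noteq> d"
    and xy: "scalar s ''x'' = x" "x < n" "scalar s ''y'' = y"
    and Q: "\<And>s'. arr s' c = kempe_improve E {v. v < n \<and> part v \<noteq> excl} {v. v < n \<and> part v < 3}
        {v. v < n \<and> part v = 3} (arr s c) (arr s d) x y \<Longrightarrow>
      frame (improve c d excl) s s' \<Longrightarrow> Q s'"
    and x_side: "part x \<noteq> excl"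
  shows "runs (improve c d excl)
     (1 + (1 + (for_time n 1 + (1 + (for_time n (for_time n (for_time n 3)) + ((1 + for_time n 3) +
     (for_time n 3 + ((1 + for_time n (for_time n 5)) + ((1 + for_time n (for_time n 5)) +
     (1 + for_time n 1 + 1)))))))))) s Q"
proof -
  let ?S = "{v. v < n \<and> part v \<noteq> excl}" and ?K = "{v. v < n \<and> part v = 3}"
  define col where "col = arr s c"
  define other where "other = arr s d"
  define i where "i = col x"
  define h where "h = other y"
  define C where "C = kempe_chain E ?S col x h"
  define new where "new = swap_on C i h col"
  have C_sub: "C \<subseteq> ?S" unfolding C_def by (rule kempe_chain_subset) (use xy x_side in auto)
  have cd: "c \<notin> {''mark'', ''new'', ''part'', ''row'', ''adj''}" "d \<notin> {''mark'', ''new'', ''part'', ''row'', ''adj''}"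
    using c d by auto
  let ?inv = "\<lambda>s' :: state. memory s' \<and> arr s' c = col \<and> arr s' d = other \<and> scalar s' ''x'' = x \<and> scalar s' ''y'' = y"
  have inv0: "?inv s" using s xy by (simp add: col_def other_def)
  have inv: "?inv s''" if "?inv s'" "unchanged X A s' s''"
    "X \<subseteq> {''i'', ''h'', ''a'', ''b'', ''r'', ''ok'', ''p'', ''q''}" "A \<subseteq> {''mark'', ''new''}" for s' s'' X A
  proof -
    have u: "unchanged {''i'', ''h'', ''a'', ''b'', ''r'', ''ok'', ''p'', ''q''} {''mark'', ''new''} s' s''"
      by (rule unchanged_mono[OF that(2-4)])
    have "memory s''" by (rule memory_unchanged[OF _ u]) (use that(1) in auto)
    then show ?thesis using that(1) u cd by (simp add: unchanged_def)
  qed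
  have n: "scalar s' ''n'' = n" "arr s' ''part'' = part" if "?inv s'" for s'
    using that by (auto simp: memory_def)
  let ?F = "{v. v < n \<and> part v < 3}"
  let ?result = "kempe_improve E ?S ?F ?K col other x y"
  let ?end = "\<lambda>s' :: state. arr s' c = ?result"
  let ?ok = "\<lambda>s' :: state. scalar s' ''ok'' = 1 \<longleftrightarrow> C \<inter> ?F = {}"
  let ?new = "\<lambda>s' :: state. \<forall>v<n. arr s' ''new'' v = new v"
  let ?p = "\<lambda>s' :: state. scalar s' ''p'' = potential ?K col other"
  let ?q = "\<lambda>s' :: state. scalar s' ''q'' = potential ?K new other"
  have result: "?result = (if C \<inter> ?F = {} \<and> potential ?K col other < potential ?K new other then new else col)"
    by (simp add: kempe_improve_def Let_def C_def new_def i_def h_def)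
  have new_outside: "new v = col v" if "\<not> v < n" for v
    using that C_sub by (auto simp: new_def swap_on_def)
  have part_F: "(\<forall>v\<in>C. \<not> part v < 3) \<longleftrightarrow> C \<inter> ?F = {}" using C_sub by auto
  let ?test = "Conj (Equal (Var ''ok'') (Lit 1)) (Less (Var ''p'') (Var ''q''))"
  let ?commit = "Cond ?test (copy_back c) Skip"
  let ?Tc = "1 + for_time n 1 + 1" and ?Tp = "1 + for_time n (for_time n 5)"
  have finish: "runs ?commit ?Tc s' ?end"
    if "?inv s'" "?ok s'" "?new s'" "?p s'" "?q s'" for s'
  proof (rule runs_Cond)
    assume "bval ?test s'"
    then have "?result = new" using that by (simp add: result)
    then show "runs (copy_back c) (for_time n 1) s' ?end"
      using that cd n[OF that(1)] new_outside by (intro runs_copy_back) auto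
  next
    assume "\<not> bval ?test s'"
    then have "\<not> (C \<inter> ?F = {} \<and> potential ?K col other < potential ?K new other)"
      using that by simp
    then have "?result = col" unfolding result by (rule if_not_P)
    then show "runs Skip 1 s' ?end" using that by (intro runs_Skip) simp
  qed
  let ?second = "Seq (compute_potential ''q'' ''new'' d) ?commit"
  have second_potential: "runs ?second (?Tp + ?Tc) s' ?end"
    if "?inv s'" "?ok s'" "?new s'" "?p s'" for s'
  proof (rule runs_Seq'[OF runs_compute_potential[where Q = ?q]])
    fix s'' :: state assume q: "scalar s'' ''q'' = potential {v. v < n \<and> arr s' ''part'' v = 3} (arr s' ''new'') (arr s' d)"
    have "potential ?K (arr s' ''new'') other = potential ?K new other"
      using that(3) unfolding potential_def by (intro sum.cong refl) auto
    then show "?q s''" using q that(1) n(2)[OF that(1)] by simp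
  next
    fix s'' :: state assume q: "?q s''" and u: "frame (compute_potential ''q'' ''new'' d) s' s''"
    show "runs ?commit ?Tc s'' ?end"
    proof (rule finish[OF inv[OF that(1) u]])
      show "?ok s''" "?new s''" "?p s''" using that(2-4) u by (simp_all add: unchanged_def)
    qed (use q in auto)
  qed (use n[OF that(1)] in auto)
  have first_potential: "runs (Seq (compute_potential ''p'' c d) ?second) (?Tp + (?Tp + ?Tc)) s' ?end"
    if "?inv s'" "?ok s'" "?new s'" for s'
  proof (rule runs_Seq'[OF runs_compute_potential[where Q = ?p]])
    fix s'' :: state assume "scalar s'' ''p'' = potential {v. v < n \<and> arr s' ''part'' v = 3} (arr s' c) (arr s' d)"
    then show "?p s''" using that(1) n(2)[OF that(1)] by simp
  next
    fix s'' :: state assume p: "?p s''" and u: "frame (compute_potential ''p'' c d) s' s''"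
    show "runs ?second (?Tp + ?Tc) s'' ?end"
    proof (rule second_potential[OF inv[OF that(1) u]])
      show "?ok s''" "?new s''" using that(2,3) u by (simp_all add: unchanged_def)
    qed (use p in auto)
  qed (use n[OF that(1)] in auto)
  let ?tail = "Seq (compute_potential ''p'' c d) ?second"
  let ?T = "?Tp + (?Tp + ?Tc)"
  let ?ih = "\<lambda>s' :: state. scalar s' ''i'' = i \<and> scalar s' ''h'' = h"
  have copy: "runs (Seq (swapped_copy c) ?tail) (for_time n 3 + ?T) s' ?end"
    if "?inv s'" "?ok s'" "?ih s'" "marked n s' = C" for s'
  proof (rule runs_Seq'[OF runs_swapped_copy[where Q = ?new]])
    show "scalar s' ''n'' = n" "arr s' c = col" using that n by auto
    show "c \<noteq> ''new''" using cd by simp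
    show "scalar s' ''i'' = i" "scalar s' ''h'' = h" "marked n s' = C" using that by auto
    show "col v = i \<or> col v = h" if "v \<in> C" for v
      using kempe_chain_color[of v E ?S col x h] that by (auto simp: C_def i_def)
    show "\<And>s'. (\<And>v. v < n \<Longrightarrow> arr s' ''new'' v = swap_on C i h col v) \<Longrightarrow> ?new s'"
      by (simp add: new_def)
    fix s'' :: state assume new: "?new s''" and u: "frame (swapped_copy c) s' s''"
    show "runs ?tail ?T s'' ?end"
    proof (rule first_potential[OF inv[OF that(1) u]])
      show "?ok s''" using that(2) u by (simp add: unchanged_def)
    qed (use new in auto)
  qed
  have check: "runs (Seq check_chain (Seq (swapped_copy c) ?tail)) ((1 + for_time n 3) + (for_time n 3 + ?T)) s' ?end"
    if "?inv s'" "?ih s'" "marked n s' = C" for s'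
  proof (rule runs_Seq'[OF runs_check_chain[where Q = ?ok]])
    show "scalar s' ''n'' = n" using that n by auto
    show "?ok s''" if "scalar s'' ''ok'' = 1 \<longleftrightarrow> (\<forall>v\<in>marked n s'. \<not> arr s' ''part'' v < 3)" for s''
      using that part_F \<open>marked n s' = C\<close> n(2)[OF \<open>?inv s'\<close>] by simp
    fix s'' :: state assume ok: "?ok s''" and u: "frame check_chain s' s''"
    show "runs (Seq (swapped_copy c) ?tail) (for_time n 3 + ?T) s'' ?end"
    proof (rule copy[OF inv[OF that(1) u]])
      show "?ih s''" "marked n s'' = C" using that(2,3) u by (simp_all add: unchanged_def marked_def)
    qed (use ok in auto)
  qed
  let ?rest = "Seq (mark_chain c excl) (Seq check_chain (Seq (swapped_copy c) ?tail))"
  let ?U = "for_time n (for_time n (for_time n 3)) + ((1 + for_time n 3) + (for_time n 3 + ?T))"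
  have chain: "runs ?rest ?U s' ?end" if "?inv s'" "?ih s'" "marked n s' = {x}" for s'
  proof (rule runs_Seq'[OF runs_mark_chain[where Q = "\<lambda>s''. marked n s'' = C"]])
    show "memory s'" "arr s' c = col" "scalar s' ''i'' = col x" "scalar s' ''h'' = h" "marked n s' = {x}"
      using that by (auto simp: i_def)
    show "c \<noteq> ''mark''" using cd by simp
    show "\<And>s''. marked n s'' = kempe_chain E ?S col x h \<Longrightarrow> marked n s'' = C" by (simp add: C_def)
    fix s'' :: state assume C: "marked n s'' = C"
      and u: "frame (mark_chain c excl) s' s''"
    show "runs (Seq check_chain (Seq (swapped_copy c) ?tail)) ((1 + for_time n 3) + (for_time n 3 + ?T)) s'' ?end"
    proof (rule check[OF inv[OF that(1) u] _ C])
      show "?ih s''" using that(2) u by (simp add: unchanged_def)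
    qed auto
  qed
  have start: "runs (Seq (Store ''mark'' (Var ''x'') (Lit 1)) ?rest) (1 + ?U) s' ?end"
    if "?inv s'" "?ih s'" "marked n s' = {}" for s'
  proof (rule runs_Seq'[OF runs_Store[where Q = "\<lambda>s''. marked n s'' = {x}"]])
    show "marked n (s'\<lparr>arr := (arr s')(''mark'' := (arr s' ''mark'')(aval (Var ''x'') s' := aval (Lit 1) s'))\<rparr>) = {x}"
      using that xy by (auto simp: marked_def)
    fix s'' :: state assume m: "marked n s'' = {x}" and u: "frame (Store ''mark'' (Var ''x'') (Lit 1)) s' s''"
    show "runs ?rest ?U s'' ?end"
    proof (rule chain[OF inv[OF that(1) u] _ m])
      show "?ih s''" using that(2) u by (simp add: unchanged_def)
    qed auto
  qed
  have clear: "runs (Seq clear_marks (Seq (Store ''mark'' (Var ''x'') (Lit 1)) ?rest)) (for_time n 1 + (1 + ?U)) s' ?end"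
    if "?inv s'" "?ih s'" for s'
  proof (rule runs_Seq'[OF runs_clear_marks[where Q = "\<lambda>s''. marked n s'' = {}"]])
    show "scalar s' ''n'' = n" using that n by auto
    fix s'' :: state assume m: "marked n s'' = {}" and u: "frame clear_marks s' s''"
    show "runs (Seq (Store ''mark'' (Var ''x'') (Lit 1)) ?rest) (1 + ?U) s'' ?end"
    proof (rule start[OF inv[OF that(1) u] _ m])
      show "?ih s''" using that(2) u by (simp add: unchanged_def)
    qed auto
  qed
  have colors: "runs (improve c d excl) (1 + (1 + (for_time n 1 + (1 + ?U)))) s ?end"
    unfolding improve_def
  proof (rule runs_Seq'[OF runs_Assign[where Q = "\<lambda>s'. scalar s' ''i'' = i"]])
    show "scalar (s\<lparr>scalar := (scalar s)(''i'' := aval (Arr c (Var ''x'')) s)\<rparr>) ''i'' = i"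
      using xy by (simp add: i_def col_def)
    fix s1 :: state assume i1: "scalar s1 ''i'' = i" and u1: "frame (Assign ''i'' (Arr c (Var ''x''))) s s1"
    have inv1: "?inv s1" by (rule inv[OF inv0 u1]) auto
    show "runs (Seq (Assign ''h'' (Arr d (Var ''y''))) (Seq clear_marks (Seq (Store ''mark'' (Var ''x'') (Lit 1)) ?rest)))
       (1 + (for_time n 1 + (1 + ?U))) s1 ?end"
    proof (rule runs_Seq'[OF runs_Assign[where Q = "\<lambda>s'. scalar s' ''h'' = h"]])
      show "scalar (s1\<lparr>scalar := (scalar s1)(''h'' := aval (Arr d (Var ''y'')) s1)\<rparr>) ''h'' = h"
        using inv1 by (simp add: h_def)
      fix s2 :: state assume h2: "scalar s2 ''h'' = h" and u2: "frame (Assign ''h'' (Arr d (Var ''y''))) s1 s2"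
      show "runs (Seq clear_marks (Seq (Store ''mark'' (Var ''x'') (Lit 1)) ?rest)) (for_time n 1 + (1 + ?U)) s2 ?end"
      proof (rule clear[OF inv[OF inv1 u2]])
        show "?ih s2" using i1 h2 u2 by (simp add: unchanged_def)
      qed auto
    qed
  qed
  show ?thesis
    by (rule runs_consequence[OF colors order_refl Q]) (simp_all add: col_def other_def)
qed

end

section \<open>The local search program\<close>

definition improve_time :: "nat \<Rightarrow> nat" where
  "improve_time n =
     (1 + (1 + (for_time n 1 + (1 + (for_time n (for_time n (for_time n 3)) + ((1 + for_time n 3) +
     (for_time n 3 + ((1 + for_time n (for_time n 5)) + ((1 + for_time n (for_time n 5)) +
     (1 + for_time n 1 + 1))))))))))"

definition sweep_time :: "nat \<Rightarrow> nat" where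
  "sweep_time n = for_time n (for_time n (1 + (improve_time n + improve_time n) + 1))"

text \<open>
  The chain of \<open>x\<close> is tried in the color of \<open>x\<close> and the color of \<open>y\<close> in the other coloring. The choice
  \<open>y = x\<close> makes \<open>x\<close> agree, and other \<open>y\<close> serve to create pairs of opposite arrows. No other color
  is tried; in particular no color that is too large can come in.
\<close>

definition improve_both :: com where
  "improve_both = Cond (Conj (Equal (Arr ''part'' (Var ''x'')) (Lit 3)) (Equal (Arr ''part'' (Var ''y'')) (Lit 3)))
     (Seq (improve ''c1'' ''c2'' 5) (improve ''c2'' ''c1'' 4)) Skip"

definition sweep :: com where
  "sweep = for_up ''x'' (for_up ''y'' improve_both)"

lemma sweep_vars [simp]:
  "assigned improve_both = {''i'', ''h'', ''a'', ''b'', ''r'', ''ok'', ''p'', ''q''}"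
  "stored improve_both = {''mark'', ''new'', ''c1'', ''c2''}"
  "assigned sweep = {''i'', ''h'', ''a'', ''b'', ''r'', ''ok'', ''p'', ''q'', ''x'', ''y''}"
  "stored sweep = {''mark'', ''new'', ''c1'', ''c2''}"
  by (auto simp: improve_both_def sweep_def)

definition local_search :: com where
  "local_search = for_up ''t'' (Seq sweep sweep)"

lemma local_search_vars [simp]:
  "assigned local_search = {''i'', ''h'', ''a'', ''b'', ''r'', ''ok'', ''p'', ''q'', ''x'', ''y'', ''t''}"
  "stored local_search = {''mark'', ''new'', ''c1'', ''c2''}"
  by (auto simp: local_search_def)

lemma kempe_improve_cases:
  "kempe_improve E S F K c d x y = c \<or> potential K c d < potential K (kempe_improve E S F K c d x y) d"
  by (simp add: kempe_improve_def Let_def)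

definition (in graph_memory) improve_left :: "(nat \<Rightarrow> nat) \<Rightarrow> (nat \<Rightarrow> nat) \<Rightarrow> nat \<Rightarrow> nat \<Rightarrow> nat \<Rightarrow> nat" where
  "improve_left = kempe_improve E {v. v < n \<and> part v \<noteq> 5} {v. v < n \<and> part v < 3} {v. v < n \<and> part v = 3}"

definition (in graph_memory) improve_right :: "(nat \<Rightarrow> nat) \<Rightarrow> (nat \<Rightarrow> nat) \<Rightarrow> nat \<Rightarrow> nat \<Rightarrow> nat \<Rightarrow> nat" where
  "improve_right = kempe_improve E {v. v < n \<and> part v \<noteq> 4} {v. v < n \<and> part v < 3} {v. v < n \<and> part v = 3}"

text \<open>
  The predicate \<open>J\<close> stands for the properties of a pair of colorings that all swaps preserve. The search
  depends on it only through the following assumptions.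
\<close>

locale color_memory = graph_memory +
  fixes J :: "(nat \<Rightarrow> nat) \<Rightarrow> (nat \<Rightarrow> nat) \<Rightarrow> bool"
  assumes J1: "J a b \<Longrightarrow> x < n \<Longrightarrow> part x = 3 \<Longrightarrow> y < n \<Longrightarrow> part y = 3 \<Longrightarrow> J (improve_left a b x y) b"
    and J2: "J a b \<Longrightarrow> x < n \<Longrightarrow> part x = 3 \<Longrightarrow> y < n \<Longrightarrow> part y = 3 \<Longrightarrow> J a (improve_right b a x y)"
    and J_le: "J a b \<Longrightarrow> potential {v. v < n \<and> part v = 3} a b \<le> 2 * card {v. v < n \<and> part v = 3}"
    and J_optimal: "J a b \<Longrightarrow> (\<And>x y. x < n \<Longrightarrow> part x = 3 \<Longrightarrow> y < n \<Longrightarrow> part y = 3 \<Longrightarrow>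
        improve_left a b x y = a \<and> improve_right b a x y = b) \<Longrightarrow>
      potential {v. v < n \<and> part v = 3} a b = 2 * card {v. v < n \<and> part v = 3}"
begin

abbreviation "K \<equiv> {v. v < n \<and> part v = 3}"

text \<open>
  Either something has improved since the start of the sweep, or the colorings are still the initial ones
  and all pairs in \<open>P\<close> have been tried on them in vain.
\<close>

definition progress :: "(nat \<Rightarrow> nat) \<Rightarrow> (nat \<Rightarrow> nat) \<Rightarrow> (nat \<times> nat) set \<Rightarrow> (nat \<Rightarrow> nat) \<Rightarrow> (nat \<Rightarrow> nat) \<Rightarrow> bool" where
  "progress a0 b0 P a b \<longleftrightarrow> J a b \<and> (potential K a0 b0 < potential K a b \<or>
     a = a0 \<and> b = b0 \<and> (\<forall>(x, y) \<in> P. x \<in> K \<longrightarrow> y \<in> K \<longrightarrow> improve_left a0 b0 x y = a0 \<and> improve_right b0 a0 x y = b0))"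

lemma progress_step:
  assumes "progress a0 b0 P a b" "x \<in> K" "y \<in> K"
  shows "progress a0 b0 (insert (x, y) P) (improve_left a b x y) (improve_right b (improve_left a b x y) x y)"
proof -
  let ?a = "improve_left a b x y"
  let ?b = "improve_right b ?a x y"
  have "J a b" using assms(1) by (simp add: progress_def)
  then have "J ?a b" using J1 assms(2,3) by blast
  then have J: "J ?a ?b" using J2 assms(2,3) by blast
  have 1: "?a = a \<or> potential K a b < potential K ?a b"
    unfolding improve_left_def by (rule kempe_improve_cases)
  have "?b = b \<or> potential K b ?a < potential K ?b ?a"
    unfolding improve_right_def by (rule kempe_improve_cases)
  then have 2: "?b = b \<or> potential K ?a b < potential K ?a ?b"
    by (simp add: potential_commute)
  show ?thesis
  proof (cases "?a = a \<and> ?b = b")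
    case True
    then show ?thesis using assms(1) J by (auto simp: progress_def)
  next
    case False
    then have "potential K a b < potential K ?a ?b" using 1 2 by auto
    then show ?thesis using assms(1) J by (auto simp: progress_def)
  qed
qed

lemma runs_improve_both:
  assumes s: "memory s" "scalar s ''x'' = x" "x < n" "scalar s ''y'' = y" "y < n"
    and P: "progress a0 b0 P (arr s ''c1'') (arr s ''c2'')"
    and Q: "\<And>s'. progress a0 b0 (insert (x, y) P) (arr s' ''c1'') (arr s' ''c2'') \<Longrightarrow> Q s'"
  shows "runs improve_both (1 + (improve_time n + improve_time n) + 1) s Q"
  unfolding improve_both_def
proof (rule runs_Cond)
  assume "bval (Conj (Equal (Arr ''part'' (Var ''x'')) (Lit 3)) (Equal (Arr ''part'' (Var ''y'')) (Lit 3))) s"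
  then have xy: "part x = 3" "part y = 3" using s by (auto simp: memory_def)
  show "runs (Seq (improve ''c1'' ''c2'' 5) (improve ''c2'' ''c1'' 4)) (improve_time n + improve_time n) s Q"
  proof (rule runs_Seq')
    show "runs (improve ''c1'' ''c2'' 5) (improve_time n) s (\<lambda>s'. arr s' ''c1'' = improve_left (arr s ''c1'') (arr s ''c2'') x y)"
      unfolding improve_time_def improve_left_def
      by (rule runs_improve[OF s(1) _ _ _ s(2,3,4)]) (simp_all add: xy)
    fix s1 assume c1: "arr s1 ''c1'' = improve_left (arr s ''c1'') (arr s ''c2'') x y"
      and u: "frame (improve ''c1'' ''c2'' 5) s s1"
    have s1: "memory s1" by (rule memory_unchanged[OF s(1) u]) simp_all
    have xy1: "scalar s1 ''x'' = x" "scalar s1 ''y'' = y" "arr s1 ''c2'' = arr s ''c2''"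
      using s u by (simp_all add: unchanged_def)
    show "runs (improve ''c2'' ''c1'' 4) (improve_time n) s1 Q"
      unfolding improve_time_def
    proof (rule runs_improve[OF s1 _ _ _ xy1(1) s(3) xy1(2)])
      fix s2 :: state
      assume c2: "arr s2 ''c2'' = kempe_improve E {v. v < n \<and> part v \<noteq> 4} {v. v < n \<and> part v < 3} K
          (arr s1 ''c2'') (arr s1 ''c1'') x y"
        and u2: "frame (improve ''c2'' ''c1'' 4) s1 s2"
      have "arr s2 ''c1'' = arr s1 ''c1''" using u2 by (simp add: unchanged_def)
      then show "Q s2"
        using progress_step[OF P, of x y] s xy c1 c2 xy1 by (intro Q) (simp add: improve_right_def)
    qed (simp_all add: xy)
  qed
next
  assume "\<not> bval (Conj (Equal (Arr ''part'' (Var ''x'')) (Lit 3)) (Equal (Arr ''part'' (Var ''y'')) (Lit 3))) s"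
  then have "\<not> (x \<in> K \<and> y \<in> K)" using s by (auto simp: memory_def)
  then have "progress a0 b0 (insert (x, y) P) (arr s ''c1'') (arr s ''c2'')"
    using P unfolding progress_def by auto
  then show "runs Skip 1 s Q" by (intro runs_Skip Q)
qed

lemma runs_sweep:
  assumes s: "memory s" and J: "J (arr s ''c1'') (arr s ''c2'')"
    and Q: "\<And>s'. memory s' \<Longrightarrow> J (arr s' ''c1'') (arr s' ''c2'') \<Longrightarrow>
      potential K (arr s ''c1'') (arr s ''c2'') < potential K (arr s' ''c1'') (arr s' ''c2'') \<or>
      potential K (arr s' ''c1'') (arr s' ''c2'') = 2 * card K \<Longrightarrow> Q s'"
  shows "runs sweep (sweep_time n) s Q"
  unfolding sweep_def sweep_time_def
proof -
  define a0 b0 where "a0 = arr s ''c1''" and "b0 = arr s ''c2''"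
  let ?I = "\<lambda>k (s' :: state). progress a0 b0 {(x, y). x < k \<and> y < n} (arr s' ''c1'') (arr s' ''c2'')"
  let ?T = "1 + (improve_time n + improve_time n) + 1"
  show "runs (for_up ''x'' (for_up ''y'' improve_both)) (for_time n (for_time n ?T)) s Q"
  proof (rule runs_for_up[where I = ?I])
    show "scalar s ''n'' = n" using s by (simp add: memory_def)
    show "?I 0 s" using J by (simp add: progress_def a0_def b0_def)
  next
    fix k and s1 :: state
    assume k: "k < n" and I: "?I k s1" and x: "scalar s1 ''x'' = k"
      and u1: "unchanged (insert ''x'' (assigned (for_up ''y'' improve_both))) (stored (for_up ''y'' improve_both)) s s1"
    have s1: "memory s1" by (rule memory_unchanged[OF s u1]) simp_all
    let ?J = "\<lambda>j (s' :: state). progress a0 b0 ({(x, y). x < k \<and> y < n} \<union> {(x, y). x = k \<and> y < j})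
        (arr s' ''c1'') (arr s' ''c2'')"
    show "runs (for_up ''y'' improve_both) (for_time n ?T) s1 (?I (Suc k))"
    proof (rule runs_for_up[where I = ?J])
      show "scalar s1 ''n'' = n" using s1 by (simp add: memory_def)
      show "?J 0 s1" using I by simp
    next
      fix j and s2 :: state
      assume j: "j < n" and J: "?J j s2" and y: "scalar s2 ''y'' = j"
        and u2: "unchanged (insert ''y'' (assigned improve_both)) (stored improve_both) s1 s2"
      have s2: "memory s2" by (rule memory_unchanged[OF s1 u2]) simp_all
      have x2: "scalar s2 ''x'' = k" using x u2 by (simp add: unchanged_def)
      show "runs improve_both ?T s2 (?J (Suc j))"
      proof (rule runs_improve_both[OF s2 x2 k y j J])
        fix s3 :: state
        assume p: "progress a0 b0 (insert (k, j) ({(x, y). x < k \<and> y < n} \<union> {(x, y). x = k \<and> y < j}))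
          (arr s3 ''c1'') (arr s3 ''c2'')"
        have "insert (k, j) ({(x, y). x < k \<and> y < n} \<union> {(x, y). x = k \<and> y < j}) =
          {(x, y). x < k \<and> y < n} \<union> {(x, y). x = k \<and> y < Suc j}" by auto
        with p show "?J (Suc j) s3" by (simp only:)
      qed
    next
      fix s2 :: state
      assume J: "?J n s2"
      have "{(x, y). x < k \<and> y < n} \<union> {(x, y). x = k \<and> y < n} = {(x, y). x < Suc k \<and> y < n}" by auto
      with J show "?I (Suc k) s2" by (simp only:)
    qed auto
  next
    fix s' :: state
    assume I: "?I n s'"
      and u: "unchanged (insert ''x'' (assigned (for_up ''y'' improve_both))) (stored (for_up ''y'' improve_both)) s s'"
    let ?a = "arr s' ''c1''" and ?b = "arr s' ''c2''"
    have J': "J ?a ?b" using I by (simp add: progress_def)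
    have "potential K a0 b0 < potential K ?a ?b \<or> potential K ?a ?b = 2 * card K"
    proof (rule disjCI)
      assume n: "potential K ?a ?b \<noteq> 2 * card K"
      show "potential K a0 b0 < potential K ?a ?b"
      proof (rule ccontr)
        assume "\<not> ?thesis"
        then have *: "?a = a0" "?b = b0" "\<forall>x<n. \<forall>y<n. x \<in> K \<longrightarrow> y \<in> K \<longrightarrow> improve_left a0 b0 x y = a0 \<and> improve_right b0 a0 x y = b0"
          using I unfolding progress_def by auto
        have "potential K ?a ?b = 2 * card K"
          by (rule J_optimal[OF J']) (use * in simp)
        then show False using n by simp
      qed
    qed
    moreover have "memory s'" by (rule memory_unchanged[OF s u]) simp_all
    ultimately show "Q s'" using J' by (intro Q) (simp_all add: a0_def b0_def)
  qed auto
qed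

text \<open>
  Each sweep increases the potential unless it is maximal already. Two sweeps in each of the \<open>n\<close> rounds reach
  the maximum \<open>2 |K3| \<le> 2 n\<close>.
\<close>

lemma runs_local_search:
  assumes s: "memory s" and J: "J (arr s ''c1'') (arr s ''c2'')"
    and Q: "\<And>s'. memory s' \<Longrightarrow> J (arr s' ''c1'') (arr s' ''c2'') \<Longrightarrow>
      potential K (arr s' ''c1'') (arr s' ''c2'') = 2 * card K \<Longrightarrow> Q s'"
  shows "runs local_search (for_time n (sweep_time n + sweep_time n)) s Q"
  unfolding local_search_def
proof -
  let ?pot = "\<lambda>s' :: state. potential K (arr s' ''c1'') (arr s' ''c2'')"
  let ?I = "\<lambda>k (s' :: state). J (arr s' ''c1'') (arr s' ''c2'') \<and> (2 * k \<le> ?pot s' \<or> ?pot s' = 2 * card K)"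
  show "runs (for_up ''t'' (Seq sweep sweep)) (for_time n (sweep_time n + sweep_time n)) s Q"
  proof (rule runs_for_up[where I = ?I])
    show "scalar s ''n'' = n" using s by (simp add: memory_def)
  next
    fix k and s1 :: state
    assume I: "?I k s1" and u: "unchanged (insert ''t'' (assigned (Seq sweep sweep))) (stored (Seq sweep sweep)) s s1"
    have s1: "memory s1" by (rule memory_unchanged[OF s u]) simp_all
    show "runs (Seq sweep sweep) (sweep_time n + sweep_time n) s1 (?I (Suc k))"
    proof (rule runs_Seq)
      show "runs sweep (sweep_time n) s1 (\<lambda>s2. runs sweep (sweep_time n) s2 (?I (Suc k)))"
      proof (rule runs_sweep[OF s1])
        fix s2 :: state
        assume s2: "memory s2" "J (arr s2 ''c1'') (arr s2 ''c2'')"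
          and p2: "?pot s1 < ?pot s2 \<or> ?pot s2 = 2 * card K"
        show "runs sweep (sweep_time n) s2 (?I (Suc k))"
        proof (rule runs_sweep[OF s2])
          fix s3 :: state
          assume J3: "J (arr s3 ''c1'') (arr s3 ''c2'')"
            and p3: "?pot s2 < ?pot s3 \<or> ?pot s3 = 2 * card K"
          show "?I (Suc k) s3"
            using I p2 p3 J3 J_le[OF J3] by auto
        qed
      qed (use I in simp)
    qed
  next
    fix s' :: state
    assume I: "?I n s'"
      and u: "unchanged (insert ''t'' (assigned (Seq sweep sweep))) (stored (Seq sweep sweep)) s s'"
    have s': "memory s'" by (rule memory_unchanged[OF s u]) simp_all
    have "card K \<le> card {..<n}" by (rule card_mono) auto
    then have "?pot s' = 2 * card K" using I J_le[of "arr s' ''c1''" "arr s' ''c2''"] by auto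
    then show "Q s'" using I s' by (intro Q) auto
  qed (use J in auto)
qed

end

definition fill_rows :: com where
  "fill_rows = Seq (Assign ''e'' (Lit 0)) (for_up ''a''
     (Seq (Store ''row'' (Var ''a'') (Var ''e'')) (Assign ''e'' (Plus (Var ''e'') (Var ''n'')))))"

lemma fill_rows_vars [simp]: "assigned fill_rows = {''e'', ''a''}" "stored fill_rows = {''row''}"
  by (auto simp: fill_rows_def)

lemma runs_fill_rows:
  assumes s: "scalar s ''n'' = n" and Q: "\<And>s'. (\<forall>a<n. arr s' ''row'' a = a * n) \<Longrightarrow> Q s'"
  shows "runs fill_rows (1 + for_time n (1 + 1)) s Q"
  unfolding fill_rows_def
proof (rule runs_Seq'[OF runs_Assign[where Q = "\<lambda>s'. scalar s' ''e'' = 0"]])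
  let ?c = "Seq (Store ''row'' (Var ''a'') (Var ''e'')) (Assign ''e'' (Plus (Var ''e'') (Var ''n'')))"
  let ?I = "\<lambda>k (s' :: state). scalar s' ''e'' = k * n \<and> (\<forall>a<k. arr s' ''row'' a = a * n)"
  fix s1 :: state assume e: "scalar s1 ''e'' = 0"
    and u: "frame (Assign ''e'' (Lit 0)) s s1"
  show "runs (for_up ''a'' ?c) (for_time n (1 + 1)) s1 Q"
  proof (rule runs_for_up[where I = ?I])
    show n1: "scalar s1 ''n'' = n" using s u by (simp add: unchanged_def)
    fix k and s2 :: state assume I: "?I k s2" and a: "scalar s2 ''a'' = k"
      and u2: "unchanged (insert ''a'' (assigned ?c)) (stored ?c) s1 s2"
    have "scalar s2 ''n'' = n" using n1 u2 by (simp add: unchanged_def)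
    then show "runs ?c (1 + 1) s2 (?I (Suc k))"
      using I a by (intro runs_Seq runs_Store runs_Assign) (auto simp: less_Suc_eq)
  qed (use e in \<open>auto intro: Q\<close>)
qed simp

definition swap_colors :: com where
  "swap_colors = for_up ''y'' (Cond (Equal (Arr ''c2'' (Var ''y'')) (Var ''i'')) (Store ''c2'' (Var ''y'') (Var ''h''))
     (Cond (Equal (Arr ''c2'' (Var ''y'')) (Var ''h'')) (Store ''c2'' (Var ''y'') (Var ''i'')) Skip))"

text \<open>
  Vertex by vertex, the color of \<open>x\<close> in the second coloring is exchanged everywhere with its color in
  the first one.
\<close>

definition match_colors :: com where
  "match_colors = for_up ''x'' (Cond (Less (Arr ''part'' (Var ''x'')) (Lit 3))
     (Seq (Assign ''i'' (Arr ''c2'' (Var ''x''))) (Seq (Assign ''h'' (Arr ''c1'' (Var ''x''))) swap_colors)) Skip)"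

lemma match_colors_vars [simp]:
  "assigned swap_colors = {''y''}" "stored swap_colors = {''c2''}"
  "assigned match_colors = {''x'', ''i'', ''h'', ''y''}" "stored match_colors = {''c2''}"
  by (auto simp: swap_colors_def match_colors_def)

lemma runs_swap_colors:
  assumes s: "scalar s ''n'' = n" "scalar s ''i'' = i" "scalar s ''h'' = h"
    and Q: "\<And>s'. arr s' ''c2'' = swap_on {..<n} i h (arr s ''c2'') \<Longrightarrow> Q s'"
  shows "runs swap_colors (for_time n 5) s Q"
  unfolding swap_colors_def
proof (rule runs_fill[where a = "''c2''" and f = "\<lambda>v. transpose i h (arr s ''c2'' v)"])
  let ?d = "Cond (Equal (Arr ''c2'' (Var ''y'')) (Var ''h'')) (Store ''c2'' (Var ''y'') (Var ''i'')) Skip"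
  let ?c = "Cond (Equal (Arr ''c2'' (Var ''y'')) (Var ''i'')) (Store ''c2'' (Var ''y'') (Var ''h'')) ?d"
  fix k and s' :: state
  assume k: "scalar s' ''y'' = k" and u: "unchanged (insert ''y'' (assigned ?c)) (stored ?c) s s'"
    and I: "arr s' ''c2'' = (\<lambda>v. if v < k then transpose i h (arr s ''c2'' v) else arr s ''c2'' v)"
  have ih: "scalar s' ''i'' = i" "scalar s' ''h'' = h" using u s by (simp_all add: unchanged_def)
  have now: "arr s' ''c2'' k = arr s ''c2'' k" using I by simp
  have "runs ?c (1 + 1 + (1 + 1 + 1)) s' (\<lambda>s''. arr s'' ''c2'' = (arr s' ''c2'')(k := transpose i h (arr s ''c2'' k)))"
    by (intro runs_Cond runs_Store runs_Skip) (use k ih now in \<open>auto simp: fun_eq_iff transpose_def\<close>)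
  moreover have "1 + 1 + (1 + 1 + 1) = (5 :: nat)" by simp
  ultimately show "runs ?c 5 s' (\<lambda>s''. arr s'' ''c2'' = (arr s' ''c2'')(k := transpose i h (arr s ''c2'' k)))"
    by (simp only:)
qed (use s Q in \<open>auto simp: swap_on_def\<close>)

lemma runs_match_colors:
  assumes s: "scalar s ''n'' = n"
    and init: "I 0 (arr s ''c2'')"
    and step: "\<And>k b. k < n \<Longrightarrow> I k b \<Longrightarrow>
      I (Suc k) (if arr s ''part'' k < 3 then swap_on {..<n} (b k) (arr s ''c1'' k) b else b)"
    and Q: "\<And>s'. I n (arr s' ''c2'') \<Longrightarrow> Q s'"
  shows "runs match_colors (for_time n (1 + (1 + (1 + for_time n 5)) + 1)) s Q"
  unfolding match_colors_def
proof (rule runs_for_up[where I = "\<lambda>k s'. I k (arr s' ''c2'')"])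
  let ?d = "Seq (Assign ''i'' (Arr ''c2'' (Var ''x''))) (Seq (Assign ''h'' (Arr ''c1'' (Var ''x''))) swap_colors)"
  let ?c = "Cond (Less (Arr ''part'' (Var ''x'')) (Lit 3)) ?d Skip"
  fix k and s' :: state
  assume k: "k < n" and I: "I k (arr s' ''c2'')" and x: "scalar s' ''x'' = k"
    and u: "unchanged (insert ''x'' (assigned ?c)) (stored ?c) s s'"
  have e: "scalar s' ''n'' = n" "arr s' ''part'' = arr s ''part''" "arr s' ''c1'' = arr s ''c1''"
    using u s by (simp_all add: unchanged_def)
  note next_I = step[OF k I]
  show "runs ?c (1 + (1 + (1 + for_time n 5)) + 1) s' (\<lambda>s''. I (Suc k) (arr s'' ''c2''))"
  proof (rule runs_Cond)
    assume "bval (Less (Arr ''part'' (Var ''x'')) (Lit 3)) s'"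
    then have "arr s ''part'' k < 3" using e x by simp
    then show "runs ?d (1 + (1 + for_time n 5)) s' (\<lambda>s''. I (Suc k) (arr s'' ''c2''))"
      using next_I e x
      by (intro runs_Seq runs_Assign runs_swap_colors[where i = "arr s' ''c2'' k" and h = "arr s' ''c1'' k"]) auto
  next
    assume "\<not> bval (Less (Arr ''part'' (Var ''x'')) (Lit 3)) s'"
    then show "runs Skip 1 s' (\<lambda>s''. I (Suc k) (arr s'' ''c2''))"
      using next_I e x by (intro runs_Skip) simp
  qed
qed (use s init Q in auto)

definition merge_colors :: com where
  "merge_colors = for_up ''a'' (Cond (Equal (Arr ''part'' (Var ''a'')) (Lit 5))
     (Store ''col'' (Var ''a'') (Arr ''c2'' (Var ''a''))) (Store ''col'' (Var ''a'') (Arr ''c1'' (Var ''a''))))"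

lemma runs_merge_colors:
  assumes s: "scalar s ''n'' = n"
    and Q: "\<And>s'. (\<And>v. v < n \<Longrightarrow> arr s' ''col'' v =
      (if arr s ''part'' v = 5 then arr s ''c2'' v else arr s ''c1'' v)) \<Longrightarrow> Q s'"
  shows "runs merge_colors (for_time n (1 + 1 + 1)) s Q"
  unfolding merge_colors_def
proof (rule runs_fill[where a = "''col''" and
      f = "\<lambda>v. if arr s ''part'' v = 5 then arr s ''c2'' v else arr s ''c1'' v"])
  let ?c = "Cond (Equal (Arr ''part'' (Var ''a'')) (Lit 5))
     (Store ''col'' (Var ''a'') (Arr ''c2'' (Var ''a''))) (Store ''col'' (Var ''a'') (Arr ''c1'' (Var ''a'')))"
  fix k and s' :: state
  assume k: "scalar s' ''a'' = k" and u: "unchanged (insert ''a'' (assigned ?c)) (stored ?c) s s'"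
  have e: "arr s' ''part'' = arr s ''part''" "arr s' ''c1'' = arr s ''c1''" "arr s' ''c2'' = arr s ''c2''"
    using u by (simp_all add: unchanged_def)
  show "runs ?c (1 + 1 + 1) s' (\<lambda>s''. arr s'' ''col'' =
      (arr s' ''col'')(k := if arr s ''part'' k = 5 then arr s ''c2'' k else arr s ''c1'' k))"
    by (intro runs_Cond runs_Store) (use k e in auto)
qed (use s Q in auto)

section \<open>Correctness of the algorithm\<close>

context graph
begin

text \<open>
  No edge that leaves the chain ends in one of the two exchanged colors.
\<close>

lemma swap_on_kempe_chain_proper:
  assumes proper: "\<And>u v. u \<in> S \<Longrightarrow> v \<in> S \<Longrightarrow> u \<rightarrow> v \<Longrightarrow> c u \<noteq> c v"
    and C: "C = kempe_chain (dominates G) S c x h"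
    and uv: "u \<in> S" "v \<in> S" "u \<rightarrow> v"
  shows "swap_on C (c x) h c u \<noteq> swap_on C (c x) h c v"
proof -
  have boundary: "c q \<notin> {c x, h}" if "p \<in> C" "q \<notin> C" "q \<in> S" "p \<rightarrow> q" for p q
    using kempe_chain_step[of p "dominates G" S c x h q] that C by blast
  have colors: "c p \<in> {c x, h}" if "p \<in> C" for p
    using kempe_chain_color that C by metis
  have "transpose (c x) h (c p) \<noteq> c q" if "p \<in> C" "q \<notin> C" "q \<in> S" "p \<rightarrow> q" for p q
    using boundary[OF that] colors[OF that(1)] by auto
  then show ?thesis
    using proper[OF uv] uv adj_sym[OF uv(3)]
    by (cases "u \<in> C"; cases "v \<in> C")
      (auto simp: swap_on_def dest!: injD[OF bij_is_inj[OF bij_transpose]] dest: sym)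
qed

lemma swap_on_less:
  assumes "c v < k" "i < k" "h < k"
  shows "swap_on C i h c v < (k :: nat)"
  using assms by (auto simp: swap_on_def transpose_def)

lemma clique_number_induced_le:
  assumes "S \<subseteq> verts G"
  shows "clique_number (G \<restriction> S) \<le> clique_number G"
  unfolding clique_number_def
proof (rule Max_mono)
  show "card ` {X. clique (G \<restriction> S) X} \<subseteq> card ` {X. clique G X}"
    using assms by (auto simp: clique_def dominates_induce)
  show "card ` {X. clique (G \<restriction> S) X} \<noteq> {}" by (auto simp: clique_def intro: exI[of _ "{}"])
  have "{X. clique G X} \<subseteq> Pow (verts G)" by (auto simp: clique_def)
  then have "finite {X. clique G X}" by (rule finite_subset) simp
  then show "finite (card ` {X. clique G X})" by (rule finite_imageI)
qed

end

context good_partition_graph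
begin

definition valid_colorings :: "nat \<Rightarrow> ('a \<Rightarrow> nat) \<Rightarrow> ('a \<Rightarrow> nat) \<Rightarrow> bool" where
  "valid_colorings k a b \<longleftrightarrow> colored_good_partition G K1 K2 K3 L R a b \<and>
     (\<forall>v\<in>verts G - R. a v < k) \<and> (\<forall>v\<in>verts G - L. b v < k)"

lemma valid_coloringsI:
  assumes "\<And>x y. x \<in> verts G - R \<Longrightarrow> y \<in> verts G - R \<Longrightarrow> x \<rightarrow> y \<Longrightarrow> a x \<noteq> a y"
    and "\<And>x y. x \<in> verts G - L \<Longrightarrow> y \<in> verts G - L \<Longrightarrow> x \<rightarrow> y \<Longrightarrow> b x \<noteq> b y"
    and "\<And>x. x \<in> K1 \<union> K2 \<Longrightarrow> a x = b x"
    and "\<And>v. v \<in> verts G - R \<Longrightarrow> a v < k" "\<And>v. v \<in> verts G - L \<Longrightarrow> b v < k"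
  shows "valid_colorings k a b"
proof -
  have "colored_good_partition G K1 K2 K3 L R a b"
    by unfold_locales (use assms in auto)
  then show ?thesis using assms by (simp add: valid_colorings_def)
qed

lemma valid_coloringsD:
  assumes "valid_colorings k a b"
  shows "x \<in> verts G - R \<Longrightarrow> y \<in> verts G - R \<Longrightarrow> x \<rightarrow> y \<Longrightarrow> a x \<noteq> a y"
    and "x \<in> verts G - L \<Longrightarrow> y \<in> verts G - L \<Longrightarrow> x \<rightarrow> y \<Longrightarrow> b x \<noteq> b y"
    and "x \<in> K1 \<union> K2 \<Longrightarrow> a x = b x"
    and "x \<in> verts G - R \<Longrightarrow> a x < k" "x \<in> verts G - L \<Longrightarrow> b x < k"
proof -
  interpret c: colored_good_partition G K1 K2 K3 L R a b
    using assms by (simp add: valid_colorings_def)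
  show "x \<in> verts G - R \<Longrightarrow> y \<in> verts G - R \<Longrightarrow> x \<rightarrow> y \<Longrightarrow> a x \<noteq> a y"
    "x \<in> verts G - L \<Longrightarrow> y \<in> verts G - L \<Longrightarrow> x \<rightarrow> y \<Longrightarrow> b x \<noteq> b y"
    "x \<in> K1 \<union> K2 \<Longrightarrow> a x = b x"
    by (fact c.proper1 c.proper2 c.agree)+
  show "x \<in> verts G - R \<Longrightarrow> a x < k" "x \<in> verts G - L \<Longrightarrow> b x < k"
    using assms by (simp_all add: valid_colorings_def)
qed

lemma K3_sides: "x \<in> K3 \<Longrightarrow> x \<in> verts G - R" "x \<in> K3 \<Longrightarrow> x \<in> verts G - L"
  using verts_eq disjoint by auto

lemma improve_left_valid:
  assumes v: "valid_colorings k a b" and x: "x \<in> K3" "y \<in> K3"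
  shows "valid_colorings k (kempe_improve (dominates G) (verts G - R) (K1 \<union> K2) K3 a b x y) b"
proof -
  define C where "C = kempe_chain (dominates G) (verts G - R) a x (b y)"
  note d = valid_coloringsD[OF v]
  have "valid_colorings k (swap_on C (a x) (b y) a) b" if C0: "C \<inter> (K1 \<union> K2) = {}"
  proof (rule valid_coloringsI)
    show "swap_on C (a x) (b y) a p \<noteq> swap_on C (a x) (b y) a q"
      if "p \<in> verts G - R" "q \<in> verts G - R" "p \<rightarrow> q" for p q
      by (rule swap_on_kempe_chain_proper[OF d(1) C_def that])
    show "swap_on C (a x) (b y) a p < k" if "p \<in> verts G - R" for p
      using d(4)[OF that] d(4)[OF K3_sides(1)[OF x(1)]] d(5)[OF K3_sides(2)[OF x(2)]]
      by (rule swap_on_less)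
    show "swap_on C (a x) (b y) a p = b p" if "p \<in> K1 \<union> K2" for p
      using d(3)[OF that] C0 that by (auto simp: swap_on_def)
  qed (use d in auto)
  then show ?thesis using v by (simp add: kempe_improve_def Let_def flip: C_def)
qed

lemma improve_right_valid:
  assumes v: "valid_colorings k a b" and x: "x \<in> K3" "y \<in> K3"
  shows "valid_colorings k a (kempe_improve (dominates G) (verts G - L) (K1 \<union> K2) K3 b a x y)"
proof -
  define C where "C = kempe_chain (dominates G) (verts G - L) b x (a y)"
  note d = valid_coloringsD[OF v]
  have "valid_colorings k a (swap_on C (b x) (a y) b)" if C0: "C \<inter> (K1 \<union> K2) = {}"
  proof (rule valid_coloringsI)
    show "swap_on C (b x) (a y) b p \<noteq> swap_on C (b x) (a y) b q"
      if "p \<in> verts G - L" "q \<in> verts G - L" "p \<rightarrow> q" for p q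
      by (rule swap_on_kempe_chain_proper[OF d(2) C_def that])
    show "swap_on C (b x) (a y) b p < k" if "p \<in> verts G - L" for p
      using d(5)[OF that] d(5)[OF K3_sides(2)[OF x(1)]] d(4)[OF K3_sides(1)[OF x(2)]]
      by (rule swap_on_less)
    show "a p = swap_on C (b x) (a y) b p" if "p \<in> K1 \<union> K2" for p
      using d(3)[OF that] C0 that by (auto simp: swap_on_def)
  qed (use d in auto)
  then show ?thesis using v by (simp add: kempe_improve_def Let_def flip: C_def)
qed

lemma kempe_improve_fixed:
  assumes "kempe_improve E S F K c d x y = c" "C = kempe_chain E S c x (d y)" "C \<inter> F = {}"
  shows "\<not> potential K c d < potential K (swap_on C (c x) (d y) c) d"
proof
  assume "potential K c d < potential K (swap_on C (c x) (d y) c) d"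
  moreover from this have "swap_on C (c x) (d y) c = c"
    using assms by (simp add: kempe_improve_def Let_def)
  ultimately show False by simp
qed

lemma locally_optimal_agree:
  assumes v: "valid_colorings k a b"
    and opt: "\<And>x y. x \<in> K3 \<Longrightarrow> y \<in> K3 \<Longrightarrow>
      kempe_improve (dominates G) (verts G - R) (K1 \<union> K2) K3 a b x y = a \<and>
      kempe_improve (dominates G) (verts G - L) (K1 \<union> K2) K3 b a x y = b"
    and x: "x \<in> K3"
  shows "a x = b x"
proof -
  interpret colored_good_partition G K1 K2 K3 L R a b
    using v by (simp add: valid_colorings_def)
  interpret kempe_optimal G K1 K2 K3 L R a b
  proof unfold_locales
    fix p q C assume p: "p \<in> K3" "q \<in> K3" and C: "C \<inter> (K1 \<union> K2) = {}"
    show "\<not> potential K3 a b < potential K3 (swap_on C (a p) (b q) a) b"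
      if "C = kempe_chain (dominates G) (verts G - R) a p (b q)"
      using kempe_improve_fixed[OF conjunct1[OF opt[OF p]] that C] .
    show "\<not> potential K3 b a < potential K3 (swap_on C (b p) (a q) b) a"
      if "C = kempe_chain (dominates G) (verts G - L) b p (a q)"
      using kempe_improve_fixed[OF conjunct2[OF opt[OF p]] that C] .
  qed
  show ?thesis using x by (rule agree_on_K3)
qed

lemma valid_inj_on_K3:
  assumes "valid_colorings k a b"
  shows "inj_on a K3" "inj_on b K3"
proof -
  interpret colored_good_partition G K1 K2 K3 L R a b
    using assms by (simp add: valid_colorings_def)
  show "inj_on a K3" "inj_on b K3" by (rule inj1, rule inj2)
qed

text \<open>
  Every edge lies in \<open>G \ R\<close> or in \<open>G \ L\<close>, and the merged coloring coincides with the given one on either side.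
\<close>

lemma merge_proper:
  assumes v: "valid_colorings k a b" and eq: "\<And>x. x \<in> K3 \<Longrightarrow> a x = b x"
    and col: "\<And>x. x \<in> verts G \<Longrightarrow> col x = (if x \<in> R then b x else a x)"
  shows "proper_coloring G k col"
proof -
  note d = valid_coloringsD[OF v]
  have left: "col x = a x" if "x \<in> verts G - R" for x using col that by simp
  have right: "col x = b x" if "x \<in> verts G - L" for x
    using col[of x] that d(3)[of x] eq[of x] verts_eq by auto
  have "col x \<noteq> col y" if xy: "x \<in> verts G" "y \<in> verts G" "x \<rightarrow> y" for x y
  proof -
    have "(x \<in> verts G - R \<and> y \<in> verts G - R) \<or> (x \<in> verts G - L \<and> y \<in> verts G - L)"
      using xy L_R adj_sym disjoint(10) by blast
    then show ?thesis using left right d(1,2) xy(3) by metis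
  qed
  moreover have "col x < k" if "x \<in> verts G" for x
  proof (cases "x \<in> R")
    case True
    then have "x \<in> verts G - L" using that disjoint(10) by blast
    then show ?thesis using right d(5) by simp
  next
    case False
    then show ?thesis using left d(4) that by simp
  qed
  ultimately show ?thesis by (auto simp: proper_coloring_def)
qed

definition matched_below :: "nat \<Rightarrow> ('a \<Rightarrow> nat) \<Rightarrow> 'a set \<Rightarrow> ('a \<Rightarrow> nat) \<Rightarrow> bool" where
  "matched_below k a M b \<longleftrightarrow>
     (\<forall>x\<in>verts G - L. \<forall>y\<in>verts G - L. x \<rightarrow> y \<longrightarrow> b x \<noteq> b y) \<and>
     (\<forall>x\<in>verts G - L. b x < k) \<and> (\<forall>x\<in>M \<inter> (K1 \<union> K2). b x = a x)"

text \<open>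
  The vertices treated before keep their color: by properness it is neither \<open>b x\<close> nor \<open>a x\<close>.
\<close>

lemma matched_below_swap:
  assumes m: "matched_below k a M b" and x: "x \<in> K1 \<union> K2" "a x < k"
    and a: "\<And>y. y \<in> K1 \<union> K2 \<Longrightarrow> y \<noteq> x \<Longrightarrow> a y \<noteq> a x" and C: "verts G \<subseteq> C"
  shows "matched_below k a (insert x M) (swap_on C (b x) (a x) b)"
proof -
  let ?b = "swap_on C (b x) (a x) b"
  have b: "?b y = transpose (b x) (a x) (b y)" if "y \<in> verts G" for y
    using that C by (auto simp: swap_on_def)
  have K: "K1 \<union> K2 \<subseteq> verts G - L" using verts_eq disjoint by auto
  have "?b p \<noteq> ?b q" if "p \<in> verts G - L" "q \<in> verts G - L" "p \<rightarrow> q" for p q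
  proof -
    have "b p \<noteq> b q" using m that unfolding matched_below_def by blast
    then show ?thesis using b that by (simp add: inj_eq[OF bij_is_inj[OF bij_transpose]])
  qed
  moreover have "?b p < k" if "p \<in> verts G - L" for p
    using m x that K unfolding matched_below_def by (intro swap_on_less) auto
  moreover have "?b y = a y" if y: "y \<in> insert x M" "y \<in> K1 \<union> K2" for y
  proof (cases "y = x")
    case True
    then show ?thesis using b x K by auto
  next
    case False
    then have "y \<rightarrow> x" using clique12 y(2) x(1) by blast
    then have "b y \<noteq> b x" using m y(2) x(1) K unfolding matched_below_def by blast
    moreover have "b y = a y" using m y False unfolding matched_below_def by blast
    ultimately show ?thesis using b[of y] a[OF y(2) False] y(2) K by (auto simp: transpose_def)
  qed
  ultimately show ?thesis unfolding matched_below_def by blast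
qed

end

definition recoloring_program :: com where
  "recoloring_program = Seq fill_rows (Seq match_colors (Seq local_search merge_colors))"

definition program_time :: "nat \<Rightarrow> nat" where
  "program_time n = (1 + for_time n (1 + 1)) + (for_time n (1 + (1 + (1 + for_time n 5)) + 1) +
     (for_time n (sweep_time n + sweep_time n) + for_time n (1 + 1 + 1)))"

lemma poly_bounded_program_time: "poly_bounded program_time"
proof -
  have improve: "poly_bounded improve_time"
    unfolding improve_time_def
    by (intro poly_bounded_add poly_bounded_for_time poly_bounded_const)
  have "poly_bounded sweep_time"
    unfolding sweep_time_def
    by (intro poly_bounded_add poly_bounded_for_time poly_bounded_const improve)
  then show ?thesis
    unfolding program_time_def
    by (intro poly_bounded_add poly_bounded_for_time poly_bounded_const)
qed

lemma runs_recoloring_program: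
  fixes G :: "(nat, 'b) pre_digraph"
  assumes gp: "good_partition_graph G K1 K2 K3 L R" and V: "verts G = {..<n}"
    and c1: "proper_coloring (G \<restriction> (verts G - R)) k c1"
    and c2: "proper_coloring (G \<restriction> (verts G - L)) k c2"
  shows "runs recoloring_program (program_time n) (input_state n G K1 K2 K3 L R c1 c2)
    (\<lambda>s. proper_coloring G k (output_coloring s))"
proof -
  interpret good_partition_graph G K1 K2 K3 L R by (rule gp)
  define s0 where "s0 = input_state n G K1 K2 K3 L R c1 c2"
  define part where "part = arr s0 ''part''"
  define a where "a = arr s0 ''c1''"
  have part: "part v = (if v \<in> K1 then 1 else if v \<in> K2 then 2 else if v \<in> K3 then 3
                           else if v \<in> L then 4 else if v \<in> R then 5 else 0)" for v
    by (simp add: part_def s0_def input_state_def)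
  have in_V: "v \<in> verts G \<longleftrightarrow> v < n" for v using V by simp
  have sets: "{v. v < n \<and> part v \<noteq> 5} = verts G - R" "{v. v < n \<and> part v \<noteq> 4} = verts G - L"
    "{v. v < n \<and> part v < 3} = K1 \<union> K2" "{v. v < n \<and> part v = 3} = K3"
    unfolding in_V[symmetric] using verts_eq disjoint by (auto simp: part split: if_splits)
  have part3: "v < n \<and> part v = 3 \<longleftrightarrow> v \<in> K3" "v < n \<and> part v < 3 \<longleftrightarrow> v \<in> K1 \<union> K2" for v
    using sets(3,4) by blast+
  have part5: "part v = 5 \<longleftrightarrow> v \<in> R" if "v < n" for v
    using sets(1) that in_V by blast
  have a: "a v = c1 v" if "v \<in> verts G - R" for v
    using that by (simp add: a_def s0_def input_state_def)
  have b: "arr s0 ''c2'' v = c2 v" if "v \<in> verts G - L" for v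
    using that by (simp add: s0_def input_state_def)
  have a_proper: "a x \<noteq> a y" if "x \<in> verts G - R" "y \<in> verts G - R" "x \<rightarrow>\<^bsub>G\<^esub> y" for x y
    using c1 that a by (auto simp: proper_coloring_def dominates_induce)
  have a_less: "a x < k" if "x \<in> verts G - R" for x
    using c1 that a by (auto simp: proper_coloring_def)
  have matched0: "matched_below k a {} (arr s0 ''c2'')"
    using c2 b by (auto simp: matched_below_def proper_coloring_def dominates_induce)
  have n0: "scalar s0 ''n'' = n" by (simp add: s0_def input_state_def)
  interpret graph_memory n "dominates G" part
    by unfold_locales (use adj_in_verts in_V in auto)
  have left: "improve_left c d x y = kempe_improve (dominates G) (verts G - R) (K1 \<union> K2) K3 c d x y"
    and right: "improve_right c d x y = kempe_improve (dominates G) (verts G - L) (K1 \<union> K2) K3 c d x y"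
    for c d x y by (simp_all only: improve_left_def improve_right_def sets)
  interpret color_memory n "dominates G" part "valid_colorings k"
  proof (unfold_locales; (unfold sets(4))?)
    fix c d x y assume v: "valid_colorings k c d"
    show "potential K3 c d \<le> 2 * card K3"
      by (rule potential_le[OF finite_K3 valid_inj_on_K3[OF v]])
    show "valid_colorings k (improve_left c d x y) d" "valid_colorings k c (improve_right d c x y)"
      if "x < n" "part x = 3" "y < n" "part y = 3"
    proof -
      have xy: "x \<in> K3" "y \<in> K3" using that part3 by blast+
      show "valid_colorings k (improve_left c d x y) d" "valid_colorings k c (improve_right d c x y)"
        unfolding left right by (rule improve_left_valid[OF v xy], rule improve_right_valid[OF v xy])
    qed
    show "potential K3 c d = 2 * card K3"
      if opt: "\<And>x y. x < n \<Longrightarrow> part x = 3 \<Longrightarrow> y < n \<Longrightarrow> part y = 3 \<Longrightarrow>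
        improve_left c d x y = c \<and> improve_right d c x y = d"
    proof -
      have "\<forall>x\<in>K3. c x = d x"
      proof
        fix z assume "z \<in> K3"
        then show "c z = d z"
          by (rule locally_optimal_agree[OF v, rotated]) (use opt part3 left right in metis)
      qed
      then show ?thesis
        using potential_max_iff[OF finite_K3 valid_inj_on_K3[OF v]] by blast
    qed
  qed
  have K1_K2_left: "x \<in> verts G - R" if "x \<in> K1 \<union> K2" for x
    using that verts_eq disjoint(7,8) by auto
  have rows: "runs fill_rows (1 + for_time n (1 + 1)) s0 memory"
  proof (rule runs_consequence[OF runs_fill_rows[OF n0, where Q = "\<lambda>s. \<forall>v<n. arr s ''row'' v = v * n"] order_refl])
    fix s assume row: "\<forall>v<n. arr s ''row'' v = v * n"
      and u: "frame fill_rows s0 s"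
    have "arr s ''adj'' (u * n + v) = (if u \<rightarrow>\<^bsub>G\<^esub> v then 1 else 0)" if "u < n" "v < n" for u v
    proof -
      have "u * n + v < Suc u * n" using that by simp
      also have "\<dots> \<le> n * n" using that by (intro mult_le_mono1) simp
      finally have "u * n + v < n * n" .
      moreover have "(u * n + v) div n = u" "(u * n + v) mod n = v" using that by simp_all
      moreover have "arr s ''adj'' = arr s0 ''adj''" using u by (simp add: unchanged_def)
      ultimately show ?thesis by (simp add: s0_def input_state_def)
    qed
    moreover have "arr s ''part'' = part" "scalar s ''n'' = n"
      using u n0 by (simp_all add: unchanged_def part_def)
    ultimately show "memory s" using row by (simp add: memory_def)
  qed simp
  show ?thesis
    unfolding recoloring_program_def program_time_def s0_def[symmetric]
  proof (rule runs_Seq'[OF rows])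
    fix s1 assume s1: "memory s1" and u1: "frame fill_rows s0 s1"
    have e1: "scalar s1 ''n'' = n" "arr s1 ''part'' = part" using s1 by (simp_all add: memory_def)
    have c1: "arr s1 ''c1'' = a" "arr s1 ''c2'' = arr s0 ''c2''"
      using u1 by (simp_all add: unchanged_def a_def)
    show "runs (Seq match_colors (Seq local_search merge_colors))
      (for_time n (1 + (1 + (1 + for_time n 5)) + 1) +
       (for_time n (sweep_time n + sweep_time n) + for_time n (1 + 1 + 1))) s1
      (\<lambda>s. proper_coloring G k (output_coloring s))"
    proof (rule runs_Seq'[OF runs_match_colors[OF e1(1), where I = "\<lambda>j. matched_below k a {..<j}"
          and Q = "\<lambda>s. matched_below k a {..<n} (arr s ''c2'')"]])
      show "matched_below k a {..<0} (arr s1 ''c2'')" using matched0 c1 by simp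
      fix j d assume j: "j < n" and m: "matched_below k a {..<j} d"
      show "matched_below k a {..<Suc j}
        (if arr s1 ''part'' j < 3 then swap_on {..<n} (d j) (arr s1 ''c1'' j) d else d)"
      proof (cases "part j < 3")
        case True
        then have J: "j \<in> K1 \<union> K2" using part3 j by blast
        have "matched_below k a (insert j {..<j}) (swap_on {..<n} (d j) (a j) d)"
        proof (rule matched_below_swap[OF m J])
          show "a j < k" by (rule a_less[OF K1_K2_left[OF J]])
          show "a y \<noteq> a j" if "y \<in> K1 \<union> K2" "y \<noteq> j" for y
            by (rule a_proper[OF K1_K2_left[OF that(1)] K1_K2_left[OF J] clique12[OF that(1) J that(2)]])
        qed (simp add: V)
        then show ?thesis using True e1 c1 by (simp add: lessThan_Suc)
      next
        case False
        then have "j \<notin> K1 \<union> K2" using part3 by blast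
        then have "matched_below k a (insert j {..<j}) d"
          using m unfolding matched_below_def by blast
        then show ?thesis using False e1 by (simp add: lessThan_Suc)
      qed
    next
      fix s2 :: state
      assume m: "matched_below k a {..<n} (arr s2 ''c2'')"
        and u2: "frame match_colors s1 s2"
      have s2: "memory s2" by (rule memory_unchanged[OF s1 u2]) simp_all
      have a2: "arr s2 ''c1'' = a" using u2 c1 by (simp add: unchanged_def)
      have v2: "valid_colorings k (arr s2 ''c1'') (arr s2 ''c2'')"
        unfolding a2
      proof (rule valid_coloringsI)
        fix x assume "x \<in> K1 \<union> K2"
        moreover from this have "x < n" using K1_K2_left in_V by blast
        ultimately show "a x = arr s2 ''c2'' x" using m unfolding matched_below_def by simp
      qed (use m a_proper a_less in \<open>auto simp: matched_below_def\<close>)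
      show "runs (Seq local_search merge_colors)
        (for_time n (sweep_time n + sweep_time n) + for_time n (1 + 1 + 1)) s2
        (\<lambda>s. proper_coloring G k (output_coloring s))"
      proof (rule runs_Seq, rule runs_local_search[OF s2 v2])
        fix s3 :: state
        assume s3: "memory s3" and v3: "valid_colorings k (arr s3 ''c1'') (arr s3 ''c2'')"
          and "potential {v. v < n \<and> part v = 3} (arr s3 ''c1'') (arr s3 ''c2'') =
            2 * card {v. v < n \<and> part v = 3}"
        then have eq: "\<forall>x\<in>K3. arr s3 ''c1'' x = arr s3 ''c2'' x"
          using potential_max_iff[OF finite_K3 valid_inj_on_K3[OF v3]] unfolding sets by blast
        have e3: "scalar s3 ''n'' = n" "arr s3 ''part'' = part" using s3 by (simp_all add: memory_def)
        show "runs merge_colors (for_time n (1 + 1 + 1)) s3 (\<lambda>s. proper_coloring G k (output_coloring s))"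
        proof (rule runs_merge_colors[OF e3(1)])
          fix s4 :: state
          assume col: "\<And>v. v < n \<Longrightarrow> arr s4 ''col'' v =
            (if arr s3 ''part'' v = 5 then arr s3 ''c2'' v else arr s3 ''c1'' v)"
          show "proper_coloring G k (output_coloring s4)"
            by (rule merge_proper[OF v3]) (use eq col e3 part5 in_V in \<open>auto simp: output_coloring_def\<close>)
        qed
      qed
    qed
  qed
qed

theorem lemma2p2:
  shows "\<exists>(prog :: com) (q :: nat poly).
    \<forall>(G :: nat pair_pre_digraph) (n :: nat) (K1 :: nat set) (K2 :: nat set) (K3 :: nat set)
      (L :: nat set) (R :: nat set) (c1 :: nat \<Rightarrow> nat) (c2 :: nat \<Rightarrow> nat).
      pair_graph G \<and> pverts G = {..<n} \<and> square_free (with_proj G) \<and> berge (with_proj G) \<and>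
      good_partition (with_proj G) K1 K2 K3 L R \<and>
      proper_coloring (with_proj G \<restriction> (pverts G - R))
        (clique_number (with_proj G \<restriction> (pverts G - R))) c1 \<and>
      proper_coloring (with_proj G \<restriction> (pverts G - L))
        (clique_number (with_proj G \<restriction> (pverts G - L))) c2
      \<longrightarrow>
      (\<exists>t s. exec prog (input_state n (with_proj G) K1 K2 K3 L R c1 c2) t s \<and>
             t \<le> poly q n \<and>
             proper_coloring (with_proj G) (clique_number (with_proj G)) (output_coloring s))"
proof -
  obtain q :: "nat poly" where q: "\<And>n. program_time n = poly q n"
    using poly_bounded_program_time by (auto simp: poly_bounded_def)
  show ?thesis
  proof (intro exI[of _ recoloring_program] exI[of _ q] allI impI, elim conjE)
    fix G :: "nat pair_pre_digraph" and n K1 K2 K3 L R c1 c2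
    let ?G = "with_proj G"
    assume G: "pair_graph G" "pverts G = {..<n}" "square_free ?G" "berge ?G"
        "good_partition ?G K1 K2 K3 L R"
      and c1: "proper_coloring (?G \<restriction> (pverts G - R)) (clique_number (?G \<restriction> (pverts G - R))) c1"
      and c2: "proper_coloring (?G \<restriction> (pverts G - L)) (clique_number (?G \<restriction> (pverts G - L))) c2"
    interpret pair_graph G by (rule G(1))
    have gp: "good_partition_graph ?G K1 K2 K3 L R"
      by unfold_locales (use G in auto)
    interpret good_partition_graph ?G K1 K2 K3 L R by (rule gp)
    (* Colors below the clique number of a side are also below that of the whole graph. *)
    have more: "proper_coloring H (clique_number ?G) c"
      if "proper_coloring H (clique_number H) c" "H = ?G \<restriction> S" "S \<subseteq> pverts G"
      for H :: "(nat, nat \<times> nat) pre_digraph" and c S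
      using that clique_number_induced_le[of S] by (force simp: proper_coloring_def)
    have "runs recoloring_program (program_time n) (input_state n ?G K1 K2 K3 L R c1 c2)
      (\<lambda>s. proper_coloring ?G (clique_number ?G) (output_coloring s))"
      using G(2) more[OF c1 refl] more[OF c2 refl]
      by (intro runs_recoloring_program[OF gp]) auto
    then show "\<exists>t s. exec recoloring_program (input_state n ?G K1 K2 K3 L R c1 c2) t s \<and>
             t \<le> poly q n \<and> proper_coloring ?G (clique_number ?G) (output_coloring s)"
      unfolding runs_def q by blast
  qed
qed

end
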